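(* There are isomorphisms of bicomplexes $$(\Omega_{\bullet,\bullet},d^H,d^V)\cong(\mathrm{Com}^c(s\mathcal L)(K_\bullet),d^{CE},d^K_* ),\qquad (\tilde\Omega_{\bullet,\bullet},d^H,d^V)\cong(\mathrm{Com}^c(s\tilde{\mathcal L})(K_\bullet),d^{CE},d^K_* ),$$ where $\Omega_{\bullet,\bullet}$ is the aromatic bicomplex and $\tilde\Omega_{\bullet,\bullet}$ is the divergence-free aromatic bicomplex.
   Context: All vector spaces are over a field $\Bbbk$ of characteristic zero; complexes are homologically graded; $s$ is a formal symbol of degree $1$. Aromatic bicomplex. An aromatic forest is a non-empty finite directed graph each of whose connected components is either a rooted tree (all edges directed towards the root) or a directed cycle of rooted trees (a connected directed graph in which every vertex has exactly one outgoing edge; loops allowed). A labelled ordered aromatic forest is an aromatic forest whose tree components are linearly ordered (cycle components are unordered) and whose vertices are coloured black and white, the black ones being indistinguishable and the white ones labelled by $\{1,\dots,q\}$; they are considered up to isomorphism. $\Omega_{p,q}$ is obtained from the span of such forests with $p$ tree components and $q$ white vertices by anti-symmetrizing over permutations of the tree components and over permutations of the white labels. The horizontal differential $d^H\colon\Omega_{p,q}\to\Omega_{p-1,q}$ is the sum of all ways of adding an edge directed from the root of the last tree component to one of the vertices of the forest. The vertical differential $d^V$ (increasing the number of white vertices by one) is the skew-symmetrization over white vertices of the sum of all ways to replace a black vertex by a new white vertex. $\tilde\Omega_{\bullet,\bullet}$ is the quotient of $\Omega_{\bullet,\bullet}$ by the subcomplex of forests having at least one component with a directed cycle of length one. Lie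 algebras. Species are functors from finite sets and bijections to graded vector spaces, with tensor product $(\mathcal A\otimes\mathcal B)(I)=\bigoplus_{I=J\sqcup K}\mathcal A(J)\otimes\mathcal B(K)$ and Koszul signs. $\mathrm{RT}(I)$ has basis the rooted trees with vertex set $I$; $\mathrm{Cyc}(\mathrm{RT})(I)$ ($I\ne\varnothing$) has basis the directed cycles of rooted trees with vertex set $I$; $\mathrm{Cyc}^+(\mathrm{RT})$ is spanned by those with cycle of length at least two. For trees $T_1,T_2$, $T_1\triangleleft T_2$ is the sum over vertices $v$ of $T_1$ of the trees obtained by adding an edge from the root of $T_2$ to $v$, and $[T_1,T_2]=T_1\triangleleft T_2-T_2\triangleleft T_1$. For a directed cycle of trees $C$, $C\blacktriangleleft T$ is the sum over vertices $v$ of $C$ of the graphs obtained by adding an edge from the root of $T$ to $v$. The divergence $\mathrm{div}(T)$ (respectively the reduced divergence $\mathrm{div}_0(T)$) is the sum over all vertices (respectively all non-root vertices) $v$ of $T$ of the graphs obtained by adding an edge from the root of $T$ to $v$. $\mathcal L=\mathrm{RT}\oplus s^{-1}\mathrm{Cyc}(\mathrm{RT})$ and $\tilde{\mathcal L}=\mathrm{RT}\oplus s^{-1}\mathrm{Cyc}^+(\mathrm{RT})$ are the dg Lie algebras in species with differentials $T\mapsto s^{-1}\mathrm{div}(T)$, respectively $T\mapsto s^{-1}\mathrm{div}_0(T)$, and nonzero brackets $[T_1,T_2]$ and $[T,s^{-1}C]=-s^{-1}(C\blacktriangleleft T)$. For a dg Lie algebra $L$, $\mathrm{Com}^c(sL)=\bigoplus_{n\ge1}S^n(sL)$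 is the cofree non-counital cocommutative coalgebra and $d^{CE}=d_1^{CE}+d_2^{CE}$ is the Chevalley--Eilenberg differential, where $d_1^{CE}$ and $d_2^{CE}$ are the coderivations extending the differential of $sL$ and the degree $-1$ map $S^2(sL)\to sL$ induced by the bracket. Composite with $K_\bullet$. $K_\bullet$ is the acyclic two-term complex $\Bbbk\to\Bbbk$ with differential $d^K=\mathrm{id}$ from the even (degree $0$, "black") generator to the odd (degree $-1$, "white") generator. For a species $\mathcal A$, $\mathcal A(K_\bullet)=\mathcal A\circ K_\bullet=\bigoplus_{n\ge0}\mathcal A(\{1,\dots,n\})\otimes_{S_n}K_\bullet^{\otimes n}=\bigoplus_{p,q\ge 0}\mathcal A(\{1,\dots,p+q\})\otimes_{S_p\times S_q}(\mathrm{triv}_p\otimes\mathrm{sgn}_q)$, i.e. $\mathcal A$-structures with indistinguishable black labels and with white labels with respect to which the elements are skew-symmetric; $d^K_*$ is the differential induced by $d^K$, the sum of all ways of replacing a black label by a new white label, and $d^{CE}$ acts through $\mathrm{Com}^c(sL)$. In the isomorphisms, the first grading is the number of tree components (the degree in the Chevalley--Eilenberg complex), the second is given by the number of white vertices, and bicomplexes with commuting and with anticommuting differentials are identified by the usual change of signs. *)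

theory Defs
  imports Complex_Main "HOL-Library.Poly_Mapping" "HOL-Combinatorics.Permutations"
begin

section \<open>Free vector spaces\<close>

text \<open>The vector space with basis the type \<open>'b\<close> over a field \<open>'k\<close> is \<open>'b \<Rightarrow>\<^sub>0 'k\<close>; the basis
  vector of \<open>b\<close> is \<open>bas b\<close>, and \<open>lin f\<close> is the linear extension of a map defined on the basis.\<close>

definition fscale :: "'k::field \<Rightarrow> ('b \<Rightarrow>\<^sub>0 'k) \<Rightarrow> ('b \<Rightarrow>\<^sub>0 'k)"
  where "fscale c x = Poly_Mapping.map ((*) c) x"

lemma lookup_fscale [simp]: "Poly_Mapping.lookup (fscale c x) b = c * Poly_Mapping.lookup x b"
  by (auto simp: fscale_def Poly_Mapping.map.rep_eq when_def)

global_interpretation fvec: vector_space "fscale :: 'k::field \<Rightarrow> ('b \<Rightarrow>\<^sub>0 'k) \<Rightarrow> _"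
  by unfold_locales (auto intro!: poly_mapping_eqI simp: lookup_add algebra_simps)

definition bas :: "'b \<Rightarrow> ('b \<Rightarrow>\<^sub>0 'k::field)"
  where "bas b = Poly_Mapping.single b 1"

definition lin :: "('b \<Rightarrow> ('c \<Rightarrow>\<^sub>0 'k::field)) \<Rightarrow> ('b \<Rightarrow>\<^sub>0 'k) \<Rightarrow> ('c \<Rightarrow>\<^sub>0 'k)"
  where "lin f x = (\<Sum>b\<in>Poly_Mapping.keys x. fscale (Poly_Mapping.lookup x b) (f b))"

definition span_of :: "'b set \<Rightarrow> ('b \<Rightarrow>\<^sub>0 'k::field) set"
  where "span_of B = fvec.span (bas ` B)"

definition parity_sign :: "int \<Rightarrow> 'k::field"
  where "parity_sign d = (if even d then 1 else - 1)"


section \<open>Bicomplexes\<close>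

text \<open>Homological bidegrees \<open>(p, q)\<close> with \<open>p, q \<ge> 0\<close>: \<open>dh p q\<close> goes from bidegree \<open>(p, q)\<close> to
  \<open>(p - 1, q)\<close> and \<open>dv p q\<close> from \<open>(p, q)\<close> to \<open>(p, q + 1)\<close>.  The spaces with \<open>p = -1\<close> are zero, so
  \<open>dh 0 q\<close> carries no information and is never referred to.  The two differentials are required
  to commute; the convention with anticommuting differentials differs by signs.\<close>

record ('e, 'k) bicomplex =
  carr :: "nat \<Rightarrow> nat \<Rightarrow> 'e set"
  zer :: "nat \<Rightarrow> nat \<Rightarrow> 'e"
  add :: "nat \<Rightarrow> nat \<Rightarrow> 'e \<Rightarrow> 'e \<Rightarrow> 'e"
  scl :: "nat \<Rightarrow> nat \<Rightarrow> 'k \<Rightarrow> 'e \<Rightarrow> 'e"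
  dh :: "nat \<Rightarrow> nat \<Rightarrow> 'e \<Rightarrow> 'e"
  dv :: "nat \<Rightarrow> nat \<Rightarrow> 'e \<Rightarrow> 'e"

definition vector_space_on ::
  "'e set \<Rightarrow> 'e \<Rightarrow> ('e \<Rightarrow> 'e \<Rightarrow> 'e) \<Rightarrow> ('k::field \<Rightarrow> 'e \<Rightarrow> 'e) \<Rightarrow> bool"
  where "vector_space_on V z pl sc \<longleftrightarrow>
    z \<in> V \<and> (\<forall>x\<in>V. \<forall>y\<in>V. pl x y \<in> V) \<and> (\<forall>c. \<forall>x\<in>V. sc c x \<in> V) \<and>
    (\<forall>x\<in>V. \<forall>y\<in>V. \<forall>w\<in>V. pl (pl x y) w = pl x (pl y w)) \<and>
    (\<forall>x\<in>V. \<forall>y\<in>V. pl x y = pl y x) \<and>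
    (\<forall>x\<in>V. pl z x = x) \<and> (\<forall>x\<in>V. \<exists>y\<in>V. pl y x = z) \<and>
    (\<forall>c. \<forall>x\<in>V. \<forall>y\<in>V. sc c (pl x y) = pl (sc c x) (sc c y)) \<and>
    (\<forall>c d. \<forall>x\<in>V. sc (c + d) x = pl (sc c x) (sc d x)) \<and>
    (\<forall>c d. \<forall>x\<in>V. sc (c * d) x = sc c (sc d x)) \<and> (\<forall>x\<in>V. sc 1 x = x)"

definition linear_map_on ::
  "('e, 'k) bicomplex \<Rightarrow> nat \<Rightarrow> nat \<Rightarrow> ('f, 'k) bicomplex \<Rightarrow> nat \<Rightarrow> nat \<Rightarrow> ('e \<Rightarrow> 'f) \<Rightarrow> bool"
  where "linear_map_on A p q B r s f \<longleftrightarrow>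
    (\<forall>x\<in>carr A p q. f x \<in> carr B r s) \<and>
    (\<forall>x\<in>carr A p q. \<forall>y\<in>carr A p q. f (add A p q x y) = add B r s (f x) (f y)) \<and>
    (\<forall>c. \<forall>x\<in>carr A p q. f (scl A p q c x) = scl B r s c (f x))"

definition is_bicomplex :: "('e, 'k::field) bicomplex \<Rightarrow> bool"
  where "is_bicomplex A \<longleftrightarrow> (\<forall>p q.
    vector_space_on (carr A p q) (zer A p q) (add A p q) (scl A p q) \<and>
    linear_map_on A (Suc p) q A p q (dh A (Suc p) q) \<and>
    linear_map_on A p q A p (Suc q) (dv A p q) \<and>
    (\<forall>x\<in>carr A (Suc (Suc p)) q. dh A (Suc p) q (dh A (Suc (Suc p)) q x) = zer A p q) \<and>
    (\<forall>x\<in>carr A p q. dv A p (Suc q) (dv A p q x) = zer A p (Suc (Suc q))) \<and>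
    (\<forall>x\<in>carr A (Suc p) q.
      dh A (Suc p) (Suc q) (dv A (Suc p) q x) = dv A p q (dh A (Suc p) q x)))"

definition bicomplex_iso ::
  "('e, 'k::field) bicomplex \<Rightarrow> ('f, 'k) bicomplex \<Rightarrow> (nat \<Rightarrow> nat \<Rightarrow> 'e \<Rightarrow> 'f) \<Rightarrow> bool"
  where "bicomplex_iso A B f \<longleftrightarrow> is_bicomplex A \<and> is_bicomplex B \<and> (\<forall>p q.
    linear_map_on A p q B p q (f p q) \<and> bij_betw (f p q) (carr A p q) (carr B p q) \<and>
    (\<forall>x\<in>carr A (Suc p) q. f p q (dh A (Suc p) q x) = dh B (Suc p) q (f (Suc p) q x)) \<and>
    (\<forall>x\<in>carr A p q. f p (Suc q) (dv A p q x) = dv B p q (f p q x)))"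

definition bicomplex_isomorphic ::
  "('e, 'k::field) bicomplex \<Rightarrow> ('f, 'k) bicomplex \<Rightarrow> bool"  (infix "\<cong>\<^sub>b" 50)
  where "A \<cong>\<^sub>b B \<longleftrightarrow> (\<exists>f. bicomplex_iso A B f)"

definition free_bicomplex where
  "free_bicomplex V dH dV =
    \<lparr>carr = V, zer = (\<lambda>_ _. 0), add = (\<lambda>_ _. (+)), scl = (\<lambda>_ _. fscale), dh = dH, dv = dV\<rparr>"

definition coset :: "('b \<Rightarrow>\<^sub>0 'k::field) set \<Rightarrow> ('b \<Rightarrow>\<^sub>0 'k) \<Rightarrow> ('b \<Rightarrow>\<^sub>0 'k) set"
  where "coset W x = (+) x ` W"

definition quotient_bicomplex ::
  "('b \<Rightarrow>\<^sub>0 'k::field, 'k) bicomplex \<Rightarrow> (nat \<Rightarrow> nat \<Rightarrow> ('b \<Rightarrow>\<^sub>0 'k) set)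
    \<Rightarrow> (('b \<Rightarrow>\<^sub>0 'k) set, 'k) bicomplex"
  where "quotient_bicomplex A W =
    \<lparr>carr = (\<lambda>p q. coset (W p q) ` carr A p q),
     zer = W,
     add = (\<lambda>p q X Y. \<Union>x\<in>X. \<Union>y\<in>Y. coset (W p q) (add A p q x y)),
     scl = (\<lambda>p q c X. \<Union>x\<in>X. coset (W p q) (scl A p q c x)),
     dh = (\<lambda>p q X. \<Union>x\<in>X. coset (W (p - 1) q) (dh A p q x)),
     dv = (\<lambda>p q X. \<Union>x\<in>X. coset (W p (Suc q)) (dv A p q x))\<rparr>"


section \<open>Rooted trees and cycles of rooted trees\<close>

type_synonym 'v digraph = "'v set \<times> ('v \<times> 'v) set"

abbreviation verts :: "'v digraph \<Rightarrow> 'v set" where "verts \<equiv> fst"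
abbreviation edges :: "'v digraph \<Rightarrow> ('v \<times> 'v) set" where "edges \<equiv> snd"

definition finite_digraph :: "'v digraph \<Rightarrow> bool"
  where "finite_digraph G \<longleftrightarrow> finite (verts G) \<and> edges G \<subseteq> verts G \<times> verts G"

definition linked :: "'v digraph \<Rightarrow> ('v \<times> 'v) set"
  where "linked G = (edges G \<union> (edges G)\<inverse>)\<^sup>* \<inter> verts G \<times> verts G"

definition connected_digraph :: "'v digraph \<Rightarrow> bool"
  where "connected_digraph G \<longleftrightarrow> verts G \<noteq> {} \<and> linked G = verts G \<times> verts G"

definition components :: "'v digraph \<Rightarrow> 'v digraph set"
  where "components G = (\<lambda>C. (C, edges G \<inter> C \<times> C)) ` (verts G // linked G)"

text \<open>Edges point towards the root: the root has no outgoing edge, every other vertex has exactly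
  one, and following the edges from any vertex one arrives at the root.\<close>

definition rooted_tree :: "'v digraph \<Rightarrow> bool"
  where "rooted_tree G \<longleftrightarrow> finite_digraph G \<and> (\<exists>r\<in>verts G.
    (\<nexists>w. (r, w) \<in> edges G) \<and> (\<forall>v\<in>verts G - {r}. \<exists>!w. (v, w) \<in> edges G) \<and>
    (\<forall>v\<in>verts G. (v, r) \<in> (edges G)\<^sup>*))"

definition root :: "'v digraph \<Rightarrow> 'v"
  where "root G = (THE r. r \<in> verts G \<and> (\<nexists>w. (r, w) \<in> edges G))"

definition cycle_of_trees :: "'v digraph \<Rightarrow> bool"
  where "cycle_of_trees G \<longleftrightarrow> finite_digraph G \<and> connected_digraph G \<and>
    (\<forall>v\<in>verts G. \<exists>!w. (v, w) \<in> edges G)"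

text \<open>The vertices lying on the (unique) directed cycle are those reachable from themselves by a
  nonempty directed path.\<close>

definition cycle_length :: "'v digraph \<Rightarrow> nat"
  where "cycle_length G = card {v \<in> verts G. (v, v) \<in> (edges G)\<^sup>+}"


section \<open>The aromatic bicomplex\<close>

text \<open>The order of the tree components is recorded by the list of their roots, which are exactly
  the vertices without outgoing edge, and the white vertex with label \<open>i\<close> is \<open>whites F ! (i - 1)\<close>.
  Vertices that are not white are black.\<close>

record 'v forest =
  graph :: "'v digraph"
  roots :: "'v list"
  whites :: "'v list"

definition aromatic_forest :: "'v forest \<Rightarrow> bool"
  where "aromatic_forest F \<longleftrightarrow>
    finite_digraph (graph F) \<and> verts (graph F) \<noteq> {} \<and>
    (\<forall>C\<in>components (graph F). rooted_tree C \<or> cycle_of_trees C) \<and>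
    distinct (roots F) \<and> set (roots F) = root ` {C \<in> components (graph F). rooted_tree C} \<and>
    distinct (whites F) \<and> set (whites F) \<subseteq> verts (graph F)"

definition map_digraph :: "('v \<Rightarrow> 'w) \<Rightarrow> 'v digraph \<Rightarrow> 'w digraph"
  where "map_digraph \<phi> G = (\<phi> ` verts G, map_prod \<phi> \<phi> ` edges G)"

definition forest_iso :: "'v forest \<Rightarrow> 'w forest \<Rightarrow> bool"
  where "forest_iso F G \<longleftrightarrow> (\<exists>\<phi>. inj_on \<phi> (verts (graph F)) \<and>
    graph G = map_digraph \<phi> (graph F) \<and> roots G = map \<phi> (roots F) \<and> whites G = map \<phi> (whites F))"

type_synonym forest_class = "nat forest set"

definition forest_class :: "nat forest \<Rightarrow> forest_class"
  where "forest_class F = {G. forest_iso F G}"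

definition representative :: "forest_class \<Rightarrow> nat forest"
  where "representative c = (SOME F. F \<in> c)"

definition forest_classes :: "nat \<Rightarrow> nat \<Rightarrow> forest_class set"
  where "forest_classes p q =
    forest_class ` {F. aromatic_forest F \<and> length (roots F) = p \<and> length (whites F) = q}"

definition permute_trees :: "(nat \<Rightarrow> nat) \<Rightarrow> forest_class \<Rightarrow> forest_class"
  where "permute_trees \<sigma> c =
    (let F = representative c in forest_class (F\<lparr>roots := permute_list \<sigma> (roots F)\<rparr>))"

definition permute_whites :: "(nat \<Rightarrow> nat) \<Rightarrow> forest_class \<Rightarrow> forest_class"
  where "permute_whites \<sigma> c =
    (let F = representative c in forest_class (F\<lparr>whites := permute_list \<sigma> (whites F)\<rparr>))"

definition skew_trees :: "nat \<Rightarrow> (forest_class \<Rightarrow>\<^sub>0 'k) \<Rightarrow> (forest_class \<Rightarrow>\<^sub>0 'k::field_char_0)"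
  where "skew_trees p x = fscale (1 / fact p)
    (\<Sum>\<sigma> | \<sigma> permutes {..<p}. fscale (of_int (sign \<sigma>)) (lin (\<lambda>c. bas (permute_trees \<sigma> c)) x))"

definition skew_whites :: "nat \<Rightarrow> (forest_class \<Rightarrow>\<^sub>0 'k) \<Rightarrow> (forest_class \<Rightarrow>\<^sub>0 'k::field_char_0)"
  where "skew_whites q x = fscale (1 / fact q)
    (\<Sum>\<sigma> | \<sigma> permutes {..<q}. fscale (of_int (sign \<sigma>)) (lin (\<lambda>c. bas (permute_whites \<sigma> c)) x))"

definition skew_forests :: "nat \<Rightarrow> nat \<Rightarrow> forest_class set \<Rightarrow> (forest_class \<Rightarrow>\<^sub>0 'k::field_char_0) set"
  where "skew_forests p q S = (\<lambda>x. skew_trees p (skew_whites q x)) ` span_of S"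

definition Omega :: "nat \<Rightarrow> nat \<Rightarrow> (forest_class \<Rightarrow>\<^sub>0 'k::field_char_0) set"
  where "Omega p q = skew_forests p q (forest_classes p q)"

text \<open>The new edge turns its source from a root into an inner vertex.  If its target lies in
  another tree, the enlarged tree keeps the place of that tree in the order, which is recorded by
  its unchanged root.\<close>

definition attach_last :: "nat forest \<Rightarrow> nat \<Rightarrow> nat forest"
  where "attach_last F v =
    F\<lparr>graph := (verts (graph F), insert (last (roots F), v) (edges (graph F))),
      roots := butlast (roots F)\<rparr>"

definition horizontal :: "(forest_class \<Rightarrow>\<^sub>0 'k) \<Rightarrow> (forest_class \<Rightarrow>\<^sub>0 'k::field_char_0)"
  where "horizontal = lin (\<lambda>c. let F = representative c in
    \<Sum>v\<in>verts (graph F). bas (forest_class (attach_last F v)))"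

definition whiten :: "(forest_class \<Rightarrow>\<^sub>0 'k) \<Rightarrow> (forest_class \<Rightarrow>\<^sub>0 'k::field_char_0)"
  where "whiten = lin (\<lambda>c. let F = representative c in
    \<Sum>v\<in>verts (graph F) - set (whites F). bas (forest_class (F\<lparr>whites := whites F @ [v]\<rparr>)))"

definition aromatic_bicomplex :: "(forest_class \<Rightarrow>\<^sub>0 'k, 'k::field_char_0) bicomplex"
  where "aromatic_bicomplex =
    free_bicomplex Omega (\<lambda>p q. horizontal) (\<lambda>p q x. skew_whites (Suc q) (whiten x))"

definition loop_classes :: "nat \<Rightarrow> nat \<Rightarrow> forest_class set"
  where "loop_classes p q =
    forest_class ` {F. aromatic_forest F \<and> length (roots F) = p \<and> length (whites F) = q \<and>
      (\<exists>C\<in>components (graph F). cycle_of_trees C \<and> cycle_length C = 1)}"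

definition divergence_free_aromatic_bicomplex ::
  "((forest_class \<Rightarrow>\<^sub>0 'k) set, 'k::field_char_0) bicomplex"
  where "divergence_free_aromatic_bicomplex =
    quotient_bicomplex aromatic_bicomplex (\<lambda>p q. skew_forests p q (loop_classes p q))"


section \<open>The dg Lie algebras of rooted trees and cycles\<close>

text \<open>A dg Lie algebra in species whose underlying species is the linearisation of a graded species
  of sets.  The basis of the value at \<open>I\<close> is \<open>{b \<in> lie_basis L. lie_supp L b = I}\<close>, bijections act
  by \<open>lie_map\<close>, and the differential and the bracket are given on basis elements.  The bracket is
  only meaningful for basis elements with disjoint supports.\<close>

record (overloaded) ('v, 'b, 'k) dg_lie =
  lie_basis :: "'b set"
  lie_supp :: "'b \<Rightarrow> 'v set"
  lie_deg :: "'b \<Rightarrow> int"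
  lie_map :: "('v \<Rightarrow> 'v) \<Rightarrow> 'b \<Rightarrow> 'b"
  lie_diff :: "'b \<Rightarrow> ('b \<Rightarrow>\<^sub>0 'k)"
  lie_bracket :: "'b \<Rightarrow> 'b \<Rightarrow> ('b \<Rightarrow>\<^sub>0 'k)"

text \<open>\<open>Cyc C\<close> stands for the desuspended element of degree \<open>-1\<close> given by the cycle of trees \<open>C\<close>.\<close>

datatype 'v tree_or_cycle = Tree "'v digraph" | Cyc "'v digraph"

primrec toc_graph :: "'v tree_or_cycle \<Rightarrow> 'v digraph"
  where "toc_graph (Tree T) = T" | "toc_graph (Cyc C) = C"

primrec toc_deg :: "'v tree_or_cycle \<Rightarrow> int"
  where "toc_deg (Tree T) = 0" | "toc_deg (Cyc C) = - 1"

primrec toc_map :: "('v \<Rightarrow> 'v) \<Rightarrow> 'v tree_or_cycle \<Rightarrow> 'v tree_or_cycle"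
  where "toc_map \<phi> (Tree T) = Tree (map_digraph \<phi> T)" | "toc_map \<phi> (Cyc C) = Cyc (map_digraph \<phi> C)"

text \<open>\<open>grafts con G T\<close> is the sum over the vertices of \<open>G\<close> of the graphs obtained by adding an edge
  from the root of \<open>T\<close> to that vertex; \<open>close_up T S\<close> is the sum over \<open>v\<close> in \<open>S\<close> of the graphs
  obtained from \<open>T\<close> by adding an edge from its root to \<open>v\<close>.\<close>

definition grafts ::
  "('v digraph \<Rightarrow> 'v tree_or_cycle) \<Rightarrow> 'v digraph \<Rightarrow> 'v digraph \<Rightarrow> ('v tree_or_cycle \<Rightarrow>\<^sub>0 'k::field)"
  where "grafts con G T =
    (\<Sum>v\<in>verts G. bas (con (verts G \<union> verts T, insert (root T, v) (edges G \<union> edges T))))"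

definition close_up :: "'v digraph \<Rightarrow> 'v set \<Rightarrow> ('v tree_or_cycle \<Rightarrow>\<^sub>0 'k::field)"
  where "close_up T S = (\<Sum>v\<in>S. bas (Cyc (verts T, insert (root T, v) (edges T))))"

primrec div_diff :: "'v tree_or_cycle \<Rightarrow> ('v tree_or_cycle \<Rightarrow>\<^sub>0 'k::field)"
  where "div_diff (Tree T) = close_up T (verts T)" | "div_diff (Cyc C) = 0"

primrec div0_diff :: "'v tree_or_cycle \<Rightarrow> ('v tree_or_cycle \<Rightarrow>\<^sub>0 'k::field)"
  where "div0_diff (Tree T) = close_up T (verts T - {root T})" | "div0_diff (Cyc C) = 0"

fun toc_bracket ::
  "'v tree_or_cycle \<Rightarrow> 'v tree_or_cycle \<Rightarrow> ('v tree_or_cycle \<Rightarrow>\<^sub>0 'k::field)"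
  where
    "toc_bracket (Tree T1) (Tree T2) = grafts Tree T1 T2 - grafts Tree T2 T1"
  | "toc_bracket (Tree T) (Cyc C) = - grafts Cyc C T"
  | "toc_bracket (Cyc C) (Tree T) = grafts Cyc C T"
  | "toc_bracket (Cyc C) (Cyc D) = 0"

definition lie_L :: "('v, 'v tree_or_cycle, 'k::field) dg_lie"
  where "lie_L =
    \<lparr>lie_basis = Tree ` {T. rooted_tree T} \<union> Cyc ` {C. cycle_of_trees C},
     lie_supp = verts \<circ> toc_graph, lie_deg = toc_deg, lie_map = toc_map,
     lie_diff = div_diff, lie_bracket = toc_bracket\<rparr>"

definition lie_L_reduced :: "('v, 'v tree_or_cycle, 'k::field) dg_lie"
  where "lie_L_reduced =
    \<lparr>lie_basis = Tree ` {T. rooted_tree T} \<union> Cyc ` {C. cycle_of_trees C \<and> cycle_length C \<ge> 2},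
     lie_supp = verts \<circ> toc_graph, lie_deg = toc_deg, lie_map = toc_map,
     lie_diff = div0_diff, lie_bracket = toc_bracket\<rparr>"


section \<open>Coderivations of the symmetric coalgebra\<close>

text \<open>Elements of the tensor powers of a graded vector space with basis \<open>'b\<close> and degree function
  \<open>d\<close> are combinations of lists.  \<open>unshuffle_sum d xs g\<close> is the sum of \<open>\<epsilon> g a b\<close> over all
  ways to split \<open>xs\<close> into two complementary subsequences \<open>a\<close> and \<open>b\<close>, where \<open>\<epsilon>\<close> is the Koszul sign
  of the permutation from \<open>xs\<close> to \<open>a @ b\<close>.\<close>

definition total_deg :: "('b \<Rightarrow> int) \<Rightarrow> 'b list \<Rightarrow> int"
  where "total_deg d xs = (\<Sum>x\<leftarrow>xs. d x)"

primrec unshuffle_sum ::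
  "('b \<Rightarrow> int) \<Rightarrow> 'b list \<Rightarrow> ('b list \<Rightarrow> 'b list \<Rightarrow> ('c \<Rightarrow>\<^sub>0 'k::field)) \<Rightarrow> ('c \<Rightarrow>\<^sub>0 'k)"
  where
    "unshuffle_sum d [] g = g [] []"
  | "unshuffle_sum d (x # xs) g = unshuffle_sum d xs
      (\<lambda>a b. g (x # a) b + fscale (parity_sign (d x * total_deg d a)) (g a (x # b)))"

text \<open>The coderivation extending a map \<open>f\<close> defined on lists of length \<open>k\<close>:
  \<open>x\<^sub>1 \<dots> x\<^sub>n\<close> is sent to the sum over unshuffles of \<open>\<epsilon> f(a) b\<close>.  The theorems
  \<open>coderivation_is_coderivation\<close> and \<open>corestriction_coderivation\<close> below show that this is a
  coderivation for the unshuffle coproduct and that it extends \<open>f\<close>.\<close>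

definition coderivation ::
  "('b \<Rightarrow> int) \<Rightarrow> nat \<Rightarrow> ('b list \<Rightarrow> ('b \<Rightarrow>\<^sub>0 'k::field)) \<Rightarrow> 'b list \<Rightarrow> ('b list \<Rightarrow>\<^sub>0 'k)"
  where "coderivation d k f xs = unshuffle_sum d xs
    (\<lambda>a b. if length a = k then lin (\<lambda>y. bas (y # b)) (f a) else 0)"

definition coproduct :: "('b \<Rightarrow> int) \<Rightarrow> 'b list \<Rightarrow> ('b list \<times> 'b list \<Rightarrow>\<^sub>0 'k::field)"
  where "coproduct d xs = unshuffle_sum d xs (\<lambda>a b. if a = [] \<or> b = [] then 0 else bas (a, b))"

definition is_coderivation :: "('b \<Rightarrow> int) \<Rightarrow> ('b list \<Rightarrow> ('b list \<Rightarrow>\<^sub>0 'k::field)) \<Rightarrow> bool"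
  where "is_coderivation d D \<longleftrightarrow> (\<forall>xs. lin (coproduct d) (D xs) = lin (\<lambda>(a, b).
    lin (\<lambda>a'. bas (a', b)) (D a) + fscale (parity_sign (total_deg d a)) (lin (\<lambda>b'. bas (a, b')) (D b)))
    (coproduct d xs))"

lemma lin_superset:
  assumes "finite S" "Poly_Mapping.keys x \<subseteq> S"
  shows "lin f x = (\<Sum>b\<in>S. fscale (Poly_Mapping.lookup x b) (f b))"
  unfolding lin_def by (rule sum.mono_neutral_left) (use assms in \<open>auto simp: in_keys_iff\<close>)

lemma lin_add: "lin f (x + y) = lin f x + lin f y"
proof -
  let ?S = "Poly_Mapping.keys x \<union> Poly_Mapping.keys y"
  have "lin f z = (\<Sum>b\<in>?S. fscale (Poly_Mapping.lookup z b) (f b))" if "z \<in> {x, y, x + y}" for z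
    using that Poly_Mapping.keys_add[of x y] by (intro lin_superset) auto
  then show ?thesis
    by (simp add: lookup_add fvec.scale_left_distrib sum.distrib)
qed

lemma lin_scale: "lin f (fscale c x) = fscale c (lin f x)"
proof -
  have "Poly_Mapping.keys (fscale c x) \<subseteq> Poly_Mapping.keys x"
    by (auto simp: in_keys_iff)
  then have "lin f (fscale c x)
    = (\<Sum>b\<in>Poly_Mapping.keys x. fscale (Poly_Mapping.lookup (fscale c x) b) (f b))"
    by (intro lin_superset) auto
  then show ?thesis by (simp add: lin_def fvec.scale_sum_right)
qed

lemma lin_zero [simp]: "lin f 0 = 0"
  by (simp add: lin_def)

lemma lin_bas [simp]: "lin f (bas b) = f b"
  by (simp add: lin_def bas_def)

lemma lin_sum: "lin f (\<Sum>i\<in>S. g i) = (\<Sum>i\<in>S. lin f (g i))"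
  by (induction S rule: infinite_finite_induct) (auto simp: lin_add)

lemma lin_fun_add: "lin (\<lambda>b. f b + g b) x = lin f x + lin g x"
  by (simp add: lin_def fvec.scale_right_distrib sum.distrib)

lemma lin_fun_scale: "lin (\<lambda>b. fscale c (f b)) x = fscale c (lin f x)"
  by (simp add: lin_def fvec.scale_sum_right mult.commute)

lemma lin_fun_zero [simp]: "lin (\<lambda>b. 0) x = 0"
  by (simp add: lin_def)

lemma lin_cong: "(\<And>b. b \<in> Poly_Mapping.keys x \<Longrightarrow> f b = g b) \<Longrightarrow> lin f x = lin g x"
  by (simp add: lin_def)

lemma lin_lin: "lin f (lin g x) = lin (\<lambda>b. lin f (g b)) x"
  by (simp add: lin_def[of g] lin_def[of "\<lambda>b. lin f (g b)"] lin_sum lin_scale)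

lemma parity_sign_mult: "parity_sign a * parity_sign b = parity_sign (a + b)"
  by (simp add: parity_sign_def)

lemma parity_sign_cong: "even (a - b) \<Longrightarrow> parity_sign a = parity_sign b"
  by (auto simp: parity_sign_def)

lemma total_deg_simps [simp]:
  "total_deg d [] = 0" "total_deg d (x # xs) = d x + total_deg d xs"
  by (simp_all add: total_deg_def)

lemma unshuffle_sum_cong:
  assumes "\<And>a b. length a + length b = length xs \<Longrightarrow> total_deg d a + total_deg d b = total_deg d xs
    \<Longrightarrow> g a b = h a b"
  shows "unshuffle_sum d xs g = unshuffle_sum d xs h"
  using assms
proof (induction xs arbitrary: g h)
  case (Cons x xs)
  show ?case unfolding unshuffle_sum.simps
  proof (rule Cons.IH, goal_cases)
    case (1 a b)
    then have "g (x # a) b = h (x # a) b" "g a (x # b) = h a (x # b)"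
      by (auto intro!: Cons.prems)
    then show ?case by simp
  qed
qed simp

lemma unshuffle_sum_add:
  "unshuffle_sum d xs (\<lambda>a b. g a b + h a b) = unshuffle_sum d xs g + unshuffle_sum d xs h"
proof (induction xs arbitrary: g h)
  case (Cons x xs)
  show ?case
    by (simp add: Cons.IH[symmetric] fvec.scale_right_distrib algebra_simps)
qed simp

lemma unshuffle_sum_scale:
  "unshuffle_sum d xs (\<lambda>a b. fscale c (g a b)) = fscale c (unshuffle_sum d xs g)"
proof (induction xs arbitrary: g)
  case (Cons x xs)
  show ?case
    by (simp add: Cons.IH[symmetric] fvec.scale_right_distrib mult.commute)
qed simp

lemma unshuffle_sum_zero [simp]: "unshuffle_sum d xs (\<lambda>a b. 0) = 0"
  by (induction xs) auto

lemma lin_unshuffle_sum: "lin f (unshuffle_sum d xs g) = unshuffle_sum d xs (\<lambda>a b. lin f (g a b))"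
  by (induction xs arbitrary: g) (auto simp: lin_add lin_scale)

lemma unshuffle_sum_lin:
  "unshuffle_sum d xs (\<lambda>a b. lin (\<lambda>y. g y a b) z) = lin (\<lambda>y. unshuffle_sum d xs (g y)) z"
  by (induction xs arbitrary: g) (simp_all add: lin_fun_add[symmetric] lin_fun_scale[symmetric])

lemma unshuffle_sum_commute:
  fixes g :: "'b list \<Rightarrow> 'b list \<Rightarrow> ('c \<Rightarrow>\<^sub>0 'k::field)"
  shows "unshuffle_sum d xs g
    = unshuffle_sum d xs (\<lambda>a b. fscale (parity_sign (total_deg d a * total_deg d b)) (g b a))"
proof (induction xs arbitrary: g)
  case (Cons x xs)
  let ?s = "\<lambda>n. parity_sign n :: 'k"
  show ?case unfolding unshuffle_sum.simps
  proof (subst Cons.IH, rule unshuffle_sum_cong, goal_cases)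
    case (1 a b)
    let ?A = "total_deg d a" and ?B = "total_deg d b"
    have s: "?s (?A * ?B) * ?s (d x * ?B) = ?s ((d x + ?A) * ?B)"
      "?s (d x * ?A) * ?s (?A * (d x + ?B)) = ?s (?A * ?B)"
      unfolding parity_sign_mult by (rule parity_sign_cong; simp add: algebra_simps)+
    then show ?case by (simp add: fvec.scale_right_distrib add.commute)
  qed
qed (simp add: parity_sign_def)

lemma unshuffle_sum_assoc:
  "unshuffle_sum d xs (\<lambda>a b. unshuffle_sum d a (\<lambda>a1 a2. g a1 a2 b))
    = unshuffle_sum d xs (\<lambda>a b. unshuffle_sum d b (\<lambda>b1 b2. g a b1 b2))"
proof (induction xs arbitrary: g)
  case (Cons x xs)
  let ?s = "\<lambda>n. parity_sign (d x * n) :: 'b"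
  let ?h = "\<lambda>a b c. g (x # a) b c + fscale (?s (total_deg d a)) (g a (x # b) c)
    + fscale (?s (total_deg d a + total_deg d b)) (g a b (x # c))"
  have "unshuffle_sum d (x # xs) (\<lambda>a b. unshuffle_sum d a (\<lambda>a1 a2. g a1 a2 b))
    = unshuffle_sum d xs (\<lambda>a b. unshuffle_sum d a (\<lambda>a1 a2. ?h a1 a2 b))"
    unfolding unshuffle_sum.simps
  proof (rule unshuffle_sum_cong, goal_cases)
    case (1 a b)
    have "fscale (?s (total_deg d a)) (unshuffle_sum d a (\<lambda>a1 a2. g a1 a2 (x # b)))
      = unshuffle_sum d a (\<lambda>a1 a2. fscale (?s (total_deg d a1 + total_deg d a2)) (g a1 a2 (x # b)))"
      unfolding unshuffle_sum_scale[symmetric] by (rule unshuffle_sum_cong) simp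
    then show ?case by (simp add: unshuffle_sum_add)
  qed
  also have "\<dots> = unshuffle_sum d xs (\<lambda>a b. unshuffle_sum d b (\<lambda>b1 b2. ?h a b1 b2))"
    by (rule Cons.IH)
  also have "\<dots> = unshuffle_sum d (x # xs) (\<lambda>a b. unshuffle_sum d b (\<lambda>b1 b2. g a b1 b2))"
    unfolding unshuffle_sum.simps
    by (rule unshuffle_sum_cong)
       (simp add: unshuffle_sum_add unshuffle_sum_scale[symmetric] fvec.scale_right_distrib
          parity_sign_mult distrib_left add.assoc)
  finally show ?case .
qed simp

theorem coderivation_is_coderivation:
  assumes k: "k > 0"
    and deg: "\<And>a y. length a = k \<Longrightarrow> y \<in> Poly_Mapping.keys (f a) \<Longrightarrow> d y = total_deg d a - 1"
  shows "is_coderivation d (coderivation d k f)"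
  unfolding is_coderivation_def
proof
  fix xs
  let ?D = "coderivation d k f"
  let ?U = "unshuffle_sum d"
  define \<beta> :: "'a list \<Rightarrow> 'a list \<Rightarrow> 'a list \<times> 'a list \<Rightarrow>\<^sub>0 'b"
    where "\<beta> a b = (if a = [] \<or> b = [] then 0 else bas (a, b))" for a b
  define F where "F a g = (if length a = k then lin g (f a) else 0)"
    for a and g :: "'a \<Rightarrow> 'a list \<times> 'a list \<Rightarrow>\<^sub>0 'b"
  have Fadd: "F a (\<lambda>y. g y + h y) = F a g + F a h" for a g h
    by (simp add: F_def lin_fun_add)
  have Fscale: "F a (\<lambda>y. fscale c (g y)) = fscale c (F a g)" for a c g
    by (simp add: F_def lin_fun_scale)
  have Fcong: "F a g = F a h" if "\<And>y. d y = total_deg d a - 1 \<Longrightarrow> g y = h y" for a g h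
    using that deg by (auto simp: F_def intro!: lin_cong)
  have FU: "?U b (\<lambda>b1 b2. F a (\<lambda>y. g y b1 b2)) = F a (\<lambda>y. ?U b (g y))" for a b g
    by (simp add: F_def unshuffle_sum_lin)
  have linD: "lin g (?D b) = ?U b (\<lambda>b1 b2. F b1 (\<lambda>y. g (y # b2)))" for g b
    by (simp add: coderivation_def lin_unshuffle_sum F_def if_distrib lin_lin cong: if_cong)
  have coprod: "coproduct d b = ?U b \<beta>" for b
    unfolding coproduct_def \<beta>_def[abs_def] ..
  have left: "lin (\<lambda>a'. bas (a', b)) (?D a) = lin (\<lambda>a'. \<beta> a' b) (?D a)" if "b \<noteq> []" for a b
    unfolding linD using that by (simp add: \<beta>_def)
  have right: "lin (\<lambda>b'. bas (a, b')) (?D b) = lin (\<lambda>b'. \<beta> a b') (?D b)" if "a \<noteq> []" for a b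
    unfolding linD using that by (simp add: \<beta>_def)
  have D0: "?D [] = 0" using k by (simp add: coderivation_def)
  have \<beta>0: "\<beta> [] b = 0" "\<beta> b [] = 0" for b by (simp_all add: \<beta>_def)
  let ?s = "\<lambda>n. parity_sign n :: 'b"
  have "lin (\<lambda>(a, b). lin (\<lambda>a'. bas (a', b)) (?D a) + fscale (?s (total_deg d a)) (lin (\<lambda>b'. bas (a, b')) (?D b)))
      (coproduct d xs)
    = ?U xs (\<lambda>a b. lin (\<lambda>a'. \<beta> a' b) (?D a) + fscale (?s (total_deg d a)) (lin (\<lambda>b'. \<beta> a b') (?D b)))"
    unfolding coprod lin_unshuffle_sum
  proof (rule unshuffle_sum_cong, goal_cases)
    case (1 a b)
    show ?case
      by (cases "a = [] \<or> b = []") (auto simp: left right D0 \<beta>0, auto simp: \<beta>_def left right)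
  qed
  also have "\<dots> = ?U xs (\<lambda>a b. ?U a (\<lambda>a1 a2. F a1 (\<lambda>y. \<beta> (y # a2) b)))
    + ?U xs (\<lambda>a b. ?U b (\<lambda>b1 b2. fscale (?s (total_deg d a)) (F b1 (\<lambda>y. \<beta> a (y # b2)))))"
    by (simp add: unshuffle_sum_add linD unshuffle_sum_scale)
  also have "?U xs (\<lambda>a b. ?U b (\<lambda>b1 b2. fscale (?s (total_deg d a)) (F b1 (\<lambda>y. \<beta> a (y # b2)))))
    = ?U xs (\<lambda>a b. ?U a (\<lambda>a1 a2. fscale (?s (total_deg d a1)) (F a2 (\<lambda>y. \<beta> a1 (y # b)))))"
    by (rule unshuffle_sum_assoc[symmetric])
  also have "\<dots> = ?U xs (\<lambda>a b. ?U a (\<lambda>a1 a2. fscale (?s (total_deg d a1 * total_deg d a2))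
      (fscale (?s (total_deg d a2)) (F a1 (\<lambda>y. \<beta> a2 (y # b))))))"
    by (subst unshuffle_sum_commute) (rule refl)
  also have "\<dots> = ?U xs (\<lambda>a b. ?U b (\<lambda>b1 b2. fscale (?s (total_deg d a * total_deg d b1))
      (fscale (?s (total_deg d b1)) (F a (\<lambda>y. \<beta> b1 (y # b2))))))"
    by (rule unshuffle_sum_assoc)
  also have "?U xs (\<lambda>a b. ?U a (\<lambda>a1 a2. F a1 (\<lambda>y. \<beta> (y # a2) b)))
    = ?U xs (\<lambda>a b. ?U b (\<lambda>b1 b2. F a (\<lambda>y. \<beta> (y # b1) b2)))"
    by (rule unshuffle_sum_assoc)
  also have "?U xs (\<lambda>a b. ?U b (\<lambda>b1 b2. F a (\<lambda>y. \<beta> (y # b1) b2))) +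
      ?U xs (\<lambda>a b. ?U b (\<lambda>b1 b2. fscale (?s (total_deg d a * total_deg d b1))
        (fscale (?s (total_deg d b1)) (F a (\<lambda>y. \<beta> b1 (y # b2))))))
    = ?U xs (\<lambda>a b. ?U b (\<lambda>b1 b2. F a (\<lambda>y. \<beta> (y # b1) b2
        + fscale (?s (d y * total_deg d b1)) (\<beta> b1 (y # b2)))))"
  proof -
    have "F a (\<lambda>y. fscale (?s (d y * total_deg d b1)) (\<beta> b1 (y # b2)))
      = fscale (?s (total_deg d a * total_deg d b1)) (fscale (?s (total_deg d b1)) (F a (\<lambda>y. \<beta> b1 (y # b2))))"
      for a b1 b2
      unfolding Fscale[symmetric]
    proof (rule Fcong)
      fix y assume "d y = total_deg d a - 1"
      then have "?s (d y * total_deg d b1) = ?s (total_deg d a * total_deg d b1 + total_deg d b1)"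
        by (intro parity_sign_cong) (simp add: left_diff_distrib)
      then show "fscale (?s (d y * total_deg d b1)) (\<beta> b1 (y # b2))
        = fscale (?s (total_deg d a * total_deg d b1)) (fscale (?s (total_deg d b1)) (\<beta> b1 (y # b2)))"
        by (simp add: parity_sign_mult)
    qed
    then show ?thesis by (simp add: Fadd unshuffle_sum_add)
  qed
  also have "\<dots> = ?U xs (\<lambda>a b. F a (\<lambda>y. ?U (y # b) \<beta>))"
    by (simp only: FU unshuffle_sum.simps)
  also have "\<dots> = lin (coproduct d) (?D xs)"
    by (simp only: linD coprod)
  finally show "lin (coproduct d) (?D xs) = lin (\<lambda>(a, b). lin (\<lambda>a'. bas (a', b)) (?D a)
      + fscale (?s (total_deg d a)) (lin (\<lambda>b'. bas (a, b')) (?D b))) (coproduct d xs)" ..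
qed

text \<open>The component in the first tensor power determines a coderivation of the cofree conilpotent
  cocommutative coalgebra; here it is \<open>f\<close> on the \<open>k\<close>-th power and zero on the others.\<close>

definition corestriction :: "('b list \<Rightarrow>\<^sub>0 'k::field) \<Rightarrow> ('b \<Rightarrow>\<^sub>0 'k)"
  where "corestriction = lin (\<lambda>zs. case zs of [y] \<Rightarrow> bas y | _ \<Rightarrow> 0)"

lemma lin_bas_id: "lin bas x = x"
proof -
  have "Poly_Mapping.lookup (lin bas x) b = Poly_Mapping.lookup x b" for b
  proof -
    have "Poly_Mapping.lookup (\<Sum>c\<in>S. fscale (Poly_Mapping.lookup x c) (bas c)) b
      = (\<Sum>c\<in>S. Poly_Mapping.lookup (fscale (Poly_Mapping.lookup x c) (bas c)) b)" for S
      by (induction S rule: infinite_finite_induct) (auto simp: lookup_add)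
    then show ?thesis
      by (simp add: lin_def bas_def lookup_single when_def in_keys_iff if_distrib cong: if_cong)
  qed
  then show ?thesis by (rule poly_mapping_eqI)
qed

lemma unshuffle_sum_left:
  "unshuffle_sum d xs (\<lambda>a b. if b = [] then h a else 0) = h xs"
proof (induction xs arbitrary: h)
  case (Cons x xs)
  have "unshuffle_sum d (x # xs) (\<lambda>a b. if b = [] then h a else 0)
    = unshuffle_sum d xs (\<lambda>a b. if b = [] then h (x # a) else 0)"
    by simp
  then show ?case using Cons.IH[of "\<lambda>a. h (x # a)"] by simp
qed simp

theorem corestriction_coderivation:
  "corestriction (coderivation d k f xs) = (if length xs = k then f xs else 0)"
proof -
  have "lin (\<lambda>zs. case zs of [y] \<Rightarrow> bas y | _ \<Rightarrow> 0) (lin (\<lambda>y. bas (y # b)) z) = (if b = [] then z else 0)"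
    for b :: "'a list" and z :: "'a \<Rightarrow>\<^sub>0 'b"
    by (cases b) (simp_all add: lin_lin lin_bas_id)
  then have "corestriction (coderivation d k f xs)
    = unshuffle_sum d xs (\<lambda>a b. if b = [] then (if length a = k then f a else 0) else 0)"
    unfolding corestriction_def coderivation_def lin_unshuffle_sum
    by (intro unshuffle_sum_cong) auto
  then show ?thesis by (simp only: unshuffle_sum_left)
qed

section \<open>The Chevalley--Eilenberg complex\<close>

text \<open>A dg species presented by generators and relations: the value at \<open>I\<close> in degree \<open>n\<close> is the
  quotient of the space with basis \<open>gens S I n\<close> by the span of \<open>rels S I n\<close>.\<close>

record (overloaded) ('v, 'x, 'k) dg_species =
  gens :: "'v set \<Rightarrow> int \<Rightarrow> 'x set"
  rels :: "'v set \<Rightarrow> int \<Rightarrow> ('x \<Rightarrow>\<^sub>0 'k) set"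
  transport :: "('v \<Rightarrow> 'v) \<Rightarrow> 'x \<Rightarrow> 'x"
  diff :: "'x \<Rightarrow> ('x \<Rightarrow>\<^sub>0 'k)"

definition susp_deg :: "('v, 'b, 'k) dg_lie \<Rightarrow> 'b \<Rightarrow> int"
  where "susp_deg L b = lie_deg L b + 1"

text \<open>The differential \<open>s x \<mapsto> - s (d x)\<close> of \<open>s L\<close>, and the degree \<open>-1\<close> map
  \<open>s x \<otimes> s y \<mapsto> (-1)\<^bsup>|x|\<^esup> s [x, y]\<close>, which descends to the symmetric square.\<close>

definition ce1 :: "('v, 'b, 'k::field) dg_lie \<Rightarrow> 'b list \<Rightarrow> ('b \<Rightarrow>\<^sub>0 'k)"
  where "ce1 L xs = - lie_diff L (xs ! 0)"

definition ce2 :: "('v, 'b, 'k::field) dg_lie \<Rightarrow> 'b list \<Rightarrow> ('b \<Rightarrow>\<^sub>0 'k)"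
  where "ce2 L xs = fscale (parity_sign (lie_deg L (xs ! 0))) (lie_bracket L (xs ! 0) (xs ! 1))"

definition ce_differential :: "('v, 'b, 'k::field) dg_lie \<Rightarrow> 'b list \<Rightarrow> ('b list \<Rightarrow>\<^sub>0 'k)"
  where "ce_differential L xs =
    coderivation (susp_deg L) 1 (ce1 L) xs + coderivation (susp_deg L) 2 (ce2 L) xs"

lemma keys_fscale_subset: "Poly_Mapping.keys (fscale c x) \<subseteq> Poly_Mapping.keys x"
  by (auto simp: in_keys_iff)

lemma ce1_is_coderivation:
  assumes "\<And>b y. y \<in> Poly_Mapping.keys (lie_diff L b) \<Longrightarrow> lie_deg L y = lie_deg L b - 1"
  shows "is_coderivation (susp_deg L) (coderivation (susp_deg L) 1 (ce1 L))"
  using assms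
  by (intro coderivation_is_coderivation)
     (auto simp: ce1_def susp_deg_def length_Suc_conv)

lemma ce2_is_coderivation:
  assumes "\<And>b c y. y \<in> Poly_Mapping.keys (lie_bracket L b c) \<Longrightarrow> lie_deg L y = lie_deg L b + lie_deg L c"
  shows "is_coderivation (susp_deg L) (coderivation (susp_deg L) 2 (ce2 L))"
  using assms keys_fscale_subset
  by (intro coderivation_is_coderivation)
     (force simp: ce2_def susp_deg_def length_Suc_conv numeral_2_eq_2)+

lemma keys_sum_bas: "y \<in> Poly_Mapping.keys (\<Sum>v\<in>S. bas (g v)) \<Longrightarrow> \<exists>v\<in>S. y = g v"
  by (drule subsetD[OF Poly_Mapping.keys_sum]) (auto simp: bas_def split: if_splits)

lemma div_diff_deg:
  "y \<in> Poly_Mapping.keys (div_diff b) \<Longrightarrow> toc_deg y = toc_deg b - 1"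
  "y \<in> Poly_Mapping.keys (div0_diff b) \<Longrightarrow> toc_deg y = toc_deg b - 1"
  by (cases b; auto simp: close_up_def dest!: keys_sum_bas)+

lemma toc_bracket_deg:
  "y \<in> Poly_Mapping.keys (toc_bracket b c) \<Longrightarrow> toc_deg y = toc_deg b + toc_deg c"
  by (cases b; cases c)
     (auto simp: grafts_def dest!: keys_sum_bas subsetD[OF Poly_Mapping.keys_diff])

theorem ce_coderivations:
  assumes "L = lie_L \<or> L = lie_L_reduced"
  shows "is_coderivation (susp_deg L) (coderivation (susp_deg L) 1 (ce1 L))"
    and "is_coderivation (susp_deg L) (coderivation (susp_deg L) 2 (ce2 L))"
  using assms
  by (intro ce1_is_coderivation ce2_is_coderivation;
      auto simp: lie_L_def lie_L_reduced_def div_diff_deg toc_bracket_deg)+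

text \<open>The basis of the sum over \<open>n \<ge> 1\<close> of the \<open>n\<close>-th tensor powers of \<open>s L\<close>, evaluated at \<open>I\<close>:
  nonempty lists of basis elements whose supports partition \<open>I\<close>.\<close>

definition tensor_basis :: "('v, 'b, 'k) dg_lie \<Rightarrow> 'v set \<Rightarrow> int \<Rightarrow> 'b list set"
  where "tensor_basis L I n = {xs. xs \<noteq> [] \<and> set xs \<subseteq> lie_basis L \<and>
    sorted_wrt (\<lambda>x y. lie_supp L x \<inter> lie_supp L y = {}) xs \<and> (\<Union>x\<in>set xs. lie_supp L x) = I \<and>
    total_deg (susp_deg L) xs = n}"

definition chevalley_eilenberg ::
  "('v, 'b, 'k::field) dg_lie \<Rightarrow> ('v, 'b list, 'k) dg_species"
  where "chevalley_eilenberg L =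
    \<lparr>gens = tensor_basis L,
     rels = (\<lambda>I n. {bas (us @ x # y # vs)
                    - fscale (parity_sign (susp_deg L x * susp_deg L y)) (bas (us @ y # x # vs))
                    | us x y vs. us @ x # y # vs \<in> tensor_basis L I n}),
     transport = (\<lambda>\<phi>. map (lie_map L \<phi>)),
     diff = ce_differential L\<rparr>"


section \<open>Composition with the acyclic two-term complex\<close>

text \<open>The basis element \<open>k\<^sub>1 \<otimes> \<dots> \<otimes> k\<^sub>n\<close> of the \<open>n\<close>-th tensor power of the two-term complex is
  encoded by the set \<open>Q \<subseteq> {1..n}\<close> of positions with the odd (white) generator.  A permutation acts
  on it with the Koszul sign \<open>white_sign\<close>, and \<open>(n, x, Q)\<close> encodes \<open>x \<otimes> k\<^sub>1 \<otimes> \<dots> \<otimes> k\<^sub>n\<close>.\<close>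

definition white_sign :: "(nat \<Rightarrow> nat) \<Rightarrow> nat set \<Rightarrow> 'k::field"
  where "white_sign \<sigma> Q = (- 1) ^ card {(i, j). i \<in> Q \<and> j \<in> Q \<and> i < j \<and> \<sigma> j < \<sigma> i}"

definition K_gens ::
  "(nat, 'x, 'k::field) dg_species \<Rightarrow> nat \<Rightarrow> nat \<Rightarrow> (nat \<times> 'x \<times> nat set) set"
  where "K_gens A p q = {(n, x, Q). x \<in> gens A {1..n} (int p) \<and> Q \<subseteq> {1..n} \<and> card Q = q}"

text \<open>The relations of \<open>A\<close>, and those defining the coinvariants for the diagonal action of the
  symmetric group.\<close>

definition K_rels ::
  "(nat, 'x, 'k::field) dg_species \<Rightarrow> nat \<Rightarrow> nat \<Rightarrow> (nat \<times> 'x \<times> nat set \<Rightarrow>\<^sub>0 'k) set"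
  where "K_rels A p q =
    {lin (\<lambda>x. bas (n, x, Q)) r | n r Q. r \<in> rels A {1..n} (int p) \<and> Q \<subseteq> {1..n} \<and> card Q = q} \<union>
    {bas (n, x, Q) - fscale (white_sign \<sigma> Q) (bas (n, transport A \<sigma> x, \<sigma> ` Q))
      | n x Q \<sigma>. (n, x, Q) \<in> K_gens A p q \<and> \<sigma> permutes {1..n}}"

definition K_diff :: "nat \<times> 'x \<times> nat set \<Rightarrow> (nat \<times> 'x \<times> nat set \<Rightarrow>\<^sub>0 'k::field)"
  where "K_diff = (\<lambda>(n, x, Q).
    \<Sum>i\<in>{1..n} - Q. fscale ((- 1) ^ card {j \<in> Q. j < i}) (bas (n, x, insert i Q)))"

definition composite_K ::
  "(nat, 'x, 'k::field) dg_species \<Rightarrow> ((nat \<times> 'x \<times> nat set \<Rightarrow>\<^sub>0 'k) set, 'k) bicomplex"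
  where "composite_K A = quotient_bicomplex
    (free_bicomplex (\<lambda>p q. span_of (K_gens A p q))
      (\<lambda>p q. lin (\<lambda>(n, x, Q). lin (\<lambda>y. bas (n, y, Q)) (diff A x)))
      (\<lambda>p q. lin K_diff))
    (\<lambda>p q. fvec.span (K_rels A p q))"

end

theory Submission
  imports Defs
begin

text \<open>The components of a functional digraph (every vertex has at most one outgoing edge) are rooted
  trees and cycles of trees, so an aromatic forest is a nonempty functional digraph with an order on
  its sinks, which are the roots, and on its white vertices.  After antisymmetrising, only the digraph
  \<open>G\<close> and the set \<open>Q\<close> of white vertices matter: ordering both by the vertices, which are natural
  numbers, gives an element \<open>alt G (sinks G) Q\<close>, and these elements span the aromatic bicomplex.  The
  same data determine an element of the composite up to the sign of the order of the roots, measured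
  by \<open>orientation\<close>.  The Koszul signs of the Chevalley--Eilenberg differential are quotients of
  such orientations, so both horizontal differentials are, up to a factor depending on the number of
  roots, the sum over all roots \<open>r\<close> and vertices \<open>v\<close> of the forests obtained by adding the edge
  \<open>(r, v)\<close>, with the sign \<open>(- 1)\<close> to the number of roots smaller than \<open>r\<close>: the differential of \<open>s L\<close>
  accounts for \<open>v\<close> in the tree of \<open>r\<close>, and the bracket for all other \<open>v\<close>.  The terms with \<open>v = r\<close>,
  which the reduced divergence omits, create a loop and vanish in the divergence-free quotient.
  Conversely, choosing a decomposition into components of a relabelling by \<open>1, \<dots>, n\<close> of each
  forest inverts the comparison map modulo the relations of the composite.\<close>

section \<open>Orientation of lists\<close>

text \<open>The elements \<open>alt G (sinks G) Q\<close> are not a basis: relabelling the vertices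
  reproduces such an element up to sign, and an automorphism of odd sign forces it to vanish. Hence
  no map can simply be prescribed on them. The inverse of the comparison is prescribed on
  isomorphism classes of forests, which form a basis of the ambient free space, and it is controlled
  only modulo the relations of the composite. Neither the Jacobi identity nor the compatibility of
  the bracket with the divergence is ever verified: the relations of the composite turn out to be
  the kernel of a surjection onto the aromatic side that intertwines the differentials, so
  well-defined differentials and all bicomplex identities are inherited from there, where the
  squares vanish by the antisymmetry of a sign in two roots or two white vertices. Finally,
  \<open>horizontal\<close> singles out the last tree, so that antisymmetrisation turns it into an
  average over the roots, whereas a coderivation sums over them; this mismatch forces a rescaling
  that depends on the bidegree.\<close>

primrec orientation :: "'a::linorder list \<Rightarrow> 'k::field"
  where
    "orientation [] = 1"
  | "orientation (x # xs) = (- 1) ^ length (filter (\<lambda>y. y < x) xs) * orientation xs"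

lemma sign_cancel: "((- 1) ^ n * a) * ((- 1) ^ n * b) = a * (b :: 'k::field)"
  by (cases "even n") auto

lemma orientation_mult_self [simp]: "orientation xs * orientation xs = (1 :: 'k::field)"
  by (induction xs) (simp_all add: sign_cancel)

lemma orientation_mult_self_left [simp]: "orientation xs * (orientation xs * c) = c"
  by (metis mult.assoc mult_1 orientation_mult_self)

lemma orientation_neq_0 [simp]: "orientation xs \<noteq> 0"
  by (metis orientation_mult_self mult_zero_left zero_neq_one)

lemma orientation_sorted: "sorted xs \<Longrightarrow> orientation xs = 1"
proof (induction xs)
  case (Cons x xs)
  then have "filter (\<lambda>y. y < x) xs = []" by (auto simp: filter_empty_conv)
  then show ?case using Cons by simp
qed simp

lemma orientation_sorted_list_of_set [simp]: "orientation (sorted_list_of_set A) = 1"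
  by (simp add: orientation_sorted)

lemma orientation_swap:
  assumes "x \<noteq> y"
  shows "orientation (us @ x # y # vs) = - orientation (us @ y # x # vs)"
proof (induction us)
  case Nil
  show ?case using assms by (cases "x < y") auto
qed simp

text \<open>Adjacent swaps connect any two arrangements of a multiset. Every intermediate
  arrangement is known to have the multiset of \<open>xs\<close>, so that distinctness remains
  available at each swap.\<close>

lemma mset_swap_induct [consumes 1, case_names refl swap]:
  assumes "mset xs = mset ys" "P xs"
    and "\<And>us x y vs. mset (us @ x # y # vs) = mset xs \<Longrightarrow> P (us @ x # y # vs) \<Longrightarrow> P (us @ y # x # vs)"
  shows "P ys"
  using assms
proof (induction xs arbitrary: ys P)
  case (Cons x xs)
  have "x \<in> set ys" using Cons.prems(1) by (metis list.set_intros(1) mset_eq_setD)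
  then obtain us vs where ys: "ys = us @ x # vs" by (metis split_list)
  have "mset xs = mset (us @ vs)" using Cons.prems(1) ys by simp
  then have "P (x # us @ vs)"
  proof (rule Cons.IH[of _ "\<lambda>zs. P (x # zs)"])
    show "P (x # xs)" by fact
    show "P (x # us @ b # a # vs)" if "mset (us @ a # b # vs) = mset xs" "P (x # us @ a # b # vs)"
      for us a b vs
      using Cons.prems(3)[of "x # us" a b vs] that by simp
  qed
  \<comment> \<open>With the tail already arranged behind \<open>x\<close>, the head travels to its
    place one swap at a time.\<close>
  moreover have "P (as @ x # bs)" if "P (x # as @ bs)" "mset (x # as @ bs) = mset (x # xs)" for as bs
    using that
  proof (induction as arbitrary: bs rule: rev_induct)
    case (snoc a as)
    then have "P (as @ x # a # bs)" by simp
    then show ?case using Cons.prems(3)[of as x a bs] snoc.prems(2) by simp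
  qed simp
  ultimately show ?case using Cons.prems(1) ys by simp
qed simp

lemma permute_list_nth_less: "i < length xs \<Longrightarrow> permute_list f xs ! i = xs ! f i"
  by (simp add: permute_list_def)

lemma permute_list_swap:
  "permute_list (transpose (length us) (Suc (length us))) (us @ x # y # vs) = us @ y # x # vs"
proof (rule nth_equalityI)
  let ?xs = "us @ x # y # vs" and ?t = "transpose (length us) (Suc (length us))"
  fix i assume "i < length (permute_list ?t ?xs)"
  then have i: "i < length ?xs" by simp
  consider "i < length us" | "i = length us" | "i = Suc (length us)"
    | j where "i = Suc (Suc (length us)) + j"
  proof -
    assume 1: "i < length us \<Longrightarrow> thesis" "i = length us \<Longrightarrow> thesis" "i = Suc (length us) \<Longrightarrow> thesis"
      "\<And>j. i = Suc (Suc (length us)) + j \<Longrightarrow> thesis"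
    have "i < length us \<or> i = length us \<or> i = Suc (length us)
      \<or> i = Suc (Suc (length us)) + (i - Suc (Suc (length us)))" by linarith
    then show thesis using 1 by blast
  qed
  moreover have "permute_list ?t ?xs ! i = ?xs ! ?t i"
    using i by (rule permute_list_nth_less)
  ultimately show "permute_list ?t ?xs ! i = (us @ y # x # vs) ! i"
    using i by cases (simp_all add: transpose_def nth_append)
qed simp

text \<open>An adjacent swap reverses both the orientation of the list and the sign of the
  permutation that produced it. Thus, on lists without repetitions, \<open>orientation\<close> is
  the sign of the permutation relating the list to its sorted form.\<close>

lemma orientation_permute_list:
  assumes "distinct xs" "\<sigma> permutes {..<length xs}"
  shows "(orientation (permute_list \<sigma> xs) :: 'k::field) = of_int (sign \<sigma>) * orientation xs"
proof -
  have "mset xs = mset (permute_list \<sigma> xs)" using assms by simp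
  then have "\<exists>\<tau>. \<tau> permutes {..<length xs} \<and> permute_list \<sigma> xs = permute_list \<tau> xs
    \<and> (orientation (permute_list \<sigma> xs) :: 'k) = of_int (sign \<tau>) * orientation xs"
  proof (induction rule: mset_swap_induct)
    case refl
    show ?case by (intro exI[of _ id] conjI permutes_id) (auto simp: sign_id)
  next
    case (swap us x y vs)
    then obtain \<tau> where \<tau>: "\<tau> permutes {..<length xs}" "us @ x # y # vs = permute_list \<tau> xs"
      "(orientation (us @ x # y # vs) :: 'k) = of_int (sign \<tau>) * orientation xs" by auto
    let ?t = "transpose (length us) (Suc (length us))"
    have len: "length xs = length us + 2 + length vs"
      using mset_eq_length[OF swap.hyps] by simp
    have t: "?t permutes {..<length xs}" using len by (auto intro: permutes_swap_id)
    have "distinct (us @ x # y # vs)" using swap.hyps assms(1) by (metis mset_eq_imp_distinct_iff)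
    then have "x \<noteq> y" by auto
    moreover have "us @ y # x # vs = permute_list (\<tau> \<circ> ?t) xs"
      using permute_list_compose[OF t, of \<tau>] \<tau>(2) permute_list_swap[of us x y vs] by simp
    moreover have "sign (\<tau> \<circ> ?t) = - sign \<tau>"
      using \<tau>(1) t by (simp add: sign_compose permutes_imp_permutation[OF finite_lessThan] sign_swap_id)
    ultimately show ?case
      using \<tau> t orientation_swap[of x y us vs, where ?'b = 'k]
      by (intro exI[of _ "\<tau> \<circ> ?t"]) (simp add: permutes_compose del: o_apply)
  qed
  then obtain \<tau> where \<tau>: "\<tau> permutes {..<length xs}" "permute_list \<sigma> xs = permute_list \<tau> xs"
    "(orientation (permute_list \<sigma> xs) :: 'k) = of_int (sign \<tau>) * orientation xs" by auto
  \<comment> \<open>The swaps only yield some permutation \<open>\<tau>\<close> producing the same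
    list; distinct entries identify it with \<open>\<sigma>\<close>.\<close>
  have "\<sigma> i = \<tau> i" for i
  proof (cases "i < length xs")
    case True
    then have "xs ! \<sigma> i = xs ! \<tau> i" using \<tau>(2) by (simp add: permute_list_def)
    moreover have "\<sigma> i < length xs" "\<tau> i < length xs"
      using permutes_in_image[OF assms(2)] permutes_in_image[OF \<tau>(1)] True by auto
    ultimately show ?thesis using assms(1) by (simp add: nth_eq_iff_index_eq)
  next
    case False
    then show ?thesis using assms(2) \<tau>(1) by (simp add: permutes_def)
  qed
  then have "\<sigma> = \<tau>" by auto
  then show ?thesis using \<tau>(3) by simp
qed

text \<open>Both sides are the sign of the permutation carrying one arrangement into the other,
  which does not see the labels. Orientations are their own inverses, so products serve as
  quotients.\<close>

lemma orientation_map_mult: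
  assumes "mset xs = mset ys" "distinct xs" "inj_on \<phi> (set xs)"
  shows "(orientation (map \<phi> xs) :: 'k::field) * orientation (map \<phi> ys) = orientation xs * orientation ys"
  using assms(1)
proof (induction rule: mset_swap_induct)
  case (swap us x y vs)
  have "distinct (us @ x # y # vs)" using swap.hyps assms(2) by (metis mset_eq_imp_distinct_iff)
  moreover have "set (us @ x # y # vs) = set xs" using swap.hyps by (metis mset_eq_setD)
  ultimately have "x \<noteq> y" "x \<in> set xs" "y \<in> set xs" by auto
  moreover from this have "\<phi> x \<noteq> \<phi> y" using assms(3) by (auto dest: inj_onD)
  ultimately show ?case
    using swap.IH orientation_swap[of x y us vs, where ?'b = 'k]
      orientation_swap[of "\<phi> x" "\<phi> y" "map \<phi> us" "map \<phi> vs", where ?'b = 'k] by simp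
qed simp

lemma orientation_append_Cons:
  assumes "x \<notin> set us"
  shows "(orientation (us @ x # vs) :: 'k::field) = (- 1) ^ length us * orientation (x # us @ vs)"
  using assms
proof (induction us arbitrary: vs rule: rev_induct)
  case (snoc u us)
  have "(orientation ((us @ [u]) @ x # vs) :: 'k) = - orientation (us @ x # u # vs)"
    using orientation_swap[of u x us vs] snoc.prems by auto
  also have "\<dots> = - ((- 1) ^ length us * orientation (x # us @ u # vs))"
    using snoc.prems snoc.IH[of "u # vs"] by (simp del: orientation.simps)
  finally show ?case by simp
qed simp

text \<open>The inversions of the head depend only on the multiset behind it, so they occur twice
  and cancel.\<close>

lemma orientation_Cons_mult:
  assumes "mset xs = mset ys"
  shows "(orientation (x # xs) :: 'k::field) * orientation (x # ys) = orientation xs * orientation ys"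
proof -
  have "length (filter (\<lambda>y. y < x) xs) = length (filter (\<lambda>y. y < x) ys)"
    using assms by (metis mset_filter size_mset)
  then show ?thesis by (simp add: sign_cancel)
qed

lemma orientation_snoc:
  "orientation (xs @ [x]) = (- 1) ^ length (filter (\<lambda>y. x < y) xs) * orientation xs"
  by (induction xs) auto

lemma length_filter_distinct:
  "distinct xs \<Longrightarrow> length (filter P xs) = card {x \<in> set xs. P x}"
  by (metis distinct_card distinct_filter set_filter)

text \<open>The inversions of \<open>\<sigma>\<close> on \<open>Q\<close> are those of the list of
  images of the sorted elements. The Koszul sign of the two-term complex thereby becomes comparable
  with the signs of the antisymmetrised forests.\<close>

lemma white_sign_eq_orientation:
  assumes "finite Q"
  shows "white_sign \<sigma> Q = orientation (map \<sigma> (sorted_list_of_set Q))"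
proof -
  have "(- 1) ^ card {(i, j). i \<in> set qs \<and> j \<in> set qs \<and> i < j \<and> \<sigma> j < \<sigma> i}
    = (orientation (map \<sigma> qs) :: 'a)" if "sorted qs" "distinct qs" for qs
    using that
  proof (induction qs)
    case (Cons x qs)
    let ?I = "\<lambda>qs. {(i, j). i \<in> set qs \<and> j \<in> set qs \<and> i < j \<and> \<sigma> j < \<sigma> i}"
    have "\<forall>y\<in>set qs. x < y" using Cons.prems by (auto simp: less_le)
    then have "?I (x # qs) = Pair x ` {j \<in> set qs. \<sigma> j < \<sigma> x} \<union> ?I qs"
      by (auto dest: less_asym)
    moreover have "finite (?I qs)" by (rule finite_subset[of _ "set qs \<times> set qs"]) auto
    moreover have "Pair x ` {j \<in> set qs. \<sigma> j < \<sigma> x} \<inter> ?I qs = {}" using Cons.prems by auto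
    ultimately have "card (?I (x # qs)) = card {j \<in> set qs. \<sigma> j < \<sigma> x} + card (?I qs)"
      by (simp add: card_Un_disjoint card_image inj_on_def)
    moreover have "length (filter (\<lambda>y. y < \<sigma> x) (map \<sigma> qs)) = card {j \<in> set qs. \<sigma> j < \<sigma> x}"
      using Cons.prems by (simp add: filter_map o_def length_filter_distinct)
    ultimately show ?case using Cons by (simp add: power_add)
  qed simp
  from this[of "sorted_list_of_set Q"] show ?thesis using assms by (simp add: white_sign_def)
qed

section \<open>Linear maps and quotient bicomplexes\<close>

abbreviation linmap :: "(('b \<Rightarrow>\<^sub>0 'k::field) \<Rightarrow> ('c \<Rightarrow>\<^sub>0 'k)) \<Rightarrow> bool"
  where "linmap \<equiv> module_hom fscale fscale"

lemma linmapI: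
  assumes "\<And>x y. f (x + y) = f x + f y" "\<And>c x. f (fscale c x) = fscale c (f x)"
  shows "linmap f"
  by (simp add: module_hom_def module_hom_axioms_def fvec.module_axioms assms)

lemma linmap_lin: "linmap (lin f)"
  by (intro linmapI lin_add lin_scale)

lemma linmap_ident: "linmap (\<lambda>x. x)"
  by (rule linmapI) auto

lemma linmap_comp:
  assumes "linmap f" "linmap g"
  shows "linmap (\<lambda>x. f (g x))"
  by (intro linmapI) (simp_all add: assms[THEN module_hom.add] assms[THEN module_hom.scale])

lemma linmap_diff:
  assumes "linmap f" "linmap g"
  shows "linmap (\<lambda>x. f x - g x)"
  by (intro linmapI)
     (simp_all add: assms[THEN module_hom.add] assms[THEN module_hom.scale] fvec.scale_right_diff_distrib)

lemma linmap_fscale: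
  assumes "linmap f"
  shows "linmap (\<lambda>x. fscale c (f x))"
  by (intro linmapI)
     (simp_all add: assms[THEN module_hom.add] assms[THEN module_hom.scale] fvec.scale_right_distrib
       mult.commute)

lemma linmap_sum:
  assumes "\<And>i. i \<in> S \<Longrightarrow> linmap (f i)"
  shows "linmap (\<lambda>x. \<Sum>i\<in>S. f i x)"
proof (rule linmapI)
  show "(\<Sum>i\<in>S. f i (x + y)) = (\<Sum>i\<in>S. f i x) + (\<Sum>i\<in>S. f i y)" for x y
    unfolding sum.distrib[symmetric] by (intro sum.cong refl) (rule module_hom.add[OF assms])
  show "(\<Sum>i\<in>S. f i (fscale c x)) = fscale c (\<Sum>i\<in>S. f i x)" for c x
    unfolding fvec.scale_sum_right by (intro sum.cong refl) (rule module_hom.scale[OF assms])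
qed

lemma linmap_eq_on_span:
  assumes "linmap f" "linmap g" "\<And>x. x \<in> S \<Longrightarrow> f x = g x" "x \<in> fvec.span S"
  shows "f x = g x"
  using assms(4)
proof (induction rule: fvec.span_induct_alt)
  case base
  then show ?case by (simp add: assms(1,2)[THEN module_hom.zero])
next
  case (step c y z)
  then show ?case using assms by (simp add: module_hom.add module_hom.scale)
qed

lemma linmap_in_subspace:
  assumes "linmap f" "fvec.subspace T" "\<And>x. x \<in> S \<Longrightarrow> f x \<in> T" "x \<in> fvec.span S"
  shows "f x \<in> T"
  using assms(4)
proof (induction rule: fvec.span_induct_alt)
  case base
  then show ?case by (simp add: assms(1)[THEN module_hom.zero] assms(2) fvec.subspace_0)
next
  case (step c y z)
  then show ?case using assms
    by (simp add: module_hom.add module_hom.scale fvec.subspace_add fvec.subspace_scale)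
qed

lemma subspace_span_of: "fvec.subspace (span_of S)"
  by (simp add: span_of_def)

lemma bas_in_span_of: "b \<in> S \<Longrightarrow> bas b \<in> span_of S"
  by (simp add: span_of_def fvec.span_base)

lemma coset_eq_iff:
  assumes "fvec.subspace W"
  shows "coset W x = coset W y \<longleftrightarrow> x - y \<in> W"
proof
  assume "coset W x = coset W y"
  then have "x + 0 \<in> coset W y" using assms unfolding coset_def by (metis fvec.subspace_0 imageI)
  then show "x - y \<in> W" by (auto simp: coset_def)
next
  have sub: "coset W x \<subseteq> coset W y" if "x - y \<in> W" for x y
  proof
    fix z assume "z \<in> coset W x"
    then obtain w where w: "w \<in> W" "z = x + w" by (auto simp: coset_def)
    then have "z = y + ((x - y) + w)" by simp
    then show "z \<in> coset W y"
      unfolding coset_def using fvec.subspace_add[OF assms that w(1)] by (metis imageI)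
  qed
  assume "x - y \<in> W"
  moreover from this have "y - x \<in> W" using fvec.subspace_neg[OF assms] by fastforce
  ultimately show "coset W x = coset W y" using sub by blast
qed

lemma coset_0: "coset W 0 = W"
  by (simp add: coset_def)

text \<open>The horizontal conditions start at \<open>Suc p\<close>: the quotient writes its target
  degree as \<open>p - 1\<close>, which is the genuine lower degree only from there on.\<close>

locale bicomplex_presentation =
  fixes V W :: "nat \<Rightarrow> nat \<Rightarrow> ('b \<Rightarrow>\<^sub>0 'k::field) set"
    and dH dV :: "nat \<Rightarrow> nat \<Rightarrow> ('b \<Rightarrow>\<^sub>0 'k) \<Rightarrow> ('b \<Rightarrow>\<^sub>0 'k)"
  assumes V: "fvec.subspace (V p q)" and W: "fvec.subspace (W p q)"
    and dH: "linmap (dH p q)" and dV: "linmap (dV p q)"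
    and dH_V: "x \<in> V (Suc p) q \<Longrightarrow> dH (Suc p) q x \<in> V p q"
    and dV_V: "x \<in> V p q \<Longrightarrow> dV p q x \<in> V p (Suc q)"
    and dH_W: "x \<in> W (Suc p) q \<Longrightarrow> dH (Suc p) q x \<in> W p q"
    and dV_W: "x \<in> W p q \<Longrightarrow> dV p q x \<in> W p (Suc q)"
begin

abbreviation Q where "Q \<equiv> quotient_bicomplex (free_bicomplex V dH dV) W"

text \<open>Operations on the quotient are unions over all representatives. When representatives of
  one coset have congruent values, the union is a union of equal sets and collapses to a single
  coset.\<close>

lemma union_cosets:
  assumes "fvec.subspace T" "\<And>x'. x' - x \<in> W p q \<Longrightarrow> f x' - f x \<in> T"
  shows "(\<Union>x\<in>coset (W p q) x. coset T (f x)) = coset T (f x)"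
proof -
  have "coset T (f x') = coset T (f x)" if "x' \<in> coset (W p q) x" for x'
    using that assms by (intro iffD2[OF coset_eq_iff]) (auto simp: coset_def)
  moreover have "coset (W p q) x \<noteq> {}"
    using fvec.subspace_0[OF W] by (auto simp: coset_def)
  ultimately show ?thesis by (intro SUP_eq_const)
qed

lemma
  shows Q_carr: "carr Q p q = coset (W p q) ` V p q"
    and Q_zer: "zer Q p q = coset (W p q) 0"
    and Q_add: "add Q p q (coset (W p q) x) (coset (W p q) y) = coset (W p q) (x + y)"
    and Q_scl: "scl Q p q c (coset (W p q) x) = coset (W p q) (fscale c x)"
    and Q_dh: "dh Q (Suc p) q (coset (W (Suc p) q) x) = coset (W p q) (dH (Suc p) q x)"
    and Q_dv: "dv Q p q (coset (W p q) x) = coset (W p (Suc q)) (dV p q x)"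
proof -
  show "carr Q p q = coset (W p q) ` V p q" "zer Q p q = coset (W p q) 0"
    by (simp_all add: quotient_bicomplex_def free_bicomplex_def coset_0)
  have 1: "(\<Union>y\<in>coset (W p q) y. coset (W p q) (x + y)) = coset (W p q) (x + y)" for x
    by (rule union_cosets[OF W]) simp
  have 2: "(\<Union>x\<in>coset (W p q) x. coset (W p q) (x + y)) = coset (W p q) (x + y)"
    by (rule union_cosets[OF W]) simp
  show "add Q p q (coset (W p q) x) (coset (W p q) y) = coset (W p q) (x + y)"
    unfolding quotient_bicomplex_def free_bicomplex_def bicomplex.simps 1 by (rule 2)
  show "scl Q p q c (coset (W p q) x) = coset (W p q) (fscale c x)"
    unfolding quotient_bicomplex_def free_bicomplex_def bicomplex.simps
    by (rule union_cosets[OF W])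
       (metis W fvec.scale_right_diff_distrib fvec.subspace_scale)
  show "dh Q (Suc p) q (coset (W (Suc p) q) x) = coset (W p q) (dH (Suc p) q x)"
    unfolding quotient_bicomplex_def free_bicomplex_def bicomplex.simps diff_Suc_1
    by (rule union_cosets[OF W]) (metis dH dH_W module_hom.diff)
  show "dv Q p q (coset (W p q) x) = coset (W p (Suc q)) (dV p q x)"
    unfolding quotient_bicomplex_def free_bicomplex_def bicomplex.simps
    by (rule union_cosets[OF W]) (metis dV dV_W module_hom.diff)
qed

lemma is_bicomplex_Q:
  assumes "\<And>p q x. x \<in> V (Suc (Suc p)) q \<Longrightarrow> dH (Suc p) q (dH (Suc (Suc p)) q x) \<in> W p q"
    and "\<And>p q x. x \<in> V p q \<Longrightarrow> dV p (Suc q) (dV p q x) \<in> W p (Suc (Suc q))"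
    and "\<And>p q x. x \<in> V (Suc p) q \<Longrightarrow>
      dH (Suc p) (Suc q) (dV (Suc p) q x) - dV p q (dH (Suc p) q x) \<in> W p (Suc q)"
  shows "is_bicomplex Q"
  unfolding is_bicomplex_def
proof (intro allI conjI)
  fix p q
  note V_simps = fvec.subspace_add[OF V] fvec.subspace_scale[OF V] fvec.subspace_neg[OF V]
    fvec.subspace_0[OF V]
  have neg: "\<exists>y\<in>V p q. coset (W p q) (y + x) = coset (W p q) 0" if "x \<in> V p q" for x
    using that V_simps by (intro bexI[of _ "- x"]) auto
  show "vector_space_on (carr Q p q) (zer Q p q) (add Q p q) (scl Q p q)"
    unfolding vector_space_on_def Q_carr Q_zer
    using neg by (auto simp: Q_add Q_scl V_simps add_ac fvec.scale_right_distrib fvec.scale_left_distrib)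
  show "linear_map_on Q (Suc p) q Q p q (dh Q (Suc p) q)"
    unfolding linear_map_on_def Q_carr
    by (auto simp: Q_add Q_scl Q_dh dH_V module_hom.add[OF dH] module_hom.scale[OF dH])
  show "linear_map_on Q p q Q p (Suc q) (dv Q p q)"
    unfolding linear_map_on_def Q_carr
    by (auto simp: Q_add Q_scl Q_dv dV_V module_hom.add[OF dV] module_hom.scale[OF dV])
  show "\<forall>x\<in>carr Q (Suc (Suc p)) q. dh Q (Suc p) q (dh Q (Suc (Suc p)) q x) = zer Q p q"
    using assms(1) by (auto simp: Q_carr Q_zer Q_dh coset_eq_iff[OF W])
  show "\<forall>x\<in>carr Q p q. dv Q p (Suc q) (dv Q p q x) = zer Q p (Suc (Suc q))"
    using assms(2) by (auto simp: Q_carr Q_zer Q_dv coset_eq_iff[OF W])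
  show "\<forall>x\<in>carr Q (Suc p) q. dh Q (Suc p) (Suc q) (dv Q (Suc p) q x) = dv Q p q (dh Q (Suc p) q x)"
    using assms(3) by (auto simp: Q_carr Q_dh Q_dv coset_eq_iff[OF W])
qed

end

text \<open>Transport of structure. Since \<open>W\<close> is the kernel of \<open>\<Psi>\<close>,
  its invariance under both differentials and the bicomplex identities of the quotient follow from
  those of \<open>A\<close>; none of them is among the hypotheses.\<close>

lemma quotient_isomorphic:
  fixes V W :: "nat \<Rightarrow> nat \<Rightarrow> ('b \<Rightarrow>\<^sub>0 'k::field) set" and A :: "('e, 'k) bicomplex"
  assumes A: "is_bicomplex A"
    and V: "\<And>p q. fvec.subspace (V p q)" and W: "\<And>p q. fvec.subspace (W p q)"
    and WV: "\<And>p q. W p q \<subseteq> V p q"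
    and dH: "\<And>p q. linmap (dH p q)" and dV: "\<And>p q. linmap (dV p q)"
    and dH_V: "\<And>p q x. x \<in> V (Suc p) q \<Longrightarrow> dH (Suc p) q x \<in> V p q"
    and dV_V: "\<And>p q x. x \<in> V p q \<Longrightarrow> dV p q x \<in> V p (Suc q)"
    and \<Psi>_carr: "\<And>p q x. x \<in> V p q \<Longrightarrow> \<Psi> p q x \<in> carr A p q"
    and \<Psi>_add: "\<And>p q x y. x \<in> V p q \<Longrightarrow> y \<in> V p q \<Longrightarrow> \<Psi> p q (x + y) = add A p q (\<Psi> p q x) (\<Psi> p q y)"
    and \<Psi>_scl: "\<And>p q c x. x \<in> V p q \<Longrightarrow> \<Psi> p q (fscale c x) = scl A p q c (\<Psi> p q x)"
    and \<Psi>_surj: "\<And>p q y. y \<in> carr A p q \<Longrightarrow> \<exists>x\<in>V p q. y = \<Psi> p q x"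
    and \<Psi>_eq: "\<And>p q x y. x \<in> V p q \<Longrightarrow> y \<in> V p q \<Longrightarrow> \<Psi> p q x = \<Psi> p q y \<longleftrightarrow> x - y \<in> W p q"
    and \<Psi>_dH: "\<And>p q x. x \<in> V (Suc p) q \<Longrightarrow> \<Psi> p q (dH (Suc p) q x) = dh A (Suc p) q (\<Psi> (Suc p) q x)"
    and \<Psi>_dV: "\<And>p q x. x \<in> V p q \<Longrightarrow> \<Psi> p (Suc q) (dV p q x) = dv A p q (\<Psi> p q x)"
  shows "A \<cong>\<^sub>b quotient_bicomplex (free_bicomplex V dH dV) W"
proof -
  note V0 = fvec.subspace_0[OF V]
  have eq0: "\<Psi> p q x = \<Psi> p q 0 \<longleftrightarrow> x \<in> W p q" if "x \<in> V p q" for p q x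
    using \<Psi>_eq[OF that V0] by simp
  interpret bicomplex_presentation V W dH dV
  proof (rule bicomplex_presentation.intro; (fact assms)?)
    show "dH (Suc p) q x \<in> W p q" if "x \<in> W (Suc p) q" for p q x
    proof -
      have x: "x \<in> V (Suc p) q" using that WV by blast
      have "\<Psi> p q (dH (Suc p) q x) = dh A (Suc p) q (\<Psi> (Suc p) q x)" by (rule \<Psi>_dH[OF x])
      also have "\<Psi> (Suc p) q x = \<Psi> (Suc p) q 0" using eq0[OF x] that by blast
      also have "dh A (Suc p) q (\<Psi> (Suc p) q 0) = \<Psi> p q (dH (Suc p) q 0)" by (rule \<Psi>_dH[OF V0, symmetric])
      also have "dH (Suc p) q 0 = 0" by (rule module_hom.zero[OF dH])
      finally show ?thesis using eq0[OF dH_V[OF x]] by blast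
    qed
    show "dV p q x \<in> W p (Suc q)" if "x \<in> W p q" for p q x
    proof -
      have x: "x \<in> V p q" using that WV by blast
      have "\<Psi> p (Suc q) (dV p q x) = dv A p q (\<Psi> p q x)" by (rule \<Psi>_dV[OF x])
      also have "\<Psi> p q x = \<Psi> p q 0" using eq0[OF x] that by blast
      also have "dv A p q (\<Psi> p q 0) = \<Psi> p (Suc q) (dV p q 0)" by (rule \<Psi>_dV[OF V0, symmetric])
      also have "dV p q 0 = 0" by (rule module_hom.zero[OF dV])
      finally show ?thesis using eq0[OF dV_V[OF x]] by blast
    qed
  qed
  \<comment> \<open>Additivity makes the image of zero idempotent, and adding its negative in the
    abstract space \<open>A\<close> shows that it is the zero there.\<close>
  have zer: "\<Psi> p q 0 = zer A p q" for p q
  proof -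
    have vs: "vector_space_on (carr A p q) (zer A p q) (add A p q) (scl A p q)"
      using A by (simp add: is_bicomplex_def)
    let ?z = "\<Psi> p q 0"
    have z: "?z \<in> carr A p q" using \<Psi>_carr V0 by blast
    have zz: "add A p q ?z ?z = ?z" using \<Psi>_add[OF V0 V0, of p q] by simp
    obtain y where y: "y \<in> carr A p q" "add A p q y ?z = zer A p q"
      using vs z unfolding vector_space_on_def by meson
    have "add A p q y (add A p q ?z ?z) = add A p q (add A p q y ?z) ?z"
      using vs z y(1) unfolding vector_space_on_def by metis
    also have "\<dots> = ?z" using vs z y(2) unfolding vector_space_on_def by metis
    finally show ?thesis using y(2) zz by simp
  qed
  have WI: "x \<in> W p q" if "x \<in> V p q" "\<Psi> p q x = zer A p q" for x p q
    using eq0[OF that(1)] that(2) by (simp add: zer)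
  have AQ: "is_bicomplex Q"
  proof (rule is_bicomplex_Q)
    fix p q x
    show "dH (Suc p) q (dH (Suc (Suc p)) q x) \<in> W p q" if "x \<in> V (Suc (Suc p)) q"
      using that A by (intro WI) (auto simp: dH_V \<Psi>_dH is_bicomplex_def \<Psi>_carr)
    show "dV p (Suc q) (dV p q x) \<in> W p (Suc (Suc q))" if "x \<in> V p q"
      using that A by (intro WI) (auto simp: dV_V \<Psi>_dV is_bicomplex_def \<Psi>_carr)
    show "dH (Suc p) (Suc q) (dV (Suc p) q x) - dV p q (dH (Suc p) q x) \<in> W p (Suc q)"
      if "x \<in> V (Suc p) q"
      using that A by (intro iffD1[OF \<Psi>_eq]) (auto simp: dV_V dH_V \<Psi>_dV \<Psi>_dH is_bicomplex_def \<Psi>_carr)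
  qed
  \<comment> \<open>The isomorphism runs against \<open>\<Psi>\<close>: any preimage may be chosen,
    because two of them differ by an element of \<open>W\<close>.\<close>
  define f where "f p q y = coset (W p q) (SOME x. x \<in> V p q \<and> y = \<Psi> p q x)" for p q y
  have f: "f p q (\<Psi> p q x) = coset (W p q) x" if "x \<in> V p q" for p q x
  proof -
    let ?x = "SOME x'. x' \<in> V p q \<and> \<Psi> p q x = \<Psi> p q x'"
    have x: "?x \<in> V p q \<and> \<Psi> p q x = \<Psi> p q ?x" by (rule someI_ex) (use that in blast)
    then have "x - ?x \<in> W p q" using that \<Psi>_eq by blast
    then show ?thesis unfolding f_def coset_eq_iff[OF W] using fvec.subspace_neg[OF W] by fastforce
  qed
  have "bicomplex_iso A Q f"
    unfolding bicomplex_iso_def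
  proof (intro allI conjI A AQ)
    fix p q
    note V_simps = fvec.subspace_add[OF V] fvec.subspace_scale[OF V]
    have "f p q x' \<in> carr Q p q" if x': "x' \<in> carr A p q" for x'
    proof -
      obtain x where x: "x \<in> V p q" "x' = \<Psi> p q x" using \<Psi>_surj[OF x'] by blast
      show ?thesis unfolding x(2) f[OF x(1)] Q_carr using x(1) by (rule imageI)
    qed
    moreover have "f p q (add A p q x' y') = add Q p q (f p q x') (f p q y')"
      if x': "x' \<in> carr A p q" and y': "y' \<in> carr A p q" for x' y'
    proof -
      obtain x where x: "x \<in> V p q" "x' = \<Psi> p q x" using \<Psi>_surj[OF x'] by blast
      obtain y where y: "y \<in> V p q" "y' = \<Psi> p q y" using \<Psi>_surj[OF y'] by blast
      show ?thesis
        unfolding x(2) y(2) \<Psi>_add[OF x(1) y(1), symmetric] f[OF x(1)] f[OF y(1)]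
          f[OF V_simps(1)[OF x(1) y(1)]] Q_add ..
    qed
    moreover have "f p q (scl A p q c x') = scl Q p q c (f p q x')" if x': "x' \<in> carr A p q" for c x'
    proof -
      obtain x where x: "x \<in> V p q" "x' = \<Psi> p q x" using \<Psi>_surj[OF x'] by blast
      show ?thesis
        unfolding x(2) \<Psi>_scl[OF x(1), symmetric] f[OF x(1)] f[OF V_simps(2)[OF x(1)]] Q_scl ..
    qed
    ultimately show "linear_map_on A p q Q p q (f p q)" by (simp add: linear_map_on_def)
    show "bij_betw (f p q) (carr A p q) (carr Q p q)"
      unfolding bij_betw_def Q_carr
    proof
      have "x' = y'" if x': "x' \<in> carr A p q" and y': "y' \<in> carr A p q" and eq: "f p q x' = f p q y'"
        for x' y'
      proof -
        obtain x y where "x \<in> V p q" "y \<in> V p q" "x' = \<Psi> p q x" "y' = \<Psi> p q y"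
          using \<Psi>_surj x' y' by blast
        then show ?thesis using eq by (simp add: f coset_eq_iff[OF W] \<Psi>_eq)
      qed
      then show "inj_on (f p q) (carr A p q)" by (rule inj_onI)
      have "carr A p q = \<Psi> p q ` V p q" using \<Psi>_surj \<Psi>_carr by blast
      then have "f p q ` carr A p q = (\<lambda>x. f p q (\<Psi> p q x)) ` V p q" by (simp add: image_image)
      also have "\<dots> = coset (W p q) ` V p q" by (intro image_cong refl f)
      finally show "f p q ` carr A p q = coset (W p q) ` V p q" .
    qed
    show "\<forall>x\<in>carr A (Suc p) q. f p q (dh A (Suc p) q x) = dh Q (Suc p) q (f (Suc p) q x)"
    proof
      fix x' assume "x' \<in> carr A (Suc p) q"
      then obtain x where x: "x \<in> V (Suc p) q" "x' = \<Psi> (Suc p) q x" using \<Psi>_surj by blast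
      show "f p q (dh A (Suc p) q x') = dh Q (Suc p) q (f (Suc p) q x')"
        unfolding x(2) \<Psi>_dH[OF x(1), symmetric] f[OF x(1)] f[OF dH_V[OF x(1)]] Q_dh ..
    qed
    show "\<forall>x\<in>carr A p q. f p (Suc q) (dv A p q x) = dv Q p q (f p q x)"
    proof
      fix x' assume "x' \<in> carr A p q"
      then obtain x where x: "x \<in> V p q" "x' = \<Psi> p q x" using \<Psi>_surj by blast
      show "f p (Suc q) (dv A p q x') = dv Q p q (f p q x')"
        unfolding x(2) \<Psi>_dV[OF x(1), symmetric] f[OF x(1)] f[OF dV_V[OF x(1)]] Q_dv ..
    qed
  qed
  then show ?thesis by (auto simp: bicomplex_isomorphic_def)
qed

section \<open>Isomorphism classes of forests\<close>

lemma forest_iso_refl: "forest_iso F F"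
  by (auto simp: forest_iso_def map_digraph_def prod.map_ident intro!: exI[of _ "\<lambda>x. x"])

lemma map_digraph_comp: "map_digraph \<psi> (map_digraph \<phi> G) = map_digraph (\<psi> \<circ> \<phi>) G"
  by (simp add: map_digraph_def image_comp map_prod_compose[symmetric])

lemma map_digraph_cong:
  assumes "edges G \<subseteq> verts G \<times> verts G" "\<And>v. v \<in> verts G \<Longrightarrow> \<phi> v = \<psi> v"
  shows "map_digraph \<phi> G = map_digraph \<psi> G"
  using assms by (force simp: map_digraph_def intro!: image_cong)

lemma map_digraph_id [simp]: "map_digraph (\<lambda>v. v) G = G"
  by (simp add: map_digraph_def prod.map_ident)

lemma verts_map_digraph [simp]: "verts (map_digraph \<phi> G) = \<phi> ` verts G"
  and edges_map_digraph [simp]: "edges (map_digraph \<phi> G) = map_prod \<phi> \<phi> ` edges G"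
  by (simp_all add: map_digraph_def)

lemma forest_iso_trans:
  assumes "forest_iso F G" "forest_iso G H"
  shows "forest_iso F H"
proof -
  obtain \<phi> where \<phi>: "inj_on \<phi> (verts (graph F))" "graph G = map_digraph \<phi> (graph F)"
    "roots G = map \<phi> (roots F)" "whites G = map \<phi> (whites F)"
    using assms(1) by (auto simp: forest_iso_def)
  obtain \<psi> where \<psi>: "inj_on \<psi> (verts (graph G))" "graph H = map_digraph \<psi> (graph G)"
    "roots H = map \<psi> (roots G)" "whites H = map \<psi> (whites G)"
    using assms(2) by (auto simp: forest_iso_def)
  have "inj_on (\<psi> \<circ> \<phi>) (verts (graph F))" using \<phi>(1) \<psi>(1) by (simp add: \<phi>(2) comp_inj_on)
  then show ?thesis
    unfolding forest_iso_def by (intro exI[of _ "\<psi> \<circ> \<phi>"]) (simp add: \<phi> \<psi> map_digraph_comp)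
qed

text \<open>The part of being an aromatic forest that makes isomorphism symmetric: an injection on
  the vertices says nothing about edges or list entries lying outside them.\<close>

definition wf_forest :: "'v forest \<Rightarrow> bool"
  where "wf_forest F \<longleftrightarrow> finite_digraph (graph F) \<and> set (roots F) \<subseteq> verts (graph F) \<and>
    set (whites F) \<subseteq> verts (graph F)"

lemma finite_digraph_map: "finite_digraph G \<Longrightarrow> finite_digraph (map_digraph \<phi> G)"
  by (auto simp: finite_digraph_def)

lemma forest_iso_sym:
  assumes "forest_iso F G" "wf_forest F"
  shows "forest_iso G F"
proof -
  obtain \<phi> where \<phi>: "inj_on \<phi> (verts (graph F))" "graph G = map_digraph \<phi> (graph F)"
    "roots G = map \<phi> (roots F)" "whites G = map \<phi> (whites F)"
    using assms(1) by (auto simp: forest_iso_def)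
  let ?\<psi> = "inv_into (verts (graph F)) \<phi>"
  have inv: "?\<psi> (\<phi> v) = v" if "v \<in> verts (graph F)" for v
    using \<phi>(1) that by (rule inv_into_f_f)
  have "map_digraph ?\<psi> (graph G) = map_digraph (\<lambda>v. v) (graph F)"
    unfolding \<phi>(2) map_digraph_comp
    by (rule map_digraph_cong) (use assms(2) inv in \<open>auto simp: wf_forest_def finite_digraph_def\<close>)
  moreover have "map ?\<psi> (map \<phi> vs) = vs" if "set vs \<subseteq> verts (graph F)" for vs
    unfolding map_map by (rule map_idI) (use that inv in auto)
  ultimately show ?thesis
    using assms(2) unfolding forest_iso_def
    by (intro exI[of _ ?\<psi>]) (auto simp: \<phi> inj_on_inv_into wf_forest_def)
qed

lemma forest_class_eq_iff:
  assumes "wf_forest F"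
  shows "forest_class F = forest_class G \<longleftrightarrow> forest_iso F G"
proof
  assume "forest_class F = forest_class G"
  then have "G \<in> forest_class F" using forest_iso_refl[of G] by (simp add: forest_class_def)
  then show "forest_iso F G" by (simp add: forest_class_def)
next
  assume "forest_iso F G"
  then show "forest_class F = forest_class G"
    using forest_iso_trans forest_iso_sym[OF _ assms] unfolding forest_class_def by blast
qed

lemma forest_iso_representative: "forest_iso F (representative (forest_class F))"
proof -
  have "representative (forest_class F) \<in> forest_class F"
    unfolding representative_def
    by (rule someI[of _ F]) (simp add: forest_class_def forest_iso_refl)
  then show ?thesis by (simp add: forest_class_def)
qed

abbreviation cls :: "nat digraph \<Rightarrow> nat list \<Rightarrow> nat list \<Rightarrow> forest_class"
  where "cls G rs ws \<equiv> forest_class \<lparr>graph = G, roots = rs, whites = ws\<rparr>"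

definition wf_data :: "nat digraph \<Rightarrow> nat list \<Rightarrow> nat list \<Rightarrow> bool"
  where "wf_data G rs ws \<longleftrightarrow> finite_digraph G \<and> set rs \<subseteq> verts G \<and> set ws \<subseteq> verts G"

lemma wf_forest_iff [simp]: "wf_forest \<lparr>graph = G, roots = rs, whites = ws\<rparr> \<longleftrightarrow> wf_data G rs ws"
  by (simp add: wf_forest_def wf_data_def)

lemma cls_map:
  assumes "wf_data G rs ws" "inj_on \<phi> (verts G)"
  shows "cls (map_digraph \<phi> G) (map \<phi> rs) (map \<phi> ws) = cls G rs ws"
  using assms by (intro sym[OF iffD2[OF forest_class_eq_iff]]) (auto simp: forest_iso_def)

text \<open>The representative chosen by \<open>SOME\<close> is unknown, but it is a relabelling of
  any given forest. Each operation is computed on it and then carried back by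
  \<open>cls_map\<close>, so that it can be evaluated on any labelling.\<close>

lemma representative_cls:
  obtains \<phi> where "inj_on \<phi> (verts G)"
    "representative (cls G rs ws)
      = \<lparr>graph = map_digraph \<phi> G, roots = map \<phi> rs, whites = map \<phi> ws\<rparr>"
proof -
  obtain \<phi> where "inj_on \<phi> (verts G)"
    "graph (representative (cls G rs ws)) = map_digraph \<phi> G"
    "roots (representative (cls G rs ws)) = map \<phi> rs"
    "whites (representative (cls G rs ws)) = map \<phi> ws"
    using forest_iso_representative[of "\<lparr>graph = G, roots = rs, whites = ws\<rparr>"]
    by (auto simp: forest_iso_def)
  then show ?thesis by (intro that) (auto intro: forest.equality)
qed

lemma wf_permute:
  "\<sigma> permutes {..<length rs} \<Longrightarrow> wf_data G (permute_list \<sigma> rs) ws = wf_data G rs ws"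
  "\<sigma> permutes {..<length ws} \<Longrightarrow> wf_data G rs (permute_list \<sigma> ws) = wf_data G rs ws"
  by (simp_all add: wf_data_def)

lemma permute_trees_cls:
  assumes "wf_data G rs ws" "\<sigma> permutes {..<length rs}"
  shows "permute_trees \<sigma> (cls G rs ws) = cls G (permute_list \<sigma> rs) ws"
proof -
  obtain \<phi> where \<phi>: "inj_on \<phi> (verts G)"
    "representative (cls G rs ws) = \<lparr>graph = map_digraph \<phi> G, roots = map \<phi> rs, whites = map \<phi> ws\<rparr>"
    by (rule representative_cls)
  have "permute_trees \<sigma> (cls G rs ws) = cls (map_digraph \<phi> G) (map \<phi> (permute_list \<sigma> rs)) (map \<phi> ws)"
    using assms(2) by (simp add: permute_trees_def \<phi>(2) permute_list_map)
  also have "\<dots> = cls G (permute_list \<sigma> rs) ws"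
    by (rule cls_map) (simp_all add: assms \<phi> wf_permute)
  finally show ?thesis .
qed

lemma permute_whites_cls:
  assumes "wf_data G rs ws" "\<sigma> permutes {..<length ws}"
  shows "permute_whites \<sigma> (cls G rs ws) = cls G rs (permute_list \<sigma> ws)"
proof -
  obtain \<phi> where \<phi>: "inj_on \<phi> (verts G)"
    "representative (cls G rs ws) = \<lparr>graph = map_digraph \<phi> G, roots = map \<phi> rs, whites = map \<phi> ws\<rparr>"
    by (rule representative_cls)
  have "permute_whites \<sigma> (cls G rs ws) = cls (map_digraph \<phi> G) (map \<phi> rs) (map \<phi> (permute_list \<sigma> ws))"
    using assms(2) by (simp add: permute_whites_def \<phi>(2) permute_list_map)
  also have "\<dots> = cls G rs (permute_list \<sigma> ws)"
    by (rule cls_map) (simp_all add: assms \<phi> wf_permute)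
  finally show ?thesis .
qed

definition add_edge :: "'v digraph \<Rightarrow> 'v \<Rightarrow> 'v \<Rightarrow> 'v digraph"
  where "add_edge G r v = (verts G, insert (r, v) (edges G))"

lemma verts_add_edge [simp]: "verts (add_edge G r v) = verts G"
  and edges_add_edge [simp]: "edges (add_edge G r v) = insert (r, v) (edges G)"
  by (simp_all add: add_edge_def)

lemma finite_digraph_add_edge:
  "finite_digraph G \<Longrightarrow> r \<in> verts G \<Longrightarrow> v \<in> verts G \<Longrightarrow> finite_digraph (add_edge G r v)"
  by (simp add: finite_digraph_def)

lemma wf_data_add_edge:
  assumes "wf_data G rs ws" "rs \<noteq> []" "v \<in> verts G"
  shows "wf_data (add_edge G (last rs) v) (butlast rs) ws"
proof -
  have "last rs \<in> verts G" using last_in_set[OF assms(2)] assms(1) by (auto simp: wf_data_def)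
  then show ?thesis
    using assms in_set_butlastD[of _ rs] by (auto simp: wf_data_def intro!: finite_digraph_add_edge)
qed

lemma map_digraph_add_edge:
  "add_edge (map_digraph \<phi> G) (\<phi> r) (\<phi> v) = map_digraph \<phi> (add_edge G r v)"
  by (simp add: add_edge_def map_digraph_def)

lemma horizontal_cls:
  assumes "wf_data G rs ws" "rs \<noteq> []"
  shows "horizontal (bas (cls G rs ws))
    = (\<Sum>v\<in>verts G. bas (cls (add_edge G (last rs) v) (butlast rs) ws))"
proof -
  obtain \<phi> where \<phi>: "inj_on \<phi> (verts G)"
    "representative (cls G rs ws) = \<lparr>graph = map_digraph \<phi> G, roots = map \<phi> rs, whites = map \<phi> ws\<rparr>"
    by (rule representative_cls)
  have "horizontal (bas (cls G rs ws)) = (\<Sum>v\<in>\<phi> ` verts G. bas (cls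
      (add_edge (map_digraph \<phi> G) (\<phi> (last rs)) v) (map \<phi> (butlast rs)) (map \<phi> ws)))"
    using assms(2)
    by (simp add: horizontal_def \<phi>(2) attach_last_def last_map map_butlast add_edge_def)
  also have "\<dots> = (\<Sum>v\<in>verts G. bas (cls (map_digraph \<phi> (add_edge G (last rs) v))
      (map \<phi> (butlast rs)) (map \<phi> ws)))"
    by (simp add: sum.reindex[OF \<phi>(1)] map_digraph_add_edge)
  also have "\<dots> = (\<Sum>v\<in>verts G. bas (cls (add_edge G (last rs) v) (butlast rs) ws))"
  proof (rule sum.cong[OF refl])
    fix v assume "v \<in> verts G"
    then have "wf_data (add_edge G (last rs) v) (butlast rs) ws"
      by (rule wf_data_add_edge[OF assms])
    then show "bas (cls (map_digraph \<phi> (add_edge G (last rs) v)) (map \<phi> (butlast rs)) (map \<phi> ws))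
      = bas (cls (add_edge G (last rs) v) (butlast rs) ws)"
      using \<phi>(1) by (subst cls_map) simp_all
  qed
  finally show ?thesis .
qed

lemma whiten_cls:
  assumes "wf_data G rs ws"
  shows "whiten (bas (cls G rs ws)) = (\<Sum>v\<in>verts G - set ws. bas (cls G rs (ws @ [v])))"
proof -
  obtain \<phi> where \<phi>: "inj_on \<phi> (verts G)"
    "representative (cls G rs ws) = \<lparr>graph = map_digraph \<phi> G, roots = map \<phi> rs, whites = map \<phi> ws\<rparr>"
    by (rule representative_cls)
  have V: "\<phi> ` verts G - \<phi> ` set ws = \<phi> ` (verts G - set ws)"
    using assms inj_on_image_set_diff[OF \<phi>(1), of "verts G" "set ws"] by (simp add: wf_data_def)
  have inj: "inj_on \<phi> (verts G - set ws)" using \<phi>(1) by (rule inj_on_subset) simp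
  have "whiten (bas (cls G rs ws))
      = (\<Sum>v\<in>verts G - set ws. bas (cls (map_digraph \<phi> G) (map \<phi> rs) (map \<phi> (ws @ [v]))))"
    by (simp add: whiten_def \<phi>(2) V sum.reindex[OF inj])
  also have "\<dots> = (\<Sum>v\<in>verts G - set ws. bas (cls G rs (ws @ [v])))"
  proof (rule sum.cong[OF refl])
    fix v assume "v \<in> verts G - set ws"
    then have "wf_data G rs (ws @ [v])" using assms by (simp add: wf_data_def)
    then show "bas (cls (map_digraph \<phi> G) (map \<phi> rs) (map \<phi> (ws @ [v]))) = bas (cls G rs (ws @ [v]))"
      using \<phi>(1) by (subst cls_map) simp_all
  qed
  finally show ?thesis .
qed

section \<open>Antisymmetrisation over trees and over white labels, and its interplay with the
  differentials\<close>

lemma linmap_skew_trees: "linmap (skew_trees p)"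
  unfolding skew_trees_def[abs_def] by (intro linmap_fscale linmap_sum linmap_lin)

lemma linmap_skew_whites: "linmap (skew_whites q)"
  unfolding skew_whites_def[abs_def] by (intro linmap_fscale linmap_sum linmap_lin)

lemma linmap_horizontal: "linmap horizontal"
  unfolding horizontal_def by (rule linmap_lin)

lemma linmap_whiten: "linmap whiten"
  unfolding whiten_def by (rule linmap_lin)

lemma skew_trees_cls:
  assumes "wf_data G rs ws" "length rs = p"
  shows "skew_trees p (bas (cls G rs ws)) = fscale (1 / fact p)
    (\<Sum>\<sigma> | \<sigma> permutes {..<p}. fscale (of_int (sign \<sigma>)) (bas (cls G (permute_list \<sigma> rs) ws)))"
  using assms by (simp add: skew_trees_def permute_trees_cls)

lemma skew_whites_cls:
  assumes "wf_data G rs ws" "length ws = q"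
  shows "skew_whites q (bas (cls G rs ws)) = fscale (1 / fact q)
    (\<Sum>\<sigma> | \<sigma> permutes {..<q}. fscale (of_int (sign \<sigma>)) (bas (cls G rs (permute_list \<sigma> ws))))"
  using assms by (simp add: skew_whites_def permute_whites_cls)

text \<open>Left composition with \<open>\<tau>\<close> permutes the index set and multiplies every
  sign by that of \<open>\<tau>\<close>, which is its own inverse.\<close>

lemma sum_sign_compose:
  fixes f :: "(nat \<Rightarrow> nat) \<Rightarrow> ('b \<Rightarrow>\<^sub>0 'k::field)"
  assumes "\<tau> permutes {..<n}"
  shows "(\<Sum>\<sigma> | \<sigma> permutes {..<n}. fscale (of_int (sign \<sigma>)) (f (\<tau> \<circ> \<sigma>)))
    = fscale (of_int (sign \<tau>)) (\<Sum>\<sigma> | \<sigma> permutes {..<n}. fscale (of_int (sign \<sigma>)) (f \<sigma>))"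
proof -
  have perm: "permutation \<rho>" if "\<rho> permutes {..<n}" for \<rho>
    using that by (rule permutes_imp_permutation[OF finite_lessThan])
  have s: "(of_int (sign \<tau>) * of_int (sign \<tau>) :: 'k) = 1"
    by (simp flip: of_int_mult)
  have "(\<Sum>\<sigma> | \<sigma> permutes {..<n}. fscale (of_int (sign \<sigma>)) (f \<sigma>))
    = (\<Sum>\<sigma> | \<sigma> permutes {..<n}. fscale (of_int (sign (\<tau> \<circ> \<sigma>))) (f (\<tau> \<circ> \<sigma>)))"
    using assms by (rule setum_permutations_compose_left)
  also have "\<dots> = (\<Sum>\<sigma> | \<sigma> permutes {..<n}.
      fscale (of_int (sign \<tau>)) (fscale (of_int (sign \<sigma>)) (f (\<tau> \<circ> \<sigma>))))"
    using perm assms by (intro sum.cong refl) (simp add: sign_compose)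
  also have "\<dots> = fscale (of_int (sign \<tau>))
      (\<Sum>\<sigma> | \<sigma> permutes {..<n}. fscale (of_int (sign \<sigma>)) (f (\<tau> \<circ> \<sigma>)))"
    by (rule fvec.scale_sum_right[symmetric])
  finally have e: "(\<Sum>\<sigma> | \<sigma> permutes {..<n}. fscale (of_int (sign \<sigma>)) (f \<sigma>)) = \<dots>" .
  show ?thesis unfolding e by (simp only: fvec.scale_scale s fvec.scale_one)
qed

lemma skew_trees_permute:
  assumes "wf_data G rs ws" "\<tau> permutes {..<length rs}"
  shows "skew_trees (length rs) (bas (cls G (permute_list \<tau> rs) ws))
    = fscale (of_int (sign \<tau>)) (skew_trees (length rs) (bas (cls G rs ws)))"
proof -
  have "skew_trees (length rs) (bas (cls G (permute_list \<tau> rs) ws)) = fscale (1 / fact (length rs))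
    (\<Sum>\<sigma> | \<sigma> permutes {..<length rs}. fscale (of_int (sign \<sigma>)) (bas (cls G (permute_list (\<tau> \<circ> \<sigma>) rs) ws)))"
    using assms by (simp add: skew_trees_cls wf_permute permute_list_compose)
  then show ?thesis
    using assms by (simp add: sum_sign_compose[OF assms(2), of "\<lambda>\<sigma>. bas (cls G (permute_list \<sigma> rs) ws)"]
      skew_trees_cls mult.commute)
qed

lemma skew_whites_permute:
  assumes "wf_data G rs ws" "\<tau> permutes {..<length ws}"
  shows "skew_whites (length ws) (bas (cls G rs (permute_list \<tau> ws)))
    = fscale (of_int (sign \<tau>)) (skew_whites (length ws) (bas (cls G rs ws)))"
proof -
  have "skew_whites (length ws) (bas (cls G rs (permute_list \<tau> ws))) = fscale (1 / fact (length ws))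
    (\<Sum>\<sigma> | \<sigma> permutes {..<length ws}. fscale (of_int (sign \<sigma>)) (bas (cls G rs (permute_list (\<tau> \<circ> \<sigma>) ws))))"
    using assms by (simp add: skew_whites_cls wf_permute permute_list_compose)
  then show ?thesis
    using assms by (simp add: sum_sign_compose[OF assms(2), of "\<lambda>\<sigma>. bas (cls G rs (permute_list \<sigma> ws))"]
      skew_whites_cls mult.commute)
qed

text \<open>Coarser than \<open>forest_classes\<close>: the operations on trees and on white labels
  commute for reasons that do not involve the shape of the components, and well-formedness is
  preserved by all of them.\<close>

definition wf_classes :: "nat \<Rightarrow> nat \<Rightarrow> forest_class set"
  where "wf_classes p q = {cls G rs ws | G rs ws. wf_data G rs ws \<and> length rs = p \<and> length ws = q}"

lemma cls_in_span: "wf_data G rs ws \<Longrightarrow> length rs = p \<Longrightarrow> length ws = q \<Longrightarrow> bas (cls G rs ws) \<in> span_of (wf_classes p q)"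
  unfolding wf_classes_def by (rule bas_in_span_of) blast

lemma scaled_sum_swap:
  "fscale a (\<Sum>i\<in>A. fscale (s i) (fscale b (\<Sum>j\<in>B. fscale (t j) (f i j))))
    = fscale b (\<Sum>j\<in>B. fscale (t j) (fscale a (\<Sum>i\<in>A. fscale (s i) (f i j))))"
proof -
  have "fscale a (\<Sum>i\<in>A. fscale (s i) (fscale b (\<Sum>j\<in>B. fscale (t j) (f i j))))
      = (\<Sum>i\<in>A. \<Sum>j\<in>B. fscale (a * b * s i * t j) (f i j))"
    by (simp add: fvec.scale_sum_right mult_ac)
  also have "\<dots> = (\<Sum>j\<in>B. \<Sum>i\<in>A. fscale (a * b * s i * t j) (f i j))" by (rule sum.swap)
  also have "\<dots> = fscale b (\<Sum>j\<in>B. fscale (t j) (fscale a (\<Sum>i\<in>A. fscale (s i) (f i j))))"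
    by (simp add: fvec.scale_sum_right mult_ac)
  finally show ?thesis .
qed

lemma skew_whites_skew_trees:
  fixes x :: "forest_class \<Rightarrow>\<^sub>0 'k::field_char_0"
  assumes "x \<in> span_of (wf_classes p q)"
  shows "skew_whites q (skew_trees p x) = skew_trees p (skew_whites q x)"
proof (rule linmap_eq_on_span[OF _ _ _ assms[unfolded span_of_def]])
  show "linmap (\<lambda>x. skew_whites q (skew_trees p x))" "linmap (\<lambda>x. skew_trees p (skew_whites q x))"
    by (rule linmap_comp[OF linmap_skew_whites linmap_skew_trees] linmap_comp[OF linmap_skew_trees linmap_skew_whites])+
  fix y :: "forest_class \<Rightarrow>\<^sub>0 'k" assume "y \<in> bas ` wf_classes p q"
  then obtain G rs ws where y: "y = bas (cls G rs ws)" "wf_data G rs ws" "length rs = p" "length ws = q"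
    by (auto simp: wf_classes_def)
  have 1: "skew_whites q (skew_trees p y) = fscale (1 / fact p) (\<Sum>\<sigma> | \<sigma> permutes {..<p}. fscale (of_int (sign \<sigma>))
      (fscale (1 / fact q) (\<Sum>\<tau> | \<tau> permutes {..<q}. fscale (of_int (sign \<tau>))
        (bas (cls G (permute_list \<sigma> rs) (permute_list \<tau> ws))))))"
    using y by (simp add: skew_trees_cls skew_whites_cls wf_permute module_hom.scale[OF linmap_skew_whites]
      module_hom.sum[OF linmap_skew_whites] del: fvec.scale_scale)
  have 2: "skew_trees p (skew_whites q y) = fscale (1 / fact q) (\<Sum>\<tau> | \<tau> permutes {..<q}. fscale (of_int (sign \<tau>))
      (fscale (1 / fact p) (\<Sum>\<sigma> | \<sigma> permutes {..<p}. fscale (of_int (sign \<sigma>))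
        (bas (cls G (permute_list \<sigma> rs) (permute_list \<tau> ws))))))"
    using y by (simp add: skew_trees_cls skew_whites_cls wf_permute module_hom.scale[OF linmap_skew_trees]
      module_hom.sum[OF linmap_skew_trees] del: fvec.scale_scale)
  show "skew_whites q (skew_trees p y) = skew_trees p (skew_whites q y)"
    unfolding 1 2 by (rule scaled_sum_swap)
qed

lemma whiten_skew_trees:
  fixes x :: "forest_class \<Rightarrow>\<^sub>0 'k::field_char_0"
  assumes "x \<in> span_of (wf_classes p q)"
  shows "whiten (skew_trees p x) = skew_trees p (whiten x)"
proof (rule linmap_eq_on_span[OF _ _ _ assms[unfolded span_of_def]])
  show "linmap (\<lambda>x. whiten (skew_trees p x))" "linmap (\<lambda>x. skew_trees p (whiten x))"
    by (rule linmap_comp[OF linmap_whiten linmap_skew_trees] linmap_comp[OF linmap_skew_trees linmap_whiten])+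
  fix y :: "forest_class \<Rightarrow>\<^sub>0 'k" assume "y \<in> bas ` wf_classes p q"
  then obtain G rs ws where y: "y = bas (cls G rs ws)" "wf_data G rs ws" "length rs = p" "length ws = q"
    by (auto simp: wf_classes_def)
  have 1: "whiten (skew_trees p y) = fscale (1 / fact p) (\<Sum>\<sigma> | \<sigma> permutes {..<p}. \<Sum>v\<in>verts G - set ws.
      fscale (of_int (sign \<sigma>)) (bas (cls G (permute_list \<sigma> rs) (ws @ [v]))))"
    using y by (simp add: skew_trees_cls whiten_cls wf_permute module_hom.scale[OF linmap_whiten]
      module_hom.sum[OF linmap_whiten] fvec.scale_sum_right[symmetric] del: fvec.scale_scale)
  have "wf_data G rs (ws @ [v])" if "v \<in> verts G - set ws" for v
    using y that by (auto simp: wf_data_def)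
  then have 2: "skew_trees p (whiten y) = fscale (1 / fact p) (\<Sum>v\<in>verts G - set ws. \<Sum>\<sigma> | \<sigma> permutes {..<p}.
      fscale (of_int (sign \<sigma>)) (bas (cls G (permute_list \<sigma> rs) (ws @ [v]))))"
    using y by (simp add: skew_trees_cls whiten_cls module_hom.sum[OF linmap_skew_trees]
      fvec.scale_sum_right[symmetric] del: fvec.scale_scale)
  show "whiten (skew_trees p y) = skew_trees p (whiten y)"
    unfolding 1 2 by (rule arg_cong[OF sum.swap])
qed

text \<open>The new edge does not touch the white labels. With \<open>skew_trees\<close> there is no
  such commutation, because only the last tree is attached; that case is the subject of
  \<open>horizontal_skew_trees\<close>.\<close>

lemma horizontal_skew_whites:
  fixes x :: "forest_class \<Rightarrow>\<^sub>0 'k::field_char_0"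
  assumes "x \<in> span_of (wf_classes (Suc p) q)"
  shows "horizontal (skew_whites q x) = skew_whites q (horizontal x)"
proof (rule linmap_eq_on_span[OF _ _ _ assms[unfolded span_of_def]])
  show "linmap (\<lambda>x. horizontal (skew_whites q x))" "linmap (\<lambda>x. skew_whites q (horizontal x))"
    by (rule linmap_comp[OF linmap_horizontal linmap_skew_whites] linmap_comp[OF linmap_skew_whites linmap_horizontal])+
  fix y :: "forest_class \<Rightarrow>\<^sub>0 'k" assume "y \<in> bas ` wf_classes (Suc p) q"
  then obtain G rs ws where y: "y = bas (cls G rs ws)" "wf_data G rs ws" "length rs = Suc p" "length ws = q"
    by (auto simp: wf_classes_def)
  then have rs: "rs \<noteq> []" by auto
  let ?c = "\<lambda>v ws. cls (add_edge G (last rs) v) (butlast rs) ws"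
  have 1: "horizontal (skew_whites q y) = fscale (1 / fact q) (\<Sum>\<sigma> | \<sigma> permutes {..<q}. \<Sum>v\<in>verts G.
      fscale (of_int (sign \<sigma>)) (bas (?c v (permute_list \<sigma> ws))))"
    using y rs by (simp add: skew_whites_cls horizontal_cls wf_permute module_hom.scale[OF linmap_horizontal]
      module_hom.sum[OF linmap_horizontal] fvec.scale_sum_right[symmetric] del: fvec.scale_scale)
  have "wf_data (add_edge G (last rs) v) (butlast rs) ws" if "v \<in> verts G" for v
    by (rule wf_data_add_edge[OF y(2) rs that])
  then have 2: "skew_whites q (horizontal y) = fscale (1 / fact q) (\<Sum>v\<in>verts G. \<Sum>\<sigma> | \<sigma> permutes {..<q}.
      fscale (of_int (sign \<sigma>)) (bas (?c v (permute_list \<sigma> ws))))"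
    using y rs by (simp add: skew_whites_cls horizontal_cls module_hom.sum[OF linmap_skew_whites]
      fvec.scale_sum_right[symmetric] del: fvec.scale_scale)
  show "horizontal (skew_whites q y) = skew_whites q (horizontal y)"
    unfolding 1 2 by (rule arg_cong[OF sum.swap])
qed

section \<open>Antisymmetrised forests\<close>

text \<open>The set \<open>R\<close> is a separate argument so that the sign computations need not
  know which vertices are sinks; in the applications it is the set of all sinks.\<close>

definition alt :: "nat digraph \<Rightarrow> nat set \<Rightarrow> nat set \<Rightarrow> (forest_class \<Rightarrow>\<^sub>0 'k::field_char_0)"
  where "alt G R Q = skew_trees (card R) (skew_whites (card Q)
    (bas (cls G (sorted_list_of_set R) (sorted_list_of_set Q))))"

definition wf_alt :: "'v digraph \<Rightarrow> 'v set \<Rightarrow> 'v set \<Rightarrow> bool"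
  where "wf_alt G R Q \<longleftrightarrow> finite_digraph G \<and> R \<subseteq> verts G \<and> Q \<subseteq> verts G"

lemma wf_alt_finite: "wf_alt G R Q \<Longrightarrow> finite (verts G) \<and> finite R \<and> finite Q"
  by (auto simp: wf_alt_def finite_digraph_def intro: finite_subset)

lemma wf_data_sorted: "wf_alt G R Q \<Longrightarrow> wf_data G (sorted_list_of_set R) (sorted_list_of_set Q)"
  using wf_alt_finite[of G R Q] by (simp add: wf_data_def wf_alt_def)

lemma permutation_of_sorted:
  fixes xs :: "nat list"
  assumes "distinct xs"
  obtains \<sigma> where "\<sigma> permutes {..<length xs}" "xs = permute_list \<sigma> (sorted_list_of_set (set xs))"
    "(orientation xs :: 'k::field) = of_int (sign \<sigma>)"
proof -
  have "mset xs = mset (sorted_list_of_set (set xs))"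
    using assms by (simp add: set_eq_iff_mset_eq_distinct[symmetric])
  then obtain \<sigma> where \<sigma>: "\<sigma> permutes {..<length (sorted_list_of_set (set xs))}"
    "permute_list \<sigma> (sorted_list_of_set (set xs)) = xs" by (rule mset_eq_permutation)
  moreover have "length (sorted_list_of_set (set xs)) = length xs"
    using assms by (simp add: distinct_card)
  moreover have "(orientation xs :: 'k) = of_int (sign \<sigma>)"
    using orientation_permute_list[OF _ \<sigma>(1), where ?'k = 'k] \<sigma>(2) by simp
  ultimately show ?thesis using that by simp
qed

text \<open>Sorting each list costs its orientation. The inner antisymmetrisation absorbs the
  reordering of the white vertices; then the two are exchanged, so that the other one can absorb
  that of the roots.\<close>

lemma skew_cls:
  assumes "wf_data G rs ws" "distinct rs" "distinct ws" "length rs = p" "length ws = q"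
  shows "skew_trees p (skew_whites q (bas (cls G rs ws)))
    = fscale (orientation rs * orientation ws) (alt G (set rs) (set ws) :: _ \<Rightarrow>\<^sub>0 'k::field_char_0)"
proof -
  let ?rs = "sorted_list_of_set (set rs)" and ?ws = "sorted_list_of_set (set ws)"
  obtain \<sigma> where \<sigma>: "\<sigma> permutes {..<length rs}" "rs = permute_list \<sigma> ?rs"
    "(orientation rs :: 'k) = of_int (sign \<sigma>)"
    using permutation_of_sorted[OF assms(2)] .
  obtain \<tau> where \<tau>: "\<tau> permutes {..<length ws}" "ws = permute_list \<tau> ?ws"
    "(orientation ws :: 'k) = of_int (sign \<tau>)"
    using permutation_of_sorted[OF assms(3)] .
  have len: "length ?rs = p" "length ?ws = q" "card (set rs) = p" "card (set ws) = q"
    using assms by (simp_all add: distinct_card)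
  have wf: "wf_data G rs ?ws" "wf_data G ?rs ?ws" using assms(1) by (simp_all add: wf_data_def)
  have "skew_trees p (skew_whites q (bas (cls G rs ws) :: _ \<Rightarrow>\<^sub>0 'k))
      = skew_trees p (skew_whites q (bas (cls G rs (permute_list \<tau> ?ws))))"
    using \<tau>(2) by simp
  also have "\<dots> = fscale (of_int (sign \<tau>)) (skew_trees p (skew_whites q (bas (cls G rs ?ws))))"
    using skew_whites_permute[OF wf(1), of \<tau>, where ?'a = 'k] \<tau>(1) len assms(5)
    by (simp add: module_hom.scale[OF linmap_skew_trees])
  also have "skew_trees p (skew_whites q (bas (cls G rs ?ws) :: _ \<Rightarrow>\<^sub>0 'k))
      = skew_whites q (skew_trees p (bas (cls G rs ?ws)))"
    by (intro skew_whites_skew_trees[symmetric] cls_in_span wf assms(4) len)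
  also have "\<dots> = skew_whites q (skew_trees p (bas (cls G (permute_list \<sigma> ?rs) ?ws)))"
    using \<sigma>(2) by simp
  also have "\<dots> = fscale (of_int (sign \<sigma>)) (skew_whites q (skew_trees p (bas (cls G ?rs ?ws))))"
    using skew_trees_permute[OF wf(2), of \<sigma>, where ?'a = 'k] \<sigma>(1) len assms(4)
    by (simp add: module_hom.scale[OF linmap_skew_whites])
  also have "skew_whites q (skew_trees p (bas (cls G ?rs ?ws) :: _ \<Rightarrow>\<^sub>0 'k))
      = skew_trees p (skew_whites q (bas (cls G ?rs ?ws)))"
    by (intro skew_whites_skew_trees cls_in_span wf len)
  finally show ?thesis
    by (simp add: alt_def len \<sigma>(3) \<tau>(3) mult.commute)
qed

text \<open>Relabelling keeps the isomorphism class but not the order of the labels; the two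
  orientations are the cost of sorting the images of the roots and of the white vertices.\<close>

lemma alt_map:
  assumes "wf_alt G R Q" "inj_on \<phi> (verts G)"
  shows "(alt G R Q :: _ \<Rightarrow>\<^sub>0 'k::field_char_0)
    = fscale (orientation (map \<phi> (sorted_list_of_set R)) * orientation (map \<phi> (sorted_list_of_set Q)))
      (alt (map_digraph \<phi> G) (\<phi> ` R) (\<phi> ` Q))"
proof -
  let ?rs = "sorted_list_of_set R" and ?ws = "sorted_list_of_set Q"
  note fin = wf_alt_finite[OF assms(1)]
  have sub: "R \<subseteq> verts G" "Q \<subseteq> verts G" using assms(1) by (auto simp: wf_alt_def)
  have inj: "inj_on \<phi> R" "inj_on \<phi> Q" using assms(2) sub by (auto intro: inj_on_subset)
  have wf: "wf_data (map_digraph \<phi> G) (map \<phi> ?rs) (map \<phi> ?ws)"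
    using assms(1) fin sub by (simp add: wf_data_def wf_alt_def finite_digraph_map image_mono)
  have "(alt G R Q :: _ \<Rightarrow>\<^sub>0 'k) = skew_trees (card R) (skew_whites (card Q)
      (bas (cls (map_digraph \<phi> G) (map \<phi> ?rs) (map \<phi> ?ws))))"
    unfolding alt_def using cls_map[OF wf_data_sorted[OF assms(1)] assms(2)] by simp
  also have "\<dots> = fscale (orientation (map \<phi> ?rs) * orientation (map \<phi> ?ws))
      (alt (map_digraph \<phi> G) (\<phi> ` R) (\<phi> ` Q))"
    using skew_cls[OF wf, of "card R" "card Q"] inj fin by (simp add: distinct_map)
  finally show ?thesis .
qed

lemma permute_list_snoc:
  assumes "\<sigma> permutes {..<length xs}"
  shows "permute_list \<sigma> (xs @ [x]) = permute_list \<sigma> xs @ [x]"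
proof (rule nth_equalityI)
  fix i assume i: "i < length (permute_list \<sigma> (xs @ [x]))"
  show "permute_list \<sigma> (xs @ [x]) ! i = (permute_list \<sigma> xs @ [x]) ! i"
  proof (cases "i < length xs")
    case True
    then have "\<sigma> i < length xs" using permutes_in_image[OF assms] by auto
    then show ?thesis using True by (simp add: permute_list_nth_less nth_append)
  next
    case False
    then have "i = length xs" "\<sigma> i = i" using i permutes_not_in[OF assms] by auto
    then show ?thesis by (simp add: permute_list_nth_less nth_append)
  qed
qed simp

text \<open>The permutations of the trees are grouped by the tree that becomes the last one.\<close>

lemma horizontal_skew_trees:
  fixes G :: "nat digraph" and rs ws :: "nat list"
  defines "us \<equiv> \<lambda>b. butlast (permute_list (transpose (length rs - 1) b) rs)"
  assumes "wf_data G rs ws" "length rs = Suc n"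
  shows "horizontal (skew_trees (Suc n) (bas (cls G rs ws) :: _ \<Rightarrow>\<^sub>0 'k::field_char_0))
    = fscale (1 / of_nat (Suc n)) (\<Sum>b<Suc n. \<Sum>v\<in>verts G. fscale (of_int (sign (transpose n b)))
      (skew_trees n (bas (cls (add_edge G (rs ! b) v) (us b) ws))))"
proof -
  have us: "permute_list (transpose n b) rs = us b @ [rs ! b]" "length (us b) = n"
      "wf_data (add_edge G (rs ! b) v) (us b) ws"
    if "b < Suc n" "v \<in> verts G" for b v
  proof -
    have b: "transpose n b permutes {..<length rs}"
      using that(1) assms(3) by (intro permutes_swap_id) auto
    have ne: "permute_list (transpose n b) rs \<noteq> []" using assms(3) by (metis length_permute_list list.size(3) nat.distinct(1))
    have l: "last (permute_list (transpose n b) rs) = rs ! b"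
      using ne assms(3) by (simp add: last_conv_nth permute_list_nth_less)
    show "permute_list (transpose n b) rs = us b @ [rs ! b]"
      using append_butlast_last_id[OF ne] l assms(3) by (simp add: us_def)
    show "length (us b) = n" using assms(3) by (simp add: us_def)
    have "wf_data G (permute_list (transpose n b) rs) ws" using assms(2) wf_permute(1)[OF b] by blast
    from wf_data_add_edge[OF this ne that(2)] show "wf_data (add_edge G (rs ! b) v) (us b) ws"
      using l assms(3) by (simp add: us_def)
  qed
  define t :: "nat \<Rightarrow> 'k" where "t b = of_int (sign (transpose n b))" for b
  define F where "F b q v = (bas (cls (add_edge G (rs ! b) v) (permute_list q (us b)) ws) :: _ \<Rightarrow>\<^sub>0 'k)" for b q v
  have hor: "horizontal (bas (cls G (permute_list (transpose n b \<circ> q) rs) ws)) = (\<Sum>v\<in>verts G. F b q v)"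
    if b: "b < Suc n" and q: "q permutes {..<n}" and v: "v \<in> verts G" for b q v
  proof -
    have t: "transpose n b permutes {..<length rs}"
      using b assms(3) by (intro permutes_swap_id) auto
    have q': "q permutes {..<length rs}" using q by (rule permutes_subset) (use assms(3) in auto)
    have e: "permute_list (transpose n b \<circ> q) rs = permute_list q (us b) @ [rs ! b]"
      using permute_list_compose[OF q', of "transpose n b"] us[OF b v] q by (simp add: permute_list_snoc)
    have "wf_data G (permute_list (transpose n b \<circ> q) rs) ws"
      using assms(2) wf_permute(1)[OF permutes_compose[OF q' t]] by blast
    then show ?thesis unfolding e by (subst horizontal_cls) (simp_all add: F_def)
  qed
  show ?thesis
  \<comment> \<open>The auxiliary facts are stated at some vertex; without vertices there could be
    no roots.\<close>
  proof (cases "verts G = {}")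
    case True
    then show ?thesis using assms(2,3) by (auto simp: wf_data_def)
  next
    case False
    then obtain v0 where v0: "v0 \<in> verts G" by auto
    let ?P = "\<lambda>n. {q. q permutes {..<n}}"
    define H where "H \<sigma> = (fscale (of_int (sign \<sigma>)) (horizontal (bas (cls G (permute_list \<sigma> rs) ws))) :: _ \<Rightarrow>\<^sub>0 'k)" for \<sigma>
    have "horizontal (skew_trees (Suc n) (bas (cls G rs ws))) = fscale (1 / fact (Suc n)) (\<Sum>\<sigma>\<in>?P (Suc n). H \<sigma>)"
      unfolding H_def using assms(2,3)
      by (simp only: skew_trees_cls module_hom.scale[OF linmap_horizontal] module_hom.sum[OF linmap_horizontal])
    \<comment> \<open>Each permutation of \<open>n + 1\<close> places is uniquely
      \<open>transpose n b \<circ> q\<close> with \<open>q\<close> fixing \<open>n\<close>. It sends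
      \<open>n\<close> to \<open>b\<close>, which is what moves \<open>rs ! b\<close> to the last
      place.\<close>
    also have "(\<Sum>\<sigma>\<in>?P (Suc n). H \<sigma>) = (\<Sum>b<Suc n. \<Sum>q\<in>?P n. H (transpose n b \<circ> q))"
      unfolding lessThan_Suc by (rule sum_over_permutations_insert) auto
    also have "\<dots> = (\<Sum>b<Suc n. \<Sum>q\<in>?P n. \<Sum>v\<in>verts G. fscale (t b * of_int (sign q)) (F b q v))"
    proof (intro sum.cong refl)
      fix b q assume "b \<in> {..<Suc n}" "q \<in> ?P n"
      then have b: "b < Suc n" and q: "q permutes {..<n}" by auto
      have "sign (transpose n b \<circ> q) = sign (transpose n b) * sign q"
        using permutes_imp_permutation[OF finite_lessThan q] by (simp add: sign_compose permutation_swap_id)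
      then show "H (transpose n b \<circ> q) = (\<Sum>v\<in>verts G. fscale (t b * of_int (sign q)) (F b q v))"
        unfolding H_def hor[OF b q v0] by (simp add: t_def fvec.scale_sum_right)
    qed
    also have "\<dots> = (\<Sum>b<Suc n. \<Sum>v\<in>verts G. \<Sum>q\<in>?P n. fscale (t b * of_int (sign q)) (F b q v))"
      by (intro sum.cong refl sum.swap)
    also have "\<dots> = (\<Sum>b<Suc n. \<Sum>v\<in>verts G. fscale (fact n) (fscale (t b)
        (skew_trees n (bas (cls (add_edge G (rs ! b) v) (us b) ws)))))"
    proof (intro sum.cong refl)
      fix b v assume "b \<in> {..<Suc n}" and v: "v \<in> verts G"
      then have b: "b < Suc n" by simp
      show "(\<Sum>q\<in>?P n. fscale (t b * of_int (sign q)) (F b q v)) = fscale (fact n) (fscale (t b)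
        (skew_trees n (bas (cls (add_edge G (rs ! b) v) (us b) ws))))"
        unfolding skew_trees_cls[OF us(3)[OF b v] us(2)[OF b v]] F_def
        by (simp add: fvec.scale_sum_right)
    qed
    also have "\<dots> = fscale (fact n) (\<Sum>b<Suc n. \<Sum>v\<in>verts G. fscale (t b)
        (skew_trees n (bas (cls (add_edge G (rs ! b) v) (us b) ws))))"
      by (simp only: fvec.scale_sum_right)
    finally have "horizontal (skew_trees (Suc n) (bas (cls G rs ws))) = fscale (1 / fact (Suc n)) \<dots>" .
    moreover have "(1 / fact (Suc n) * fact n :: 'k) = 1 / of_nat (Suc n)"
      by (simp del: of_nat_Suc)
    ultimately show ?thesis by (simp only: t_def fvec.scale_scale)
  qed
qed

text \<open>The sign of contracting an ordered exterior monomial with one of its generators, here a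
  root, or of multiplying it from the left by a new one, here a white vertex.\<close>

definition below_sign :: "nat set \<Rightarrow> nat \<Rightarrow> 'k::field"
  where "below_sign R r = (- 1) ^ card {s \<in> R. s < r}"

lemma card_below_above:
  fixes r :: nat
  assumes "finite R" "r \<in> R"
  shows "card R = Suc (card {s \<in> R. s < r} + card {s \<in> R. r < s})"
proof -
  have "R = insert r ({s \<in> R. s < r} \<union> {s \<in> R. r < s})" using assms(2) by auto
  then have "card R = card (insert r ({s \<in> R. s < r} \<union> {s \<in> R. r < s}))" by simp
  also have "\<dots> = Suc (card ({s \<in> R. s < r} \<union> {s \<in> R. r < s}))" using assms(1) by simp
  also have "card ({s \<in> R. s < r} \<union> {s \<in> R. r < s}) = card {s \<in> R. s < r} + card {s \<in> R. r < s}"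
    using assms(1) by (intro card_Un_disjoint) auto
  finally show ?thesis .
qed

lemma skew_trees_in_span:
  assumes "x \<in> span_of (wf_classes p q)"
  shows "skew_trees p x \<in> span_of (wf_classes p q)"
proof (rule linmap_in_subspace[OF linmap_skew_trees subspace_span_of _ assms[unfolded span_of_def]])
  fix y :: "forest_class \<Rightarrow>\<^sub>0 'a" assume "y \<in> bas ` wf_classes p q"
  then obtain G rs ws where y: "y = bas (cls G rs ws)" "wf_data G rs ws" "length rs = p" "length ws = q"
    by (auto simp: wf_classes_def)
  show "skew_trees p y \<in> span_of (wf_classes p q)"
    unfolding y(1) skew_trees_cls[OF y(2,3)]
    by (intro fvec.subspace_scale fvec.subspace_sum subspace_span_of cls_in_span)
       (use y in \<open>auto simp: wf_permute\<close>)
qed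

lemma skew_whites_in_span:
  assumes "x \<in> span_of (wf_classes p q)"
  shows "skew_whites q x \<in> span_of (wf_classes p q)"
proof (rule linmap_in_subspace[OF linmap_skew_whites subspace_span_of _ assms[unfolded span_of_def]])
  fix y :: "forest_class \<Rightarrow>\<^sub>0 'a" assume "y \<in> bas ` wf_classes p q"
  then obtain G rs ws where y: "y = bas (cls G rs ws)" "wf_data G rs ws" "length rs = p" "length ws = q"
    by (auto simp: wf_classes_def)
  show "skew_whites q y \<in> span_of (wf_classes p q)"
    unfolding y(1) skew_whites_cls[OF y(2,4)]
    by (intro fvec.subspace_scale fvec.subspace_sum subspace_span_of cls_in_span)
       (use y in \<open>auto simp: wf_permute\<close>)
qed

lemma whiten_in_span:
  assumes "x \<in> span_of (wf_classes p q)"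
  shows "whiten x \<in> span_of (wf_classes p (Suc q))"
proof (rule linmap_in_subspace[OF linmap_whiten subspace_span_of _ assms[unfolded span_of_def]])
  fix y :: "forest_class \<Rightarrow>\<^sub>0 'a" assume "y \<in> bas ` wf_classes p q"
  then obtain G rs ws where y: "y = bas (cls G rs ws)" "wf_data G rs ws" "length rs = p" "length ws = q"
    by (auto simp: wf_classes_def)
  show "whiten y \<in> span_of (wf_classes p (Suc q))"
    unfolding y(1) whiten_cls[OF y(2)]
    by (intro fvec.subspace_sum subspace_span_of cls_in_span) (use y in \<open>auto simp: wf_data_def\<close>)
qed

text \<open>Bringing the root \<open>r\<close> to the last place passes all larger roots. As there
  are \<open>n\<close> other roots, this sign is \<open>(- 1) ^ n\<close> times that of the smaller
  ones. The denominator remains from grouping the \<open>n + 1\<close> possible last roots under the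
  normalised antisymmetrisation.\<close>

lemma horizontal_alt:
  assumes "wf_alt G R Q" "card R = Suc n"
  shows "horizontal (alt G R Q :: _ \<Rightarrow>\<^sub>0 'k::field_char_0) = fscale ((- 1) ^ n / of_nat (Suc n))
    (\<Sum>r\<in>R. \<Sum>v\<in>verts G. fscale (below_sign R r) (alt (add_edge G r v) (R - {r}) Q))"
proof -
  note fin = wf_alt_finite[OF assms(1)]
  let ?rs = "sorted_list_of_set R" and ?ws = "sorted_list_of_set Q" and ?q = "card Q"
  define us where "us b = butlast (permute_list (transpose n b) ?rs)" for b
  note wf = wf_data_sorted[OF assms(1)]
  have len: "length ?rs = Suc n" "length ?ws = ?q" using assms(2) by simp_all
  note span = cls_in_span[OF wf len, where ?'a = 'k]
  have "horizontal (alt G R Q :: _ \<Rightarrow>\<^sub>0 'k) = horizontal (skew_whites ?q (skew_trees (Suc n) (bas (cls G ?rs ?ws))))"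
    unfolding alt_def assms(2) skew_whites_skew_trees[OF span] ..
  also have "\<dots> = skew_whites ?q (horizontal (skew_trees (Suc n) (bas (cls G ?rs ?ws))))"
    by (rule horizontal_skew_whites[OF skew_trees_in_span[OF span]])
  also have "horizontal (skew_trees (Suc n) (bas (cls G ?rs ?ws) :: _ \<Rightarrow>\<^sub>0 'k))
    = fscale (1 / of_nat (Suc n)) (\<Sum>b<Suc n. \<Sum>v\<in>verts G. fscale (of_int (sign (transpose n b)))
      (skew_trees n (bas (cls (add_edge G (?rs ! b) v) (us b) ?ws))))"
    using horizontal_skew_trees[OF wf len(1), where ?'k = 'k] by (simp only: us_def len diff_Suc_1)
  also have "skew_whites ?q \<dots> = fscale (1 / of_nat (Suc n)) (\<Sum>b<Suc n. \<Sum>v\<in>verts G.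
      fscale (of_int (sign (transpose n b)))
        (skew_whites ?q (skew_trees n (bas (cls (add_edge G (?rs ! b) v) (us b) ?ws)))))"
    by (simp only: module_hom.scale[OF linmap_skew_whites] module_hom.sum[OF linmap_skew_whites])
  also have "(\<Sum>b<Suc n. \<Sum>v\<in>verts G. fscale (of_int (sign (transpose n b)))
        (skew_whites ?q (skew_trees n (bas (cls (add_edge G (?rs ! b) v) (us b) ?ws)) :: _ \<Rightarrow>\<^sub>0 'k)))
     = (\<Sum>b<Suc n. \<Sum>v\<in>verts G. fscale ((- 1) ^ n) (fscale (below_sign R (?rs ! b))
        (alt (add_edge G (?rs ! b) v) (R - {?rs ! b}) Q)))"
  proof (intro sum.cong refl)
    fix b v assume "b \<in> {..<Suc n}" and v: "v \<in> verts G"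
    then have b: "b < length ?rs" using len by simp
    let ?r = "?rs ! b"
    have r: "?r \<in> R" using nth_mem[OF b] fin by simp
    have t: "transpose n b permutes {..<length ?rs}" using b len by (intro permutes_swap_id) auto
    have ne: "permute_list (transpose n b) ?rs \<noteq> []"
      using len by (metis length_permute_list list.size(3) nat.distinct(1))
    have l: "last (permute_list (transpose n b) ?rs) = ?r"
      using ne len by (simp add: last_conv_nth permute_list_nth_less)
    have us: "permute_list (transpose n b) ?rs = us b @ [?r]"
      using append_butlast_last_id[OF ne] l by (simp add: us_def)
    have d: "distinct (us b @ [?r])" unfolding us[symmetric] using t by simp
    have "set (us b @ [?r]) = R" unfolding us[symmetric] using t fin by simp
    with d have set: "set (us b) = R - {?r}" by auto
    have "wf_data G (permute_list (transpose n b) ?rs) ?ws" using wf wf_permute(1)[OF t] by blast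
    from wf_data_add_edge[OF this ne v] have wf': "wf_data (add_edge G ?r v) (us b) ?ws"
      using l by (simp add: us_def)
    have len': "length (us b) = n" using len by (simp add: us_def)
    have "skew_whites ?q (skew_trees n (bas (cls (add_edge G ?r v) (us b) ?ws)))
      = skew_trees n (skew_whites ?q (bas (cls (add_edge G ?r v) (us b) ?ws)) :: _ \<Rightarrow>\<^sub>0 'k)"
      by (rule skew_whites_skew_trees[OF cls_in_span[OF wf' len' len(2)]])
    also have "\<dots> = fscale (orientation (us b)) (alt (add_edge G ?r v) (R - {?r}) Q)"
      using skew_cls[OF wf' _ _ len' len(2), where ?'k = 'k] d set fin by simp
    finally have 1: "skew_whites ?q (skew_trees n (bas (cls (add_edge G ?r v) (us b) ?ws)))
      = fscale (orientation (us b)) (alt (add_edge G ?r v) (R - {?r}) Q :: _ \<Rightarrow>\<^sub>0 'k)" .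
    \<comment> \<open>The starting list is sorted, so the sign of the transposition is the
      orientation of the list it produces.\<close>
    have "(of_int (sign (transpose n b)) :: 'k) = orientation (us b @ [?r])"
      using orientation_permute_list[OF _ t, where ?'k = 'k] by (simp add: us)
    also have "\<dots> = (- 1) ^ card {s \<in> R. ?r < s} * orientation (us b)"
    proof -
      have "{s \<in> set (us b). ?r < s} = {s \<in> R. ?r < s}" using set by auto
      moreover have "distinct (us b)" using d by simp
      ultimately show ?thesis by (simp only: orientation_snoc length_filter_distinct)
    qed
    finally have "(of_int (sign (transpose n b)) * orientation (us b) :: 'k) = (- 1) ^ card {s \<in> R. ?r < s}"
      by (simp add: mult.assoc)
    \<comment> \<open>Passing from the larger to the smaller roots: together they number
      \<open>n\<close>, and the square of the second sign is one.\<close>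
    also have "\<dots> = (- 1) ^ (card {s \<in> R. s < ?r} + card {s \<in> R. ?r < s}) * (- 1) ^ card {s \<in> R. s < ?r}"
      by (simp add: power_add)
    also have "card {s \<in> R. s < ?r} + card {s \<in> R. ?r < s} = n"
      using card_below_above[of R ?r] fin r assms(2) by simp
    finally have "(of_int (sign (transpose n b)) * orientation (us b) :: 'k) = (- 1) ^ n * below_sign R ?r"
      by (simp add: below_sign_def)
    then show "fscale (of_int (sign (transpose n b)))
        (skew_whites ?q (skew_trees n (bas (cls (add_edge G ?r v) (us b) ?ws))))
      = fscale ((- 1) ^ n) (fscale (below_sign R ?r) (alt (add_edge G ?r v) (R - {?r}) Q) :: _ \<Rightarrow>\<^sub>0 'k)"
      unfolding 1 by simp
  qed
  also have "\<dots> = (\<Sum>r\<in>R. \<Sum>v\<in>verts G. fscale ((- 1) ^ n) (fscale (below_sign R r)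
        (alt (add_edge G r v) (R - {r}) Q)))"
    by (rule sum.reindex_bij_betw[OF bij_betw_nth]) (use len fin in auto)
  finally show ?thesis
    by (simp add: fvec.scale_sum_right)
qed

text \<open>The new white vertex is appended at the end, and moving it past the larger ones gives
  \<open>(- 1) ^ q * below_sign Q v\<close>. In contrast to the horizontal case no denominator
  survives, since no permutation of the old white labels affects which vertex is the new
  one.\<close>

lemma whiten_alt:
  assumes "wf_alt G R Q" "card Q = q"
  shows "skew_whites (Suc q) (whiten (alt G R Q :: _ \<Rightarrow>\<^sub>0 'k::field_char_0))
    = (\<Sum>v\<in>verts G - Q. fscale ((- 1) ^ q * below_sign Q v) (alt G R (insert v Q)))"
proof -
  note fin = wf_alt_finite[OF assms(1)]
  let ?rs = "sorted_list_of_set R" and ?ws = "sorted_list_of_set Q" and ?p = "card R"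
  let ?P = "{\<tau>. \<tau> permutes {..<q}}"
  note wf = wf_data_sorted[OF assms(1)]
  have len: "length ?rs = ?p" "length ?ws = q" using assms(2) by simp_all
  note span = cls_in_span[OF wf len, where ?'a = 'k]
  let ?x = "skew_whites q (bas (cls G ?rs ?ws)) :: _ \<Rightarrow>\<^sub>0 'k"
  note x = skew_whites_in_span[OF span]
  have "skew_whites (Suc q) (whiten (alt G R Q)) = skew_whites (Suc q) (skew_trees ?p (whiten ?x))"
    unfolding alt_def assms(2) whiten_skew_trees[OF x] ..
  also have "\<dots> = skew_trees ?p (skew_whites (Suc q) (whiten ?x))"
    by (rule skew_whites_skew_trees[OF whiten_in_span[OF x]])
  also have "?x = fscale (1 / fact q) (\<Sum>\<tau>\<in>?P. fscale (of_int (sign \<tau>)) (bas (cls G ?rs (permute_list \<tau> ?ws))))"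
    by (rule skew_whites_cls[OF wf len(2)])
  also have "skew_trees ?p (skew_whites (Suc q) (whiten \<dots>)) = fscale (1 / fact q) (\<Sum>\<tau>\<in>?P.
      fscale (of_int (sign \<tau>)) (skew_trees ?p (skew_whites (Suc q) (whiten (bas (cls G ?rs (permute_list \<tau> ?ws)))))))"
    by (simp only: module_hom.scale[OF linmap_skew_whites] module_hom.sum[OF linmap_skew_whites]
      module_hom.scale[OF linmap_skew_trees] module_hom.sum[OF linmap_skew_trees]
      module_hom.scale[OF linmap_whiten] module_hom.sum[OF linmap_whiten])
  also have "(\<Sum>\<tau>\<in>?P. fscale (of_int (sign \<tau>)) (skew_trees ?p (skew_whites (Suc q)
        (whiten (bas (cls G ?rs (permute_list \<tau> ?ws)))))))
    = (\<Sum>\<tau>\<in>?P. \<Sum>v\<in>verts G - Q. fscale ((- 1) ^ q * below_sign Q v) (alt G R (insert v Q) :: _ \<Rightarrow>\<^sub>0 'k))"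
  proof (rule sum.cong[OF refl])
    fix \<tau> assume "\<tau> \<in> ?P"
    then have \<tau>: "\<tau> permutes {..<length ?ws}" using len by simp
    let ?w = "permute_list \<tau> ?ws"
    have w: "wf_data G ?rs ?w" "set ?w = Q" "distinct ?w" "length ?w = q"
      using \<tau> wf fin assms(2) by (simp_all add: wf_permute)
    have o: "(orientation ?w :: 'k) = of_int (sign \<tau>)"
      using orientation_permute_list[OF _ \<tau>, where ?'k = 'k] by simp
    have s: "(of_int (sign \<tau>) * of_int (sign \<tau>) :: 'k) = 1"
      by (simp flip: of_int_mult)
    have "fscale (of_int (sign \<tau>)) (skew_trees ?p (skew_whites (Suc q) (bas (cls G ?rs (?w @ [v])))))
      = fscale ((- 1) ^ q * below_sign Q v) (alt G R (insert v Q) :: _ \<Rightarrow>\<^sub>0 'k)"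
      if v: "v \<in> verts G - Q" for v
    proof -
      have wv: "wf_data G ?rs (?w @ [v])" "distinct (?w @ [v])" "length (?w @ [v]) = Suc q"
        using w v by (simp_all add: wf_data_def)
      have "card (insert v Q) = Suc (card {s \<in> Q. s < v} + card {s \<in> Q. v < s})"
      proof -
        have "{s \<in> insert v Q. s < v} = {s \<in> Q. s < v}" "{s \<in> insert v Q. v < s} = {s \<in> Q. v < s}" by auto
        then show ?thesis using card_below_above[of "insert v Q" v] fin by simp
      qed
      then have q: "q = card {s \<in> Q. s < v} + card {s \<in> Q. v < s}" using fin v assms(2) by simp
      have "(orientation (?w @ [v]) :: 'k) = (- 1) ^ card {s \<in> Q. v < s} * of_int (sign \<tau>)"
        using w by (simp add: orientation_snoc o length_filter_distinct)
      also have "(- 1) ^ card {s \<in> Q. v < s} = ((- 1) ^ q * below_sign Q v :: 'k)"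
        by (subst q) (simp add: power_add below_sign_def)
      finally have "(orientation (?w @ [v]) :: 'k) = (- 1) ^ q * below_sign Q v * of_int (sign \<tau>)" .
      then have "of_int (sign \<tau>) * (orientation ?rs * orientation (?w @ [v]) :: 'k)
        = (- 1) ^ q * below_sign Q v * (of_int (sign \<tau>) * of_int (sign \<tau>))"
        by (simp add: mult_ac)
      then show ?thesis
        using skew_cls[OF wv(1) _ wv(2) len(1) wv(3), where ?'k = 'k] w fin by (simp add: s)
    qed
    then show "fscale (of_int (sign \<tau>)) (skew_trees ?p (skew_whites (Suc q) (whiten (bas (cls G ?rs ?w)))))
      = (\<Sum>v\<in>verts G - Q. fscale ((- 1) ^ q * below_sign Q v) (alt G R (insert v Q) :: _ \<Rightarrow>\<^sub>0 'k))"
      by (simp add: whiten_cls[OF w(1)] w(2) module_hom.sum[OF linmap_skew_whites]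
        module_hom.sum[OF linmap_skew_trees] fvec.scale_sum_right)
  qed
  \<comment> \<open>All permutations of the old white labels contribute equally, which cancels the
    normalisation of the inner antisymmetrisation.\<close>
  also have "\<dots> = fscale (fact q) (\<Sum>v\<in>verts G - Q.
      fscale ((- 1) ^ q * below_sign Q v) (alt G R (insert v Q) :: _ \<Rightarrow>\<^sub>0 'k))"
    by (subst fvec.sum_constant_scale) (simp add: card_permutations[of "{..<q}" q])
  finally show ?thesis by simp
qed

section \<open>Functional digraphs\<close>

definition sinks :: "'v digraph \<Rightarrow> 'v set"
  where "sinks G = {v \<in> verts G. v \<notin> Domain (edges G)}"

definition functional_digraph :: "'v digraph \<Rightarrow> bool"
  where "functional_digraph G \<longleftrightarrow> finite_digraph G \<and> verts G \<noteq> {} \<and> single_valued (edges G)"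

abbreviation symcl :: "'v digraph \<Rightarrow> ('v \<times> 'v) set"
  where "symcl G \<equiv> (edges G \<union> (edges G)\<inverse>)\<^sup>*"

lemma symcl_sym: "(v, w) \<in> symcl G \<Longrightarrow> (w, v) \<in> symcl G"
  by (meson sym_Un_converse sym_rtrancl symD)

lemma connected_digraph_iff:
  "connected_digraph G \<longleftrightarrow> verts G \<noteq> {} \<and> (\<forall>v\<in>verts G. \<forall>w\<in>verts G. (v, w) \<in> symcl G)"
  by (auto simp: connected_digraph_def linked_def)

text \<open>An undirected path to a sink can be straightened from its end: if a step runs against an
  edge from \<open>z\<close> to \<open>y\<close>, the directed path from \<open>z\<close> must begin
  with that very edge, so its remainder already starts at \<open>y\<close>.\<close>

lemma reaches_sink:
  assumes "single_valued (edges G)" "r \<in> sinks G" "(v, r) \<in> symcl G"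
  shows "(v, r) \<in> (edges G)\<^sup>*"
  using assms(3)
proof (induction rule: converse_rtrancl_induct)
  case (step y z)
  show ?case
  proof (cases "(y, z) \<in> edges G")
    case True
    then show ?thesis using step.IH by (rule converse_rtrancl_into_rtrancl)
  next
    case False
    then have zy: "(z, y) \<in> edges G" using step.hyps(1) by auto
    then have "z \<noteq> r" using assms(2) by (auto simp: sinks_def)
    then obtain z' where "(z, z') \<in> edges G" "(z', r) \<in> (edges G)\<^sup>*"
      using step.IH by (metis converse_rtranclE)
    then show ?thesis using zy assms(1) by (metis single_valuedD)
  qed
qed simp

text \<open>In a connected functional digraph a sink is reached from everywhere, hence is the root.
  In this form trees differ from cycles of trees only by the presence of a sink, so operations on
  them can be studied uniformly.\<close>

lemma rooted_tree_iff:
  "rooted_tree G \<longleftrightarrow> finite_digraph G \<and> connected_digraph G \<and> single_valued (edges G) \<and> sinks G \<noteq> {}"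
proof
  assume t: "rooted_tree G"
  then obtain r where r: "r \<in> verts G" "\<nexists>w. (r, w) \<in> edges G"
    "\<forall>v\<in>verts G - {r}. \<exists>!w. (v, w) \<in> edges G" "\<forall>v\<in>verts G. (v, r) \<in> (edges G)\<^sup>*"
    by (auto simp: rooted_tree_def)
  have fin: "finite_digraph G" using t by (simp add: rooted_tree_def)
  have "(v, r) \<in> symcl G" if "v \<in> verts G" for v
    using r(4) that by (meson in_mono inf_sup_ord(3) rtrancl_mono)
  then have "connected_digraph G"
    unfolding connected_digraph_iff using r(1) by (metis empty_iff rtrancl_trans symcl_sym)
  moreover have "single_valued (edges G)"
    using r(2,3) fin by (force simp: single_valued_def finite_digraph_def)
  moreover have "r \<in> sinks G" using r by (auto simp: sinks_def)
  ultimately show "finite_digraph G \<and> connected_digraph G \<and> single_valued (edges G) \<and> sinks G \<noteq> {}"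
    using fin by blast
next
  assume G: "finite_digraph G \<and> connected_digraph G \<and> single_valued (edges G) \<and> sinks G \<noteq> {}"
  then obtain r where r: "r \<in> sinks G" by blast
  then have r': "r \<in> verts G" "\<nexists>w. (r, w) \<in> edges G" by (auto simp: sinks_def)
  have reach: "(v, r) \<in> (edges G)\<^sup>*" if "v \<in> verts G" for v
    using G r r'(1) that by (intro reaches_sink) (auto simp: connected_digraph_iff)
  have "\<exists>!w. (v, w) \<in> edges G" if "v \<in> verts G - {r}" for v
    using reach[of v] that G by (metis Diff_iff converse_rtranclE insertI1 single_valuedD)
  then show "rooted_tree G" unfolding rooted_tree_def using G r' reach by blast
qed

lemma sinks_eq_root:
  assumes "rooted_tree G"
  shows "sinks G = {root G}"
proof -
  obtain r where r: "r \<in> verts G" "\<nexists>w. (r, w) \<in> edges G"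
    "\<forall>v\<in>verts G - {r}. \<exists>!w. (v, w) \<in> edges G"
    using assms by (auto simp: rooted_tree_def)
  have "r' = r" if "r' \<in> verts G \<and> (\<nexists>w. (r', w) \<in> edges G)" for r' using r that by blast
  then have "root G = r" unfolding root_def using r by (intro the_equality) blast+
  moreover have "sinks G = {r}" using r by (auto simp: sinks_def)
  ultimately show ?thesis by simp
qed

lemma cycle_of_trees_iff:
  "cycle_of_trees G \<longleftrightarrow> finite_digraph G \<and> connected_digraph G \<and> single_valued (edges G) \<and> sinks G = {}"
proof -
  have "(\<forall>v\<in>verts G. \<exists>!w. (v, w) \<in> edges G) \<longleftrightarrow> single_valued (edges G) \<and> sinks G = {}"
    if "finite_digraph G"
  proof -
    have "edges G \<subseteq> verts G \<times> verts G" using that by (simp add: finite_digraph_def)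
    then show ?thesis unfolding single_valued_def sinks_def by blast
  qed
  then show ?thesis unfolding cycle_of_trees_def by blast
qed

definition restrict_digraph :: "'v digraph \<Rightarrow> 'v set \<Rightarrow> 'v digraph"
  where "restrict_digraph G C = (C, edges G \<inter> C \<times> C)"

lemma restrict_digraph_simps [simp]:
  "verts (restrict_digraph G C) = C" "edges (restrict_digraph G C) = edges G \<inter> C \<times> C"
  by (simp_all add: restrict_digraph_def)

definition component_of :: "'v digraph \<Rightarrow> 'v \<Rightarrow> 'v set"
  where "component_of G v = {w \<in> verts G. (v, w) \<in> symcl G}"

lemma components_eq: "components G = (\<lambda>v. restrict_digraph G (component_of G v)) ` verts G"
proof -
  have "linked G `` {v} = component_of G v" if "v \<in> verts G" for v
    using that by (auto simp: linked_def component_of_def)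
  then show ?thesis
    by (auto simp: components_def quotient_def restrict_digraph_def image_iff)
qed

lemma component_of_step:
  assumes "finite_digraph G" "(x, y) \<in> edges G"
  shows "x \<in> component_of G v \<longleftrightarrow> y \<in> component_of G v"
proof -
  have "x \<in> verts G" "y \<in> verts G" using assms by (auto simp: finite_digraph_def)
  moreover have "(x, y) \<in> edges G \<union> (edges G)\<inverse>" "(y, x) \<in> edges G \<union> (edges G)\<inverse>"
    using assms(2) by auto
  ultimately show ?thesis
    unfolding component_of_def by (metis (no_types, lifting) mem_Collect_eq rtrancl.rtrancl_into_rtrancl)
qed

lemma
  assumes G: "finite_digraph G" and v: "v \<in> verts G"
  defines "C \<equiv> restrict_digraph G (component_of G v)"
  shows component_finite: "finite_digraph C" and component_connected: "connected_digraph C"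
    and component_sinks: "sinks C = sinks G \<inter> component_of G v"
proof -
  have sub: "component_of G v \<subseteq> verts G" by (auto simp: component_of_def)
  then show "finite_digraph C"
    using G finite_subset[OF sub] by (auto simp: C_def finite_digraph_def)
  have v_in: "v \<in> component_of G v" using v by (simp add: component_of_def)
  \<comment> \<open>Membership in the component is carried through the induction, so that every step
    is an edge of the restricted digraph.\<close>
  have "(v, w) \<in> symcl C \<and> w \<in> component_of G v" if "(v, w) \<in> symcl G" for w
    using that
  proof (induction rule: rtrancl_induct)
    case base
    show ?case using v_in by simp
  next
    case (step y z)
    then have "z \<in> component_of G v"
      using component_of_step[OF G, of y z v] component_of_step[OF G, of z y v] by auto
    then have "(y, z) \<in> edges C \<union> (edges C)\<inverse>" using step by (auto simp: C_def)
    then show ?case using step \<open>z \<in> component_of G v\<close> by (metis rtrancl.rtrancl_into_rtrancl)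
  qed
  then have reach: "(v, w) \<in> symcl C" if "w \<in> component_of G v" for w
    using that by (simp add: component_of_def)
  have "verts C = component_of G v" by (simp add: C_def)
  then show "connected_digraph C"
    unfolding connected_digraph_iff using v_in reach symcl_sym[of v _ C]
    by (metis empty_iff rtrancl_trans)
  have "w \<in> sinks C \<longleftrightarrow> w \<in> sinks G" if w: "w \<in> component_of G v" for w
    using w component_of_step[OF G, of w _ v] sub by (auto simp: C_def sinks_def)
  moreover have "sinks C \<subseteq> component_of G v" by (auto simp: C_def sinks_def)
  ultimately show "sinks C = sinks G \<inter> component_of G v" by blast
qed

text \<open>Each component is connected, and having a sink or not decides between the two shapes.
  Only single-valuedness remains, and it can be tested on components because no edge leaves
  one.\<close>

lemma components_tree_or_cycle_iff:
  assumes "finite_digraph G"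
  shows "(\<forall>C\<in>components G. rooted_tree C \<or> cycle_of_trees C) \<longleftrightarrow> single_valued (edges G)"
proof -
  have "(\<forall>C\<in>components G. rooted_tree C \<or> cycle_of_trees C)
      \<longleftrightarrow> (\<forall>v\<in>verts G. single_valued (edges G \<inter> component_of G v \<times> component_of G v))"
    unfolding components_eq ball_simps rooted_tree_iff cycle_of_trees_iff
    using component_finite[OF assms] component_connected[OF assms] by auto
  also have "\<dots> \<longleftrightarrow> single_valued (edges G)"
  proof
    assume *: "\<forall>v\<in>verts G. single_valued (edges G \<inter> component_of G v \<times> component_of G v)"
    show "single_valued (edges G)"
    proof (rule single_valuedI)
      fix x y z assume xy: "(x, y) \<in> edges G" and xz: "(x, z) \<in> edges G"
      then have x: "x \<in> verts G" using assms by (auto simp: finite_digraph_def)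
      then have "x \<in> component_of G x" by (simp add: component_of_def)
      then have "y \<in> component_of G x" "z \<in> component_of G x" "x \<in> component_of G x"
        using component_of_step[OF assms xy] component_of_step[OF assms xz] by auto
      then show "y = z" using * x xy xz by (auto dest!: bspec dest: single_valuedD)
    qed
  qed (auto simp: single_valued_def)
  finally show ?thesis .
qed

lemma roots_of_components:
  assumes "finite_digraph G" "single_valued (edges G)"
  shows "root ` {C \<in> components G. rooted_tree C} = sinks G"
proof -
  have sv: "single_valued (edges C)" if "C \<in> components G" for C
    using that assms(2) by (auto simp: components_eq single_valued_def)
  have "root C \<in> sinks G" if "C \<in> components G" "rooted_tree C" for C
  proof -
    have "root C \<in> sinks C" using sinks_eq_root[OF that(2)] by simp
    then show ?thesis using that(1) component_sinks[OF assms(1)] by (auto simp: components_eq)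
  qed
  moreover have "\<exists>C\<in>components G. rooted_tree C \<and> root C = r" if r: "r \<in> sinks G" for r
  proof -
    let ?C = "restrict_digraph G (component_of G r)"
    have v: "r \<in> verts G" using r by (simp add: sinks_def)
    have "r \<in> sinks ?C" using component_sinks[OF assms(1) v] r v by (simp add: component_of_def)
    moreover have C: "?C \<in> components G" using v by (auto simp: components_eq)
    ultimately have "rooted_tree ?C"
      unfolding rooted_tree_iff using component_finite[OF assms(1) v] component_connected[OF assms(1) v] sv
      by blast
    moreover from this have "sinks ?C = {root ?C}" by (rule sinks_eq_root)
    then have "root ?C = r" using \<open>r \<in> sinks ?C\<close> by simp
    ultimately show ?thesis using C by blast
  qed
  ultimately show ?thesis by blast
qed

lemma aromatic_forest_iff:
  "aromatic_forest F \<longleftrightarrow> functional_digraph (graph F) \<and> distinct (roots F) \<and>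
    set (roots F) = sinks (graph F) \<and> distinct (whites F) \<and> set (whites F) \<subseteq> verts (graph F)"
proof (cases "finite_digraph (graph F)")
  case fin: True
  show ?thesis
  proof (cases "single_valued (edges (graph F))")
    case True
    then show ?thesis
      unfolding aromatic_forest_def components_tree_or_cycle_iff[OF fin] roots_of_components[OF fin True]
        functional_digraph_def by blast
  next
    case False
    then show ?thesis
      unfolding aromatic_forest_def components_tree_or_cycle_iff[OF fin] functional_digraph_def by blast
  qed
next
  case False
  then show ?thesis by (simp add: aromatic_forest_def functional_digraph_def)
qed

section \<open>Loops and cycles of length one\<close>

definition has_loop :: "'v digraph \<Rightarrow> bool"
  where "has_loop G \<longleftrightarrow> (\<exists>v. (v, v) \<in> edges G)"

text \<open>Without vertices on a cycle the converse of the finite edge relation would be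
  well-founded, and a minimal vertex would have no outgoing edge.\<close>

lemma cycle_length_nonzero:
  assumes "cycle_of_trees C"
  shows "cycle_length C \<noteq> 0"
proof
  have fin: "finite (verts C)" "edges C \<subseteq> verts C \<times> verts C"
    using assms by (auto simp: cycle_of_trees_def finite_digraph_def)
  assume "cycle_length C = 0"
  then have "{v \<in> verts C. (v, v) \<in> (edges C)\<^sup>+} = {}" using fin by (simp add: cycle_length_def)
  moreover have "(edges C)\<^sup>+ \<subseteq> verts C \<times> verts C" using fin(2) by (rule trancl_subset_Sigma)
  ultimately have "acyclic (edges C)" by (auto simp: acyclic_def)
  moreover have "finite (edges C)" using fin by (meson finite_SigmaI finite_subset)
  ultimately have "wf ((edges C)\<inverse>)" by (simp add: finite_acyclic_wf_converse)
  moreover obtain v where "v \<in> verts C"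
    using assms by (auto simp: cycle_of_trees_def connected_digraph_def)
  ultimately obtain z where "z \<in> verts C" "\<And>y. (y, z) \<in> (edges C)\<inverse> \<Longrightarrow> y \<notin> verts C"
    by (meson wfE_min)
  moreover from this obtain y where "(z, y) \<in> edges C"
    using assms by (auto simp: cycle_of_trees_def)
  ultimately show False using fin(2) by auto
qed

text \<open>A vertex with a loop behaves like a sink: its only outgoing edge never leaves it, so the
  path is straightened as in \<open>reaches_sink\<close>.\<close>

lemma reaches_loop:
  assumes "single_valued (edges G)" "(r, r) \<in> edges G" "(v, r) \<in> symcl G"
  shows "(v, r) \<in> (edges G)\<^sup>*"
  using assms(3)
proof (induction rule: converse_rtrancl_induct)
  case (step y z)
  show ?case
  proof (cases "(y, z) \<in> edges G")
    case True
    then show ?thesis using step.IH by (rule converse_rtrancl_into_rtrancl)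
  next
    case False
    then have zy: "(z, y) \<in> edges G" using step.hyps(1) by auto
    show ?thesis
    proof (cases "z = r")
      case True
      then show ?thesis using zy assms by (metis rtrancl.rtrancl_refl single_valuedD)
    next
      case False
      then obtain z' where "(z, z') \<in> edges G" "(z', r) \<in> (edges G)\<^sup>*"
        using step.IH by (metis converse_rtranclE)
      then show ?thesis using zy assms(1) by (metis single_valuedD)
    qed
  qed
qed simp

text \<open>The successor of a vertex on the cycle lies on the cycle, so a single such vertex is its
  own successor. Conversely, every vertex reaches the loop by connectedness, and whatever a cycle
  vertex reaches leads back to it; since nothing else is reachable from the loop, the two
  coincide.\<close>

lemma cycle_length_eq_1_iff:
  assumes "cycle_of_trees C"
  shows "cycle_length C = 1 \<longleftrightarrow> has_loop C"
proof
  have sv: "single_valued (edges C)" and sub: "edges C \<subseteq> verts C \<times> verts C"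
    and con: "connected_digraph C"
    using assms by (auto simp: cycle_of_trees_iff finite_digraph_def)
  assume "cycle_length C = 1"
  then obtain v where v: "{v \<in> verts C. (v, v) \<in> (edges C)\<^sup>+} = {v}"
    unfolding cycle_length_def by (rule card_1_singletonE)
  then have "(v, v) \<in> (edges C)\<^sup>+" by auto
  then obtain w where w: "(v, w) \<in> edges C" "(w, v) \<in> (edges C)\<^sup>*" by (metis tranclD)
  then have "(w, w) \<in> (edges C)\<^sup>+" "w \<in> verts C" using sub by (auto intro: rtrancl_into_trancl1)
  then have "w \<in> {v}" using v by blast
  then show "has_loop C" using w by (auto simp: has_loop_def)
next
  have sv: "single_valued (edges C)" and sub: "edges C \<subseteq> verts C \<times> verts C"
    and con: "connected_digraph C"
    using assms by (auto simp: cycle_of_trees_iff finite_digraph_def)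
  assume "has_loop C"
  then obtain v where v: "(v, v) \<in> edges C" by (auto simp: has_loop_def)
  have only: "w = v" if "(v, w) \<in> (edges C)\<^sup>*" for w
    using that by (induction rule: rtrancl_induct) (use v sv in \<open>auto dest: single_valuedD\<close>)
  have "u = v" if u: "u \<in> verts C" "(u, u) \<in> (edges C)\<^sup>+" for u
  proof -
    have "(u, v) \<in> (edges C)\<^sup>*"
      using con u v sub by (intro reaches_loop[OF sv v]) (auto simp: connected_digraph_iff)
    moreover have "(w, u) \<in> (edges C)\<^sup>+" if "(u, w) \<in> (edges C)\<^sup>*" for w
      using that
    proof (induction rule: rtrancl_induct)
      case (step y z)
      obtain z' where "(y, z') \<in> edges C" "(z', u) \<in> (edges C)\<^sup>*" using step.IH by (metis tranclD)
      then have "(z, u) \<in> (edges C)\<^sup>*" using step.hyps(2) sv by (metis single_valuedD)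
      then show ?case using u(2) by (rule rtrancl_trancl_trancl)
    qed (rule u)
    ultimately show "u = v" using only by (blast dest: trancl_into_rtrancl)
  qed
  then have "{v \<in> verts C. (v, v) \<in> (edges C)\<^sup>+} = {v}" using v sub by auto
  then show "cycle_length C = 1" by (simp add: cycle_length_def)
qed

lemma cycle_length_ge_2_iff: "cycle_of_trees C \<Longrightarrow> cycle_length C \<ge> 2 \<longleftrightarrow> \<not> has_loop C"
  using cycle_length_nonzero[of C] cycle_length_eq_1_iff[of C] by linarith

text \<open>The component of a loop has no sink: the vertex with the loop would have to reach it,
  but is trapped. So it is a cycle of trees, to which \<open>cycle_length_eq_1_iff\<close>
  applies.\<close>

lemma loop_component_iff:
  assumes "functional_digraph G"
  shows "(\<exists>C\<in>components G. cycle_of_trees C \<and> cycle_length C = 1) \<longleftrightarrow> has_loop G"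
proof
  assume "\<exists>C\<in>components G. cycle_of_trees C \<and> cycle_length C = 1"
  then obtain C where "C \<in> components G" "has_loop C" using cycle_length_eq_1_iff by blast
  then show "has_loop G" by (auto simp: components_eq has_loop_def)
next
  assume "has_loop G"
  then obtain v where v: "(v, v) \<in> edges G" by (auto simp: has_loop_def)
  have fin: "finite_digraph G" and sv: "single_valued (edges G)"
    using assms by (auto simp: functional_digraph_def)
  have vG: "v \<in> verts G" using v fin by (auto simp: finite_digraph_def)
  let ?C = "restrict_digraph G (component_of G v)"
  have vC: "v \<in> component_of G v" using vG by (simp add: component_of_def)
  have C: "?C \<in> components G" using vG by (auto simp: components_eq)
  have l: "has_loop ?C" using v vC by (auto simp: has_loop_def)
  have "single_valued (edges ?C)" using sv by (auto simp: single_valued_def)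
  moreover have "r \<notin> sinks ?C" for r
  proof
    assume r: "r \<in> sinks ?C"
    then have "(v, r) \<in> symcl ?C"
      using component_connected[OF fin vG] vC by (auto simp: connected_digraph_iff sinks_def)
    then have "(v, r) \<in> (edges ?C)\<^sup>*" by (rule reaches_sink[OF \<open>single_valued (edges ?C)\<close> r])
    then have "r = v"
      by (induction rule: rtrancl_induct) (use v sv in \<open>auto dest: single_valuedD\<close>)
    then show False using r v vC by (auto simp: sinks_def)
  qed
  ultimately have "cycle_of_trees ?C"
    unfolding cycle_of_trees_iff using component_finite[OF fin vG] component_connected[OF fin vG] by auto
  then show "\<exists>C\<in>components G. cycle_of_trees C \<and> cycle_length C = 1"
    using C l cycle_length_eq_1_iff by blast
qed

lemma functional_add_edge:
  assumes "functional_digraph G" "r \<in> sinks G" "v \<in> verts G"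
  shows "functional_digraph (add_edge G r v)" "sinks (add_edge G r v) = sinks G - {r}"
  using assms
  by (auto simp: functional_digraph_def sinks_def finite_digraph_def single_valued_def)

lemma functional_map:
  assumes "functional_digraph G" "inj_on \<phi> (verts G)"
  shows "functional_digraph (map_digraph \<phi> G)" "sinks (map_digraph \<phi> G) = \<phi> ` sinks G"
    "has_loop (map_digraph \<phi> G) \<longleftrightarrow> has_loop G"
proof -
  have E: "edges G \<subseteq> verts G \<times> verts G" and sv: "single_valued (edges G)"
    using assms(1) by (auto simp: functional_digraph_def finite_digraph_def)
  have *: "(\<phi> x, y) \<in> map_prod \<phi> \<phi> ` edges G \<longleftrightarrow> (\<exists>z. y = \<phi> z \<and> (x, z) \<in> edges G)" if "x \<in> verts G" for x y
    using E that assms(2) by (force dest: inj_onD)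
  have "single_valued (map_prod \<phi> \<phi> ` edges G)"
  proof (rule single_valuedI)
    fix x y z assume "(x, y) \<in> map_prod \<phi> \<phi> ` edges G" "(x, z) \<in> map_prod \<phi> \<phi> ` edges G"
    moreover from this obtain u where "x = \<phi> u" "u \<in> verts G" using E by auto
    ultimately show "y = z" using * sv by (metis single_valuedD)
  qed
  then show "functional_digraph (map_digraph \<phi> G)"
    using assms(1) by (simp add: functional_digraph_def finite_digraph_map)
  define D where "D = Domain (map_prod \<phi> \<phi> ` edges G)"
  have "\<phi> v \<in> D \<longleftrightarrow> v \<in> Domain (edges G)" if "v \<in> verts G" for v
    unfolding D_def Domain_iff using *[OF that] by auto
  then show "sinks (map_digraph \<phi> G) = \<phi> ` sinks G"
    unfolding sinks_def verts_map_digraph edges_map_digraph D_def[symmetric] by blast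
  show "has_loop (map_digraph \<phi> G) \<longleftrightarrow> has_loop G"
    using E assms(2) by (force simp: has_loop_def dest: inj_onD)
qed

section \<open>The aromatic bicomplex\<close>

text \<open>The predicate allows a single treatment of all forests and of those spanning the loop
  subcomplex.\<close>

definition alt_forests :: "(nat digraph \<Rightarrow> bool) \<Rightarrow> nat \<Rightarrow> nat \<Rightarrow> (forest_class \<Rightarrow>\<^sub>0 'k::field_char_0) set"
  where "alt_forests P p q = {alt G (sinks G) Q | G Q.
    functional_digraph G \<and> P G \<and> Q \<subseteq> verts G \<and> card (sinks G) = p \<and> card Q = q}"

lemma alt_forestsI:
  "functional_digraph G \<Longrightarrow> P G \<Longrightarrow> Q \<subseteq> verts G \<Longrightarrow> card (sinks G) = p \<Longrightarrow> card Q = q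
    \<Longrightarrow> alt G (sinks G) Q \<in> alt_forests P p q"
  unfolding alt_forests_def by blast

definition aromatic_classes :: "(nat digraph \<Rightarrow> bool) \<Rightarrow> nat \<Rightarrow> nat \<Rightarrow> forest_class set"
  where "aromatic_classes P p q = {cls G rs ws | G rs ws. functional_digraph G \<and> P G \<and>
    distinct rs \<and> set rs = sinks G \<and> length rs = p \<and> distinct ws \<and> set ws \<subseteq> verts G \<and> length ws = q}"

lemma aromatic_classesI:
  "functional_digraph G \<Longrightarrow> P G \<Longrightarrow> distinct rs \<Longrightarrow> set rs = sinks G \<Longrightarrow> length rs = p
    \<Longrightarrow> distinct ws \<Longrightarrow> set ws \<subseteq> verts G \<Longrightarrow> length ws = q \<Longrightarrow> cls G rs ws \<in> aromatic_classes P p q"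
  unfolding aromatic_classes_def by blast

lemma forest_classes_eq: "forest_classes p q = aromatic_classes (\<lambda>_. True) p q"
proof (intro set_eqI iffI)
  fix c assume "c \<in> forest_classes p q"
  then obtain F where F: "c = forest_class F" "aromatic_forest F" "length (roots F) = p" "length (whites F) = q"
    by (auto simp: forest_classes_def)
  moreover have "forest_class F = cls (graph F) (roots F) (whites F)" by (cases F) simp
  ultimately show "c \<in> aromatic_classes (\<lambda>_. True) p q"
    using aromatic_classesI[of "graph F" "\<lambda>_. True" "roots F" p "whites F" q]
    by (simp add: aromatic_forest_iff)
qed (force simp: aromatic_classes_def forest_classes_def aromatic_forest_iff)

lemma loop_classes_eq: "loop_classes p q = aromatic_classes has_loop p q"
proof (intro set_eqI iffI)
  fix c assume "c \<in> loop_classes p q"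
  then obtain F where F: "c = forest_class F" "aromatic_forest F" "length (roots F) = p" "length (whites F) = q"
    "\<exists>C\<in>components (graph F). cycle_of_trees C \<and> cycle_length C = 1"
    unfolding loop_classes_def by blast
  moreover have "forest_class F = cls (graph F) (roots F) (whites F)" by (cases F) simp
  ultimately show "c \<in> aromatic_classes has_loop p q"
    using aromatic_classesI[of "graph F" has_loop "roots F" p "whites F" q] loop_component_iff[of "graph F"]
    by (simp add: aromatic_forest_iff)
next
  fix c assume "c \<in> aromatic_classes has_loop p q"
  then obtain G rs ws where c: "c = cls G rs ws" "functional_digraph G" "has_loop G" "distinct rs"
    "set rs = sinks G" "length rs = p" "distinct ws" "set ws \<subseteq> verts G" "length ws = q"
    by (auto simp: aromatic_classes_def)
  then show "c \<in> loop_classes p q"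
    using loop_component_iff[OF c(2)] unfolding loop_classes_def
    by (intro image_eqI[of _ _ "\<lparr>graph = G, roots = rs, whites = ws\<rparr>"]) (auto simp: aromatic_forest_iff)
qed

lemma functional_wf_data:
  "functional_digraph G \<Longrightarrow> set rs = sinks G \<Longrightarrow> set ws \<subseteq> verts G \<Longrightarrow> wf_data G rs ws"
  by (auto simp: functional_digraph_def wf_data_def sinks_def)

lemma functional_wf_alt: "functional_digraph G \<Longrightarrow> Q \<subseteq> verts G \<Longrightarrow> wf_alt G (sinks G) Q"
  by (auto simp: functional_digraph_def wf_alt_def sinks_def)

lemma functional_finite: "functional_digraph G \<Longrightarrow> finite (verts G) \<and> finite (sinks G)"
  by (auto simp: functional_digraph_def sinks_def finite_digraph_def)

text \<open>Every class is antisymmetrised to a multiple of some \<open>alt\<close> element, and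
  each of these arises from a class whose two lists are sorted.\<close>

lemma skew_forests_eq:
  "skew_forests p q (aromatic_classes P p q) = (fvec.span (alt_forests P p q) :: (_ \<Rightarrow>\<^sub>0 'k::field_char_0) set)"
proof -
  let ?f = "\<lambda>x :: forest_class \<Rightarrow>\<^sub>0 'k. skew_trees p (skew_whites q x)"
  have f: "linmap ?f" by (rule linmap_comp[OF linmap_skew_trees linmap_skew_whites])
  have "?f ` bas ` aromatic_classes P p q \<subseteq> fvec.span (alt_forests P p q)"
  proof -
    have "?f (bas (cls G rs ws)) \<in> fvec.span (alt_forests P p q)"
      if "functional_digraph G" "P G" "distinct rs" "set rs = sinks G" "length rs = p" "distinct ws"
        "set ws \<subseteq> verts G" "length ws = q" for G rs ws
    proof -
      have "(alt G (set rs) (set ws) :: _ \<Rightarrow>\<^sub>0 'k) \<in> alt_forests P p q"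
        using that distinct_card[of rs] distinct_card[of ws] by (simp add: alt_forestsI)
      then show ?thesis
        unfolding skew_cls[OF functional_wf_data[OF that(1,4,7)] that(3,6,5,8)]
        by (intro fvec.span_scale fvec.span_base)
    qed
    then show ?thesis by (auto simp: aromatic_classes_def)
  qed
  moreover have "alt_forests P p q \<subseteq> ?f ` bas ` aromatic_classes P p q"
  proof
    fix x :: "forest_class \<Rightarrow>\<^sub>0 'k" assume "x \<in> alt_forests P p q"
    then obtain G Q where x: "x = alt G (sinks G) Q" "functional_digraph G" "P G" "Q \<subseteq> verts G"
      "card (sinks G) = p" "card Q = q" by (auto simp: alt_forests_def)
    have fin: "finite (sinks G)" "finite Q"
      using functional_finite[OF x(2)] x(4) finite_subset by auto
    let ?c = "cls G (sorted_list_of_set (sinks G)) (sorted_list_of_set Q)"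
    have "?c \<in> aromatic_classes P p q" using x fin by (intro aromatic_classesI) simp_all
    moreover have "x = ?f (bas ?c)" using x by (simp add: alt_def)
    ultimately show "x \<in> ?f ` bas ` aromatic_classes P p q" by blast
  qed
  ultimately have "fvec.span (?f ` bas ` aromatic_classes P p q) = fvec.span (alt_forests P p q)"
    by (metis fvec.span_mono fvec.span_span subset_antisym)
  then show ?thesis
    unfolding skew_forests_def span_of_def by (simp add: module_hom.span_image[OF f])
qed

lemma Omega_eq: "Omega p q = fvec.span (alt_forests (\<lambda>_. True) p q)"
  by (simp add: Omega_def forest_classes_eq skew_forests_eq)

text \<open>The vertical differential leaves the digraph unchanged, so stability under new edges is
  what makes the forests satisfying \<open>P\<close> span a subcomplex.\<close>

definition edge_stable :: "('v digraph \<Rightarrow> bool) \<Rightarrow> bool"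
  where "edge_stable P \<longleftrightarrow> (\<forall>G r v. P G \<longrightarrow> P (add_edge G r v))"

lemma alt_add_edge_in:
  assumes "edge_stable P" "functional_digraph G" "P G" "Q \<subseteq> verts G" "card (sinks G) = Suc p" "card Q = q"
    "r \<in> sinks G" "v \<in> verts G"
  shows "alt (add_edge G r v) (sinks G - {r}) Q \<in> alt_forests P p q"
proof -
  have "card (sinks G - {r}) = p" using assms(5,7) functional_finite[OF assms(2)] by simp
  moreover have "P (add_edge G r v)" using assms(1,3) unfolding edge_stable_def by blast
  ultimately show ?thesis
    using assms(4,6) functional_add_edge[OF assms(2,7,8)] alt_forestsI[of "add_edge G r v" P Q p q]
    by simp
qed

lemma horizontal_alt_forests:
  assumes "edge_stable P" "x \<in> fvec.span (alt_forests P (Suc p) q)"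
  shows "horizontal x \<in> fvec.span (alt_forests P p q)"
proof (rule linmap_in_subspace[OF linmap_horizontal fvec.subspace_span _ assms(2)])
  fix y :: "forest_class \<Rightarrow>\<^sub>0 'a" assume "y \<in> alt_forests P (Suc p) q"
  then obtain G Q where y: "y = alt G (sinks G) Q" "functional_digraph G" "P G" "Q \<subseteq> verts G"
    "card (sinks G) = Suc p" "card Q = q" by (auto simp: alt_forests_def)
  show "horizontal y \<in> fvec.span (alt_forests P p q)"
    unfolding y(1) horizontal_alt[OF functional_wf_alt[OF y(2,4)] y(5)]
    by (intro fvec.span_scale fvec.span_sum fvec.span_base alt_add_edge_in assms(1) y(2-))
qed

lemma vertical_alt_forests:
  assumes "x \<in> fvec.span (alt_forests P p q)"
  shows "skew_whites (Suc q) (whiten x) \<in> fvec.span (alt_forests P p (Suc q))"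
proof (rule linmap_in_subspace[OF linmap_comp[OF linmap_skew_whites linmap_whiten] fvec.subspace_span _ assms])
  fix y :: "forest_class \<Rightarrow>\<^sub>0 'a" assume "y \<in> alt_forests P p q"
  then obtain G Q where y: "y = alt G (sinks G) Q" "functional_digraph G" "P G" "Q \<subseteq> verts G"
    "card (sinks G) = p" "card Q = q" by (auto simp: alt_forests_def)
  have "alt G (sinks G) (insert v Q) \<in> alt_forests P p (Suc q)" if "v \<in> verts G - Q" for v
  proof -
    have "finite Q" using functional_finite[OF y(2)] y(4) finite_subset by blast
    then show ?thesis using y that by (intro alt_forestsI) auto
  qed
  then show "skew_whites (Suc q) (whiten y) \<in> fvec.span (alt_forests P p (Suc q))"
    unfolding y(1) whiten_alt[OF functional_wf_alt[OF y(2,4)] y(6)]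
    by (intro fvec.span_sum fvec.span_scale fvec.span_base)
qed

section \<open>The bicomplex identities on antisymmetrised forests\<close>

lemma sum_antisymmetric_eq_0:
  fixes f :: "'a \<Rightarrow> 'a \<Rightarrow> ('b \<Rightarrow>\<^sub>0 'k::field_char_0)"
  assumes "finite S" "\<And>a b. a \<in> S \<Longrightarrow> b \<in> S \<Longrightarrow> a \<noteq> b \<Longrightarrow> f b a = - f a b"
  shows "(\<Sum>a\<in>S. \<Sum>b\<in>S - {a}. f a b) = 0"
proof -
  let ?g = "\<lambda>a b. if a \<noteq> b then f a b else 0"
  have "(\<Sum>a\<in>S. \<Sum>b\<in>S - {a}. f a b) = (\<Sum>a\<in>S. \<Sum>b\<in>S. ?g a b)"
    using assms(1) by (intro sum.cong refl sum.mono_neutral_cong_left) auto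
  also have "\<dots> = (\<Sum>b\<in>S. \<Sum>a\<in>S. ?g a b)" by (rule sum.swap)
  also have "\<dots> = (\<Sum>b\<in>S. \<Sum>a\<in>S. - ?g b a)"
  proof (intro sum.cong refl)
    show "?g a b = - ?g b a" if "a \<in> S" "b \<in> S" for a b
      using that assms(2)[of b a] by simp
  qed
  also have "\<dots> = - (\<Sum>a\<in>S. \<Sum>b\<in>S. ?g a b)" by (simp only: sum_negf)
  also have "(\<Sum>a\<in>S. \<Sum>b\<in>S. ?g a b) = (\<Sum>a\<in>S. \<Sum>b\<in>S - {a}. f a b)"
    using assms(1) by (intro sum.cong refl sum.mono_neutral_cong_right) auto
  finally have "(\<Sum>a\<in>S. \<Sum>b\<in>S - {a}. f a b) = - (\<Sum>a\<in>S. \<Sum>b\<in>S - {a}. f a b)" .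
  moreover have "x = 0" if "x = - x" for x :: "'b \<Rightarrow>\<^sub>0 'k"
  proof (rule poly_mapping_eqI)
    fix k
    have "Poly_Mapping.lookup x k = - Poly_Mapping.lookup x k"
      using arg_cong[OF that, of "\<lambda>x. Poly_Mapping.lookup x k"] by (simp only: lookup_uminus)
    then show "Poly_Mapping.lookup x k = Poly_Mapping.lookup 0 k"
      by (simp add: eq_neg_iff_add_eq_0 flip: mult_2)
  qed
  ultimately show ?thesis by blast
qed

text \<open>Contractions with two different generators anticommute: removing the smaller root lowers
  the count below the larger one by one, while the converse removal changes nothing.\<close>

lemma below_sign_remove:
  assumes "finite R" "r \<in> R" "s \<in> R" "r \<noteq> s"
  shows "(below_sign R s * below_sign (R - {s}) r :: 'k::field) = - (below_sign R r * below_sign (R - {r}) s)"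
proof -
  have *: "(below_sign R s * below_sign (R - {s}) r :: 'k) = - (below_sign R r * below_sign (R - {r}) s)"
    if "r \<in> R" "r < s" for r s
  proof -
    have "{u \<in> R - {s}. u < r} = {u \<in> R. u < r}" using that by auto
    moreover have "{u \<in> R. u < s} = insert r {u \<in> R - {r}. u < s}" using that by auto
    moreover have "r \<notin> {u \<in> R - {r}. u < s}" by simp
    ultimately show ?thesis using assms(1) by (simp add: below_sign_def)
  qed
  show ?thesis using assms *[of r s] *[of s r] by (cases "r < s") auto
qed

text \<open>The same for exterior multiplication: inserting the smaller vertex first raises the
  count below the larger one.\<close>

lemma below_sign_insert:
  assumes "finite Q" "v \<notin> Q" "w \<notin> Q" "v \<noteq> w"
  shows "(below_sign Q w * below_sign (insert w Q) v :: 'k::field) = - (below_sign Q v * below_sign (insert v Q) w)"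
proof -
  have *: "(below_sign Q w * below_sign (insert w Q) v :: 'k) = - (below_sign Q v * below_sign (insert v Q) w)"
    if "v \<notin> Q" "v < w" for v w
  proof -
    have "{u \<in> insert w Q. u < v} = {u \<in> Q. u < v}" using that by auto
    moreover have "{u \<in> insert v Q. u < w} = insert v {u \<in> Q. u < w}" using that by auto
    ultimately show ?thesis using assms(1) that by (simp add: below_sign_def)
  qed
  show ?thesis using assms *[of v w] *[of w v] by (cases "v < w") auto
qed

lemma add_edge_commute: "add_edge (add_edge G r v) s w = add_edge (add_edge G s w) r v"
  by (simp add: add_edge_def insert_commute)

text \<open>Two new edges with different sources can be added in either order with the same
  resulting digraph, while the signs of the two orders are opposite. The targets range over all
  vertices both times, so the terms match.\<close>

lemma horizontal_horizontal:
  assumes "x \<in> (fvec.span (alt_forests P (Suc (Suc p)) q) :: (_ \<Rightarrow>\<^sub>0 'k::field_char_0) set)"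
  shows "horizontal (horizontal x) = 0"
proof (rule linmap_eq_on_span[OF linmap_comp[OF linmap_horizontal linmap_horizontal] _ _ assms, where g = "\<lambda>_. 0"])
  show "linmap (\<lambda>_ :: forest_class \<Rightarrow>\<^sub>0 'k. 0 :: forest_class \<Rightarrow>\<^sub>0 'k)" by (rule linmapI) auto
  fix y :: "forest_class \<Rightarrow>\<^sub>0 'k" assume "y \<in> alt_forests P (Suc (Suc p)) q"
  then obtain G Q where y: "y = alt G (sinks G) Q" "functional_digraph G" "Q \<subseteq> verts G"
    "card (sinks G) = Suc (Suc p)" by (auto simp: alt_forests_def)
  let ?R = "sinks G" and ?V = "verts G"
  let ?c = "\<lambda>n. (- 1) ^ n / of_nat (Suc n) :: 'k"
  have fin: "finite ?R" using functional_finite[OF y(2)] by simp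
  define X where "X r s = (\<Sum>v\<in>?V. \<Sum>w\<in>?V. fscale (?c p) (fscale (below_sign ?R r * below_sign (?R - {r}) s)
    (alt (add_edge (add_edge G r v) s w) (?R - {r} - {s}) Q :: _ \<Rightarrow>\<^sub>0 'k)))" for r s
  have "horizontal (horizontal y) = fscale (?c (Suc p)) (\<Sum>r\<in>?R. \<Sum>v\<in>?V. fscale (below_sign ?R r)
      (horizontal (alt (add_edge G r v) (?R - {r}) Q)))"
    unfolding y(1) horizontal_alt[OF functional_wf_alt[OF y(2,3)] y(4)]
    by (simp only: module_hom.scale[OF linmap_horizontal] module_hom.sum[OF linmap_horizontal])
  also have "(\<Sum>r\<in>?R. \<Sum>v\<in>?V. fscale (below_sign ?R r) (horizontal (alt (add_edge G r v) (?R - {r}) Q)))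
    = (\<Sum>r\<in>?R. \<Sum>v\<in>?V. \<Sum>s\<in>?R - {r}. \<Sum>w\<in>?V. fscale (?c p) (fscale (below_sign ?R r * below_sign (?R - {r}) s)
    (alt (add_edge (add_edge G r v) s w) (?R - {r} - {s}) Q :: _ \<Rightarrow>\<^sub>0 'k)))"
  proof (intro sum.cong refl)
    fix r v assume r: "r \<in> ?R" "v \<in> ?V"
    note f = functional_add_edge[OF y(2) r]
    have "wf_alt (add_edge G r v) (?R - {r}) Q"
      using functional_wf_alt[OF f(1)] y(3) by (simp add: f(2))
    moreover have "card (?R - {r}) = Suc p" using y(4) r fin by simp
    ultimately show "fscale (below_sign ?R r) (horizontal (alt (add_edge G r v) (?R - {r}) Q))
      = (\<Sum>s\<in>?R - {r}. \<Sum>w\<in>?V. fscale (?c p) (fscale (below_sign ?R r * below_sign (?R - {r}) s)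
    (alt (add_edge (add_edge G r v) s w) (?R - {r} - {s}) Q :: _ \<Rightarrow>\<^sub>0 'k)))"
      by (simp add: horizontal_alt fvec.scale_sum_right mult_ac del: of_nat_Suc)
  qed
  also have "\<dots> = (\<Sum>r\<in>?R. \<Sum>s\<in>?R - {r}. X r s)"
    unfolding X_def by (intro sum.cong refl sum.swap)
  also have "\<dots> = 0"
  proof (rule sum_antisymmetric_eq_0[OF fin])
    fix r s assume rs: "r \<in> ?R" "s \<in> ?R" "r \<noteq> s"
    have "X s r = (\<Sum>w\<in>?V. \<Sum>v\<in>?V. - fscale (?c p) (fscale (below_sign ?R r * below_sign (?R - {r}) s)
    (alt (add_edge (add_edge G r v) s w) (?R - {r} - {s}) Q)))"
    proof -
      have "?R - {s} - {r} = ?R - {r} - {s}" by auto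
      then show ?thesis
        unfolding X_def below_sign_remove[OF fin rs] by (simp add: add_edge_commute[of G s _ r] del: of_nat_Suc)
    qed
    then show "X s r = - X r s" unfolding X_def sum_negf by (subst sum.swap) simp
  qed
  finally show "horizontal (horizontal y) = 0" by simp
qed

text \<open>Whitening two vertices in either order gives the same white set with opposite
  signs.\<close>

lemma vertical_vertical:
  assumes "x \<in> (fvec.span (alt_forests P p q) :: (_ \<Rightarrow>\<^sub>0 'k::field_char_0) set)"
  shows "skew_whites (Suc (Suc q)) (whiten (skew_whites (Suc q) (whiten x))) = 0"
proof (rule linmap_eq_on_span[OF linmap_comp[OF linmap_comp[OF linmap_skew_whites linmap_whiten]
    linmap_comp[OF linmap_skew_whites linmap_whiten]] _ _ assms, where g = "\<lambda>_. 0"])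
  show "linmap (\<lambda>_ :: forest_class \<Rightarrow>\<^sub>0 'k. 0 :: forest_class \<Rightarrow>\<^sub>0 'k)" by (rule linmapI) auto
  fix y :: "forest_class \<Rightarrow>\<^sub>0 'k" assume "y \<in> alt_forests P p q"
  then obtain G Q where y: "y = alt G (sinks G) Q" "functional_digraph G" "Q \<subseteq> verts G"
    "card Q = q" by (auto simp: alt_forests_def)
  let ?R = "sinks G" and ?V = "verts G"
  have fin: "finite ?V" using functional_finite[OF y(2)] by simp
  then have finQ: "finite Q" using y(3) finite_subset by blast
  define X where "X v w = fscale ((- 1) ^ q * (- 1) ^ Suc q) (fscale (below_sign Q v * below_sign (insert v Q) w)
    (alt G ?R (insert w (insert v Q)) :: _ \<Rightarrow>\<^sub>0 'k))" for v w
  have "skew_whites (Suc (Suc q)) (whiten (skew_whites (Suc q) (whiten y)))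
    = (\<Sum>v\<in>?V - Q. fscale ((- 1) ^ q * below_sign Q v)
        (skew_whites (Suc (Suc q)) (whiten (alt G ?R (insert v Q)))))"
    unfolding y(1) whiten_alt[OF functional_wf_alt[OF y(2,3)] y(4)]
    by (simp only: module_hom.scale[OF linmap_skew_whites] module_hom.sum[OF linmap_skew_whites]
      module_hom.scale[OF linmap_whiten] module_hom.sum[OF linmap_whiten])
  also have "\<dots> = (\<Sum>v\<in>?V - Q. \<Sum>w\<in>?V - Q - {v}. X v w)"
  proof (intro sum.cong refl)
    fix v assume v: "v \<in> ?V - Q"
    have "insert v Q \<subseteq> ?V" using v y(3) by auto
    note wf = functional_wf_alt[OF y(2) this]
    have c: "card (insert v Q) = Suc q" using v finQ y(4) by simp
    have "?V - insert v Q = ?V - Q - {v}" by auto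
    then show "fscale ((- 1) ^ q * below_sign Q v) (skew_whites (Suc (Suc q)) (whiten (alt G ?R (insert v Q))))
      = (\<Sum>w\<in>?V - Q - {v}. X v w)"
      unfolding whiten_alt[OF wf c] X_def by (simp add: fvec.scale_sum_right mult_ac)
  qed
  also have "\<dots> = 0"
  proof (rule sum_antisymmetric_eq_0)
    show "finite (?V - Q)" using fin by simp
    fix v w assume "v \<in> ?V - Q" "w \<in> ?V - Q" "v \<noteq> w"
    then show "X w v = - X v w"
      unfolding X_def using below_sign_insert[OF finQ, of v w, where ?'k = 'k] by (simp add: insert_commute)
  qed
  finally show "skew_whites (Suc (Suc q)) (whiten (skew_whites (Suc q) (whiten y))) = 0" .
qed

text \<open>One differential changes edges and roots, the other only the white set, and neither sign
  depends on the data of the other. They therefore commute without any sign.\<close>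

lemma horizontal_vertical:
  assumes "x \<in> (fvec.span (alt_forests P (Suc p) q) :: (_ \<Rightarrow>\<^sub>0 'k::field_char_0) set)"
  shows "horizontal (skew_whites (Suc q) (whiten x)) = skew_whites (Suc q) (whiten (horizontal x))"
proof (rule linmap_eq_on_span[OF linmap_comp[OF linmap_horizontal linmap_comp[OF linmap_skew_whites linmap_whiten]]
    linmap_comp[OF linmap_comp[OF linmap_skew_whites linmap_whiten] linmap_horizontal] _ assms])
  fix y :: "forest_class \<Rightarrow>\<^sub>0 'k" assume "y \<in> alt_forests P (Suc p) q"
  then obtain G Q where y: "y = alt G (sinks G) Q" "functional_digraph G" "Q \<subseteq> verts G"
    "card (sinks G) = Suc p" "card Q = q" by (auto simp: alt_forests_def)
  let ?R = "sinks G" and ?V = "verts G"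
  let ?c = "(- 1) ^ p / of_nat (Suc p) :: 'k"
  define X where "X u r v = fscale ((- 1) ^ q * below_sign Q u) (fscale ?c (fscale (below_sign ?R r)
    (alt (add_edge G r v) (?R - {r}) (insert u Q) :: _ \<Rightarrow>\<^sub>0 'k)))" for u r v
  have "horizontal (skew_whites (Suc q) (whiten y))
    = (\<Sum>u\<in>?V - Q. fscale ((- 1) ^ q * below_sign Q u) (horizontal (alt G ?R (insert u Q))))"
    unfolding y(1) whiten_alt[OF functional_wf_alt[OF y(2,3)] y(5)]
    by (simp only: module_hom.scale[OF linmap_horizontal] module_hom.sum[OF linmap_horizontal])
  also have "\<dots> = (\<Sum>u\<in>?V - Q. \<Sum>r\<in>?R. \<Sum>v\<in>?V. X u r v)"
  proof (intro sum.cong refl)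
    fix u assume u: "u \<in> ?V - Q"
    have "insert u Q \<subseteq> ?V" using u y(3) by auto
    note wf = functional_wf_alt[OF y(2) this]
    show "fscale ((- 1) ^ q * below_sign Q u) (horizontal (alt G ?R (insert u Q))) = (\<Sum>r\<in>?R. \<Sum>v\<in>?V. X u r v)"
      unfolding horizontal_alt[OF wf y(4)] X_def by (simp only: fvec.scale_sum_right)
  qed
  also have "\<dots> = (\<Sum>r\<in>?R. \<Sum>u\<in>?V - Q. \<Sum>v\<in>?V. X u r v)" by (rule sum.swap)
  also have "\<dots> = (\<Sum>r\<in>?R. \<Sum>v\<in>?V. \<Sum>u\<in>?V - Q. X u r v)"
    by (intro sum.cong refl sum.swap)
  also have "\<dots> = (\<Sum>r\<in>?R. \<Sum>v\<in>?V. fscale ?c (fscale (below_sign ?R r)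
      (skew_whites (Suc q) (whiten (alt (add_edge G r v) (?R - {r}) Q)))))"
  proof (intro sum.cong refl)
    fix r v assume r: "r \<in> ?R" "v \<in> ?V"
    note f = functional_add_edge[OF y(2) r]
    have wf: "wf_alt (add_edge G r v) (?R - {r}) Q"
      using functional_wf_alt[OF f(1)] y(3) by (simp add: f(2))
    show "(\<Sum>u\<in>?V - Q. X u r v) = fscale ?c (fscale (below_sign ?R r)
      (skew_whites (Suc q) (whiten (alt (add_edge G r v) (?R - {r}) Q))))"
      unfolding whiten_alt[OF wf y(5)] X_def by (simp add: fvec.scale_sum_right mult_ac del: of_nat_Suc)
  qed
  also have "\<dots> = skew_whites (Suc q) (whiten (horizontal y))"
    unfolding y(1) horizontal_alt[OF functional_wf_alt[OF y(2,3)] y(4)]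
    by (simp only: module_hom.scale[OF linmap_skew_whites] module_hom.sum[OF linmap_skew_whites]
      module_hom.scale[OF linmap_whiten] module_hom.sum[OF linmap_whiten] fvec.scale_sum_right)
  finally show "horizontal (skew_whites (Suc q) (whiten y)) = skew_whites (Suc q) (whiten (horizontal y))" .
qed

lemma edge_stable_True: "edge_stable (\<lambda>_. True)"
  by (simp add: edge_stable_def)

lemma is_bicomplex_aromatic: "is_bicomplex (aromatic_bicomplex :: (_, 'k::field_char_0) bicomplex)"
proof -
  let ?dV = "\<lambda>q (x :: forest_class \<Rightarrow>\<^sub>0 'k). skew_whites (Suc q) (whiten x)"
  note dV = linmap_comp[OF linmap_skew_whites linmap_whiten]
  show ?thesis
    unfolding aromatic_bicomplex_def is_bicomplex_def free_bicomplex_def bicomplex.simps Omega_eq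
  proof (intro allI conjI)
    fix p q
    let ?S = "fvec.span (alt_forests (\<lambda>_. True) p q) :: (_ \<Rightarrow>\<^sub>0 'k) set"
    have neg: "\<exists>y\<in>?S. y + x = 0" if "x \<in> ?S" for x
      using fvec.span_neg[OF that] by (intro bexI[of _ "- x"]) auto
    then show "vector_space_on ?S 0 (+) fscale"
      unfolding vector_space_on_def
      by (auto simp: fvec.span_add fvec.span_scale fvec.span_zero add_ac fvec.scale_right_distrib
        fvec.scale_left_distrib)
  qed (auto simp: linear_map_on_def horizontal_alt_forests[OF edge_stable_True] vertical_alt_forests
      module_hom.add[OF linmap_horizontal] module_hom.scale[OF linmap_horizontal]
      module_hom.add[OF dV] module_hom.scale[OF dV]
      intro: horizontal_horizontal vertical_vertical horizontal_vertical)
qed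

section \<open>Configurations of trees and cycles\<close>

definition tree_lie :: "bool \<Rightarrow> ('v, 'v tree_or_cycle, 'k::field) dg_lie"
  where "tree_lie red = (if red then lie_L_reduced else lie_L)"

lemma tree_lie_simps [simp]:
  "lie_supp (tree_lie red) b = verts (toc_graph b)" "lie_deg (tree_lie red) = toc_deg"
  "lie_map (tree_lie red) = toc_map" "lie_bracket (tree_lie red) = toc_bracket"
  "lie_diff (tree_lie red) = (if red then div0_diff else div_diff)"
  by (simp_all add: tree_lie_def lie_L_def lie_L_reduced_def)

lemma tree_lie_basis:
  "Tree T \<in> lie_basis (tree_lie red) \<longleftrightarrow> rooted_tree T"
  "Cyc C \<in> lie_basis (tree_lie red) \<longleftrightarrow> cycle_of_trees C \<and> (red \<longrightarrow> \<not> has_loop C)"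
  by (auto simp: tree_lie_def lie_L_def lie_L_reduced_def cycle_length_ge_2_iff)

primrec toc_roots :: "'v tree_or_cycle \<Rightarrow> 'v list"
  where "toc_roots (Tree T) = [root T]" | "toc_roots (Cyc C) = []"

definition list_roots :: "'v tree_or_cycle list \<Rightarrow> 'v list"
  where "list_roots xs = concat (map toc_roots xs)"

lemma list_roots_simps [simp]:
  "list_roots [] = []" "list_roots (x # xs) = toc_roots x @ list_roots xs"
  "list_roots (xs @ ys) = list_roots xs @ list_roots ys"
  by (simp_all add: list_roots_def)

lemma set_list_roots: "set (list_roots xs) = (\<Union>x\<in>set xs. set (toc_roots x))"
  by (simp add: list_roots_def)

definition graph_union :: "'v tree_or_cycle list \<Rightarrow> 'v digraph"
  where "graph_union xs = ((\<Union>x\<in>set xs. verts (toc_graph x)), (\<Union>x\<in>set xs. edges (toc_graph x)))"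

lemma graph_union_simps [simp]:
  "verts (graph_union xs) = (\<Union>x\<in>set xs. verts (toc_graph x))"
  "edges (graph_union xs) = (\<Union>x\<in>set xs. edges (toc_graph x))"
  by (simp_all add: graph_union_def)

text \<open>The suspended degree counts roots: odd elements are the trees and even ones the cycles.
  This is why Koszul signs are signs of permutations of roots.\<close>

lemma susp_deg_tree_lie: "susp_deg (tree_lie red) b = int (length (toc_roots b))"
  by (cases b) (simp_all add: susp_deg_def)

lemma total_deg_tree_lie: "total_deg (susp_deg (tree_lie red)) xs = int (length (list_roots xs))"
  by (induction xs) (simp_all add: susp_deg_tree_lie)

lemma toc_roots_cases: "toc_roots b = [] \<or> (\<exists>r. toc_roots b = [r])"
  by (cases b) simp_all

lemma basis_props:
  assumes "b \<in> lie_basis (tree_lie red)"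
  shows "finite_digraph (toc_graph b)" "connected_digraph (toc_graph b)"
    "single_valued (edges (toc_graph b))" "sinks (toc_graph b) = set (toc_roots b)"
    "verts (toc_graph b) \<noteq> {}" "set (toc_roots b) \<subseteq> verts (toc_graph b)"
proof -
  show fin: "finite_digraph (toc_graph b)" and con: "connected_digraph (toc_graph b)"
    and "single_valued (edges (toc_graph b))"
    using assms by (cases b; simp add: tree_lie_basis rooted_tree_iff cycle_of_trees_iff)+
  show s: "sinks (toc_graph b) = set (toc_roots b)"
    using assms by (cases b) (simp_all add: tree_lie_basis sinks_eq_root cycle_of_trees_iff)
  show "verts (toc_graph b) \<noteq> {}" using con by (simp add: connected_digraph_def)
  show "set (toc_roots b) \<subseteq> verts (toc_graph b)" unfolding s[symmetric] by (auto simp: sinks_def)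
qed

text \<open>A vertex with a loop could never reach the root, because its only outgoing edge returns
  to it.\<close>

lemma rooted_tree_no_loop:
  assumes "rooted_tree T"
  shows "\<not> has_loop T"
proof
  assume "has_loop T"
  then obtain v where v: "(v, v) \<in> edges T" by (auto simp: has_loop_def)
  obtain r where r: "r \<in> sinks T" using assms by (auto simp: rooted_tree_iff)
  have "v \<in> verts T" using v assms by (auto simp: rooted_tree_def finite_digraph_def)
  moreover have "r \<in> verts T" using r by (simp add: sinks_def)
  ultimately have "(v, r) \<in> symcl T" using assms by (auto simp: rooted_tree_iff connected_digraph_iff)
  then have "(v, r) \<in> (edges T)\<^sup>*" using assms r by (intro reaches_sink) (auto simp: rooted_tree_iff)
  then have "r = v"
    by (induction rule: rtrancl_induct) (use v assms in \<open>auto simp: rooted_tree_iff dest: single_valuedD\<close>)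
  then show False using r v by (auto simp: sinks_def)
qed

lemma basis_has_loop:
  assumes "b \<in> lie_basis (tree_lie red)" "red"
  shows "\<not> has_loop (toc_graph b)"
  using assms rooted_tree_no_loop by (cases b) (auto simp: tree_lie_basis)

lemma sorted_wrt_symD:
  assumes "sorted_wrt P xs" "\<And>x y. P x y \<Longrightarrow> P y x" "x \<in> set xs" "y \<in> set xs" "x \<noteq> y"
  shows "P x y"
proof -
  obtain i j where ij: "i < length xs" "xs ! i = x" "j < length xs" "xs ! j = y"
    using assms(3,4) by (auto simp: in_set_conv_nth)
  then have "i < j \<or> j < i" using assms(5) by (metis linorder_neqE_nat)
  then show ?thesis using assms(1,2) ij sorted_wrt_nth_less by blast
qed

text \<open>The set \<open>lie_basis\<close> does not depend on the field; the field \<open>rat\<close> only fixes a type.\<close>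

definition configuration :: "bool \<Rightarrow> nat tree_or_cycle list \<Rightarrow> bool"
  where "configuration red xs \<longleftrightarrow> xs \<noteq> [] \<and> set xs \<subseteq> lie_basis (tree_lie red :: (nat, _, rat) dg_lie) \<and>
    sorted_wrt (\<lambda>x y. verts (toc_graph x) \<inter> verts (toc_graph y) = {}) xs"

lemma lie_basis_any_field:
  "lie_basis (tree_lie red :: ('v, _, 'k::field) dg_lie) = lie_basis (tree_lie red :: ('v, _, rat) dg_lie)"
  by (simp add: tree_lie_def lie_L_def lie_L_reduced_def)

lemma tensor_basis_iff:
  "xs \<in> tensor_basis (tree_lie red :: (nat, _, 'k::field) dg_lie) I (int p)
    \<longleftrightarrow> configuration red xs \<and> verts (graph_union xs) = I \<and> length (list_roots xs) = p"
  by (auto simp: tensor_basis_def configuration_def total_deg_tree_lie lie_basis_any_field[where 'k = 'k])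

lemma configurationD:
  assumes "configuration red xs"
  shows "\<And>x. x \<in> set xs \<Longrightarrow> x \<in> lie_basis (tree_lie red :: (nat, _, rat) dg_lie)"
    and "\<And>x y. x \<in> set xs \<Longrightarrow> y \<in> set xs \<Longrightarrow> x \<noteq> y \<Longrightarrow> verts (toc_graph x) \<inter> verts (toc_graph y) = {}"
    and "distinct xs" and "distinct (list_roots xs)"
proof -
  show b: "x \<in> lie_basis (tree_lie red :: (nat, _, rat) dg_lie)" if "x \<in> set xs" for x
    using assms that by (auto simp: configuration_def)
  show "verts (toc_graph x) \<inter> verts (toc_graph y) = {}" if "x \<in> set xs" "y \<in> set xs" "x \<noteq> y" for x y
    by (rule sorted_wrt_symD[where P = "\<lambda>x y. verts (toc_graph x) \<inter> verts (toc_graph y) = {}" and xs = xs])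
       (use that assms in \<open>auto simp: configuration_def\<close>)
  have s: "sorted_wrt (\<lambda>x y. verts (toc_graph x) \<inter> verts (toc_graph y) = {}) xs"
    using assms by (simp add: configuration_def)
  show "distinct xs" using s b
  proof (induction xs)
    case (Cons x xs)
    have "verts (toc_graph x) \<noteq> {}" by (rule basis_props(5)[OF Cons.prems(2)]) simp
    then show ?case using Cons by auto
  qed simp
  show "distinct (list_roots xs)" using s b
  proof (induction xs)
    case (Cons x xs)
    have "set (toc_roots x) \<inter> set (list_roots xs) = {}"
    proof -
      have "set (toc_roots y) \<subseteq> verts (toc_graph y)" if "y \<in> set (x # xs)" for y
        by (rule basis_props(6)[OF Cons.prems(2)[OF that]])
      moreover have "verts (toc_graph x) \<inter> verts (toc_graph y) = {}" if "y \<in> set xs" for y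
        using Cons.prems(1) that by simp
      ultimately have "set (toc_roots x) \<inter> set (toc_roots y) = {}" if "y \<in> set xs" for y
        using that by (meson disjoint_iff list.set_intros subsetD)
      then show ?thesis unfolding set_list_roots by blast
    qed
    moreover have "distinct (toc_roots x)" using toc_roots_cases[of x] by auto
    ultimately show ?case using Cons by simp
  qed simp
qed

lemma configuration_graph:
  assumes "configuration red xs"
  shows "functional_digraph (graph_union xs)" "sinks (graph_union xs) = set (list_roots xs)"
    "red \<Longrightarrow> \<not> has_loop (graph_union xs)"
proof -
  note b = configurationD(1)[OF assms]
  have E: "edges (toc_graph x) \<subseteq> verts (toc_graph x) \<times> verts (toc_graph x)" if "x \<in> set xs" for x
    using basis_props(1)[OF b[OF that]] by (simp add: finite_digraph_def)
  have eq: "x = y" if "x \<in> set xs" "y \<in> set xs" "v \<in> verts (toc_graph x)" "v \<in> verts (toc_graph y)" for x y v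
    using configurationD(2)[OF assms that(1,2)] that(3,4) by blast
  have "single_valued (edges (graph_union xs))"
  proof (rule single_valuedI)
    fix u v w assume "(u, v) \<in> edges (graph_union xs)" "(u, w) \<in> edges (graph_union xs)"
    then obtain x y where x: "x \<in> set xs" "(u, v) \<in> edges (toc_graph x)"
      and y: "y \<in> set xs" "(u, w) \<in> edges (toc_graph y)" by auto
    then have "x = y" using E eq by blast
    then show "v = w" using x y basis_props(3)[OF b[OF x(1)]] by (auto dest: single_valuedD)
  qed
  moreover have "finite_digraph (graph_union xs)"
    using basis_props(1)[OF b] E unfolding finite_digraph_def graph_union_simps by blast
  moreover have "verts (graph_union xs) \<noteq> {}"
    using assms basis_props(5)[OF b] by (cases xs) (auto simp: configuration_def)
  ultimately show "functional_digraph (graph_union xs)" by (simp add: functional_digraph_def)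
  have "sinks (graph_union xs) = (\<Union>x\<in>set xs. sinks (toc_graph x))"
  proof (intro set_eqI iffI)
    fix v assume "v \<in> sinks (graph_union xs)"
    then show "v \<in> (\<Union>x\<in>set xs. sinks (toc_graph x))" by (auto simp: sinks_def)
  next
    fix v assume "v \<in> (\<Union>x\<in>set xs. sinks (toc_graph x))"
    then obtain x where x: "x \<in> set xs" "v \<in> verts (toc_graph x)" "v \<notin> Domain (edges (toc_graph x))"
      by (auto simp: sinks_def)
    have False if "(v, w) \<in> edges (toc_graph y)" "y \<in> set xs" for w y
    proof -
      have "v \<in> verts (toc_graph y)" using E[OF that(2)] that(1) by blast
      then have "x = y" using eq x(1,2) that(2) by blast
      then show False using x(3) that(1) by blast
    qed
    then show "v \<in> sinks (graph_union xs)" using x unfolding sinks_def by auto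
  qed
  then show "sinks (graph_union xs) = set (list_roots xs)"
    using basis_props(4)[OF b] by (simp add: set_list_roots)
  show "\<not> has_loop (graph_union xs)" if red
    using basis_has_loop[OF b that] by (auto simp: has_loop_def)
qed

text \<open>An unshuffle is determined by the set of entries in its first part, as the entries are
  distinct. Its Koszul sign counts the odd entries that pass each other, that is, it compares the
  order of the roots before and after. In the induction the head either stays in front, without
  sign, or passes the first part.\<close>

lemma unshuffle_sum_subsets:
  fixes g :: "nat tree_or_cycle list \<Rightarrow> nat tree_or_cycle list \<Rightarrow> ('c \<Rightarrow>\<^sub>0 'k::field)"
  assumes "distinct xs" "distinct (list_roots xs)"
  shows "unshuffle_sum (susp_deg (tree_lie red :: (nat, _, 'k) dg_lie)) xs g = (\<Sum>A\<in>Pow (set xs).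
    fscale (orientation (list_roots xs)
        * orientation (list_roots (filter (\<lambda>x. x \<in> A) xs @ filter (\<lambda>x. x \<notin> A) xs)))
      (g (filter (\<lambda>x. x \<in> A) xs) (filter (\<lambda>x. x \<notin> A) xs)))"
  using assms
proof (induction xs arbitrary: g)
  case (Cons x xs)
  let ?d = "susp_deg (tree_lie red :: (nat, _, 'k) dg_lie)"
  let ?a = "\<lambda>A xs. filter (\<lambda>x. x \<in> A) xs" and ?b = "\<lambda>A xs. filter (\<lambda>x. x \<notin> A) xs"
  let ?o = "\<lambda>xs. orientation (list_roots xs) :: 'k"
  let ?F = "\<lambda>A xs. fscale (?o xs * ?o (?a A xs @ ?b A xs)) (g (?a A xs) (?b A xs))"
  have x: "x \<notin> set xs" "distinct xs" "distinct (list_roots xs)" using Cons.prems by auto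
  have in1: "?F (insert x A) (x # xs) = fscale (?o xs * ?o (?a A xs @ ?b A xs)) (g (x # ?a A xs) (?b A xs))"
    if A: "A \<in> Pow (set xs)" for A
  proof -
    have f: "?a (insert x A) (x # xs) = x # ?a A xs" "?b (insert x A) (x # xs) = ?b A xs"
      using x(1) by (auto intro!: filter_cong)
    have "mset (list_roots xs) = mset (list_roots (?a A xs @ ?b A xs))"
      unfolding list_roots_def by (induction xs) simp_all
    then have "?o (x # xs) * ?o (x # ?a A xs @ ?b A xs) = ?o xs * ?o (?a A xs @ ?b A xs)"
      using toc_roots_cases[of x] orientation_Cons_mult by fastforce
    then show ?thesis unfolding f by (simp only: append_Cons)
  qed
  \<comment> \<open>Here the head joins the second part, so that its root, if any, passes the roots
    of the first part; their number is the total degree of that part.\<close>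
  have in2: "?F A (x # xs) = fscale (?o xs * ?o (?a A xs @ ?b A xs))
      (fscale (parity_sign (?d x * total_deg ?d (?a A xs))) (g (?a A xs) (x # ?b A xs)))"
    if A: "A \<in> Pow (set xs)" for A
  proof -
    have xA: "x \<notin> A" using A x(1) by auto
    have m: "mset (list_roots xs) = mset (list_roots (?a A xs @ ?b A xs))"
      unfolding list_roots_def by (induction xs) simp_all
    have "?o (x # xs) * ?o (?a A xs @ x # ?b A xs)
      = parity_sign (?d x * total_deg ?d (?a A xs)) * (?o xs * ?o (?a A xs @ ?b A xs))"
    proof (cases "toc_roots x = []")
      case True
      then show ?thesis by (simp add: susp_deg_tree_lie parity_sign_def)
    next
      case False
      then obtain r where r: "toc_roots x = [r]" using toc_roots_cases[of x] by blast
      then have rn: "r \<notin> set (list_roots (?a A xs))"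
        using Cons.prems(2) by (auto simp: set_list_roots)
      have e1: "?o (?a A xs @ x # ?b A xs) = (- 1) ^ length (list_roots (?a A xs))
          * orientation (r # list_roots (?a A xs @ ?b A xs))"
        using orientation_append_Cons[OF rn, of "list_roots (?b A xs)", where ?'k = 'k]
        by (simp only: list_roots_simps r append.simps)
      have e2: "parity_sign (?d x * total_deg ?d (?a A xs)) = ((- 1) ^ length (list_roots (?a A xs)) :: 'k)"
        by (simp add: susp_deg_tree_lie total_deg_tree_lie r parity_sign_def)
      have e3: "?o (x # xs) * orientation (r # list_roots (?a A xs @ ?b A xs))
          = ?o xs * ?o (?a A xs @ ?b A xs)"
        using orientation_Cons_mult[OF m, of r, where ?'k = 'k] by (simp only: list_roots_simps r append.simps)
      show ?thesis unfolding e1 e2 e3[symmetric] by (simp only: mult_ac)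
    qed
    then show ?thesis using xA by (simp add: mult_ac)
  qed
  have "unshuffle_sum ?d (x # xs) g = (\<Sum>A\<in>Pow (set xs). fscale (?o xs * ?o (?a A xs @ ?b A xs))
      (g (x # ?a A xs) (?b A xs)
        + fscale (parity_sign (?d x * total_deg ?d (?a A xs))) (g (?a A xs) (x # ?b A xs))))"
    unfolding unshuffle_sum.simps by (rule Cons.IH[OF x(2,3)])
  also have "\<dots> = (\<Sum>A\<in>Pow (set xs). ?F (insert x A) (x # xs) + ?F A (x # xs))"
    by (intro sum.cong refl) (simp only: in1 in2 fvec.scale_right_distrib)
  also have "\<dots> = (\<Sum>A\<in>Pow (set xs). ?F A (x # xs)) + (\<Sum>A\<in>insert x ` Pow (set xs). ?F A (x # xs))"
  proof -
    have "inj_on (insert x) (Pow (set xs))" using x(1) by (auto simp: inj_on_def)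
    then show ?thesis by (simp only: sum.distrib sum.reindex o_def add.commute)
  qed
  also have "\<dots> = (\<Sum>A\<in>Pow (set (x # xs)). ?F A (x # xs))"
    unfolding list.set Pow_insert using x(1) by (intro sum.union_disjoint[symmetric]) auto
  finally show ?case .
qed simp

text \<open>The quadratic part of the differential sums over unordered pairs, but a bracket contains
  one attachment for each order. This splits it into a sum over ordered pairs.\<close>

lemma sum_card_2_subsets:
  fixes h :: "'a set \<Rightarrow> 'b::comm_monoid_add"
  assumes "finite S" "\<And>x y. x \<in> S \<Longrightarrow> y \<in> S \<Longrightarrow> x \<noteq> y \<Longrightarrow> h {x, y} = k x y + k y x"
  shows "(\<Sum>A\<in>{A \<in> Pow S. card A = 2}. h A) = (\<Sum>x\<in>S. \<Sum>y\<in>S - {x}. k x y)"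
  using assms
proof (induction S rule: finite_induct)
  case (insert z S)
  let ?P = "\<lambda>S. {A \<in> Pow S. card A = 2}"
  have "?P (insert z S) = ?P S \<union> (\<lambda>y. {z, y}) ` S"
  proof (intro set_eqI iffI)
    fix A assume A: "A \<in> ?P (insert z S)"
    show "A \<in> ?P S \<union> (\<lambda>y. {z, y}) ` S"
    proof (cases "z \<in> A")
      case True
      obtain x y where "A = {x, y}" "x \<noteq> y" using A by (auto simp: card_2_iff)
      then show ?thesis using True A by auto
    qed (use A in auto)
  qed (use insert.hyps in \<open>auto simp: card_insert_if\<close>)
  moreover have "?P S \<inter> (\<lambda>y. {z, y}) ` S = {}" using insert.hyps by auto
  moreover have "finite (?P S)" using insert.hyps by simp
  moreover have "inj_on (\<lambda>y. {z, y}) S" by (auto simp: inj_on_def doubleton_eq_iff)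
  ultimately have "(\<Sum>A\<in>?P (insert z S). h A) = (\<Sum>A\<in>?P S. h A) + (\<Sum>y\<in>S. h {z, y})"
    using insert.hyps by (simp add: sum.union_disjoint sum.reindex)
  also have "(\<Sum>A\<in>?P S. h A) = (\<Sum>x\<in>S. \<Sum>y\<in>S - {x}. k x y)"
    using insert.prems by (intro insert.IH) auto
  also have "(\<Sum>y\<in>S. h {z, y}) = (\<Sum>y\<in>S. k z y + k y z)"
    using insert.prems insert.hyps by (intro sum.cong refl) auto
  also have "(\<Sum>x\<in>S. \<Sum>y\<in>S - {x}. k x y) + (\<Sum>y\<in>S. k z y + k y z)
    = (\<Sum>x\<in>S. k x z + (\<Sum>y\<in>S - {x}. k x y)) + (\<Sum>y\<in>S. k z y)"
    by (simp add: sum.distrib ac_simps)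
  also have "(\<Sum>x\<in>S. k x z + (\<Sum>y\<in>S - {x}. k x y)) = (\<Sum>x\<in>S. \<Sum>y\<in>insert z S - {x}. k x y)"
  proof (intro sum.cong refl)
    fix x assume "x \<in> S"
    then have "insert z S - {x} = insert z (S - {x})" using insert.hyps by auto
    then show "k x z + (\<Sum>y\<in>S - {x}. k x y) = (\<Sum>y\<in>insert z S - {x}. k x y)"
      using insert.hyps by simp
  qed
  also have "(\<Sum>y\<in>S. k z y) = (\<Sum>y\<in>insert z S - {z}. k z y)"
    using insert.hyps by (intro sum.cong) auto
  finally show ?case using insert.hyps by (simp add: add.commute)
qed (auto intro: sum.neutral)

section \<open>The Chevalley--Eilenberg differential\<close>

definition join :: "'v digraph \<Rightarrow> 'v digraph \<Rightarrow> 'v \<Rightarrow> 'v digraph"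
  where "join G T v = (verts G \<union> verts T, insert (root T, v) (edges G \<union> edges T))"

lemma join_simps [simp]:
  "verts (join G T v) = verts G \<union> verts T"
  "edges (join G T v) = insert (root T, v) (edges G \<union> edges T)"
  by (simp_all add: join_def)

lemma symcl_mono: "edges G \<subseteq> edges H \<Longrightarrow> (u, v) \<in> symcl G \<Longrightarrow> (u, v) \<in> symcl H"
  by (rule subsetD[OF rtrancl_mono]) auto

lemma connected_add_edge:
  assumes "connected_digraph G"
  shows "connected_digraph (add_edge G r v)"
  using assms symcl_mono[of G "add_edge G r v"] unfolding connected_digraph_iff
  by (metis edges_add_edge subset_insertI verts_add_edge)

lemma connected_join:
  assumes "connected_digraph G" "connected_digraph T" "root T \<in> verts T" "v \<in> verts G"
  shows "connected_digraph (join G T v)"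
proof -
  let ?J = "join G T v"
  have E: "edges G \<subseteq> edges ?J" "edges T \<subseteq> edges ?J" by auto
  have rv: "(root T, v) \<in> symcl ?J" by auto
  have to_v: "(u, v) \<in> symcl ?J" if "u \<in> verts ?J" for u
  proof (cases "u \<in> verts G")
    case True
    then show ?thesis using assms symcl_mono[OF E(1)] unfolding connected_digraph_iff by blast
  next
    case False
    then have "(u, root T) \<in> symcl ?J"
      using assms that symcl_mono[OF E(2)] unfolding connected_digraph_iff by auto
    then show ?thesis using rv by (rule rtrancl_trans)
  qed
  then have "(u, w) \<in> symcl ?J" if "u \<in> verts ?J" "w \<in> verts ?J" for u w
    using that symcl_sym[of w v ?J] by (blast intro: rtrancl_trans)
  moreover have "verts ?J \<noteq> {}" using assms(4) by auto
  ultimately show ?thesis unfolding connected_digraph_iff by blast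
qed

lemma join_props:
  assumes "finite_digraph G" "single_valued (edges G)" "rooted_tree T" "v \<in> verts G"
    "verts G \<inter> verts T = {}"
  shows "finite_digraph (join G T v)" "single_valued (edges (join G T v))"
    "sinks (join G T v) = sinks G" "has_loop (join G T v) \<longleftrightarrow> has_loop G"
proof -
  have T: "finite_digraph T" "single_valued (edges T)" "sinks T = {root T}"
    using assms(3) sinks_eq_root[OF assms(3)] by (simp_all add: rooted_tree_iff)
  have r: "root T \<in> verts T" "root T \<notin> Domain (edges T)" using T(3) by (auto simp: sinks_def)
  have E: "edges G \<subseteq> verts G \<times> verts G" "edges T \<subseteq> verts T \<times> verts T"
    using assms(1) T(1) by (auto simp: finite_digraph_def)
  show "finite_digraph (join G T v)"
    using assms(1,4) T(1) r(1) by (auto simp: finite_digraph_def)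
  show "single_valued (edges (join G T v))"
  proof (rule single_valuedI)
    fix x y z assume xy: "(x, y) \<in> edges (join G T v)" and xz: "(x, z) \<in> edges (join G T v)"
    show "y = z"
    proof (cases "x \<in> verts G")
      case True
      then have "x \<notin> verts T" using assms(5) by auto
      then have "(x, y) \<in> edges G" "(x, z) \<in> edges G" using xy xz E(2) r(1) by auto
      then show ?thesis using assms(2) by (auto dest: single_valuedD)
    next
      case False
      then have "(x, y) \<in> insert (root T, v) (edges T)" "(x, z) \<in> insert (root T, v) (edges T)"
        using xy xz E(1) by auto
      then show ?thesis using T(2) r(2) by (auto dest: single_valuedD)
    qed
  qed
  show "sinks (join G T v) = sinks G"
  proof -
    have "w \<in> Domain (edges T) \<union> {root T}" if "w \<in> verts T" for w
      using that T(3) by (auto simp: sinks_def)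
    moreover have "w \<notin> Domain (edges T) \<and> w \<noteq> root T" if "w \<in> verts G" for w
      using that E(2) r(1) assms(5) by auto
    ultimately show ?thesis unfolding sinks_def by auto
  qed
  show "has_loop (join G T v) \<longleftrightarrow> has_loop G"
    using rooted_tree_no_loop[OF assms(3)] assms(4,5) r(1) by (auto simp: has_loop_def)
qed

text \<open>The effect of a new edge from the root of \<open>T\<close>: in its own tree it closes a
  cycle, elsewhere it grafts. Comparing digraphs suffices to tell these cases apart, since different
  members of a configuration have disjoint nonempty vertex sets.\<close>

primrec attach :: "'v digraph \<Rightarrow> 'v tree_or_cycle \<Rightarrow> 'v \<Rightarrow> 'v tree_or_cycle"
  where "attach T (Tree U) v = (if U = T then Cyc (add_edge T (root T) v) else Tree (join U T v))"
  | "attach T (Cyc C) v = Cyc (join C T v)"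

lemma grafts_eq: "grafts con G T = (\<Sum>v\<in>verts G. bas (con (join G T v)))"
  by (simp add: grafts_def join_def)

lemma close_up_eq: "close_up T S = (\<Sum>v\<in>S. bas (Cyc (add_edge T (root T) v)))"
  by (simp add: close_up_def add_edge_def)

text \<open>The last hypothesis excludes exactly the edge that would create a loop at the root and
  so leave the reduced basis. Grafting preserves the sinks of the target, hence its root, and
  creates no loop.\<close>

lemma attach_props:
  fixes s t :: "nat tree_or_cycle"
  assumes xs: "configuration red xs" and s: "s = Tree T" "s \<in> set xs" and t: "t \<in> set xs"
    and v: "v \<in> verts (toc_graph t)" and red: "red \<longrightarrow> v \<noteq> root T"
  shows "attach T t v \<in> lie_basis (tree_lie red :: (nat, _, rat) dg_lie)"
    and "toc_roots (attach T t v) = (if t = s then [] else toc_roots t)"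
    and "verts (toc_graph (attach T t v)) = verts (toc_graph t) \<union> verts T"
    and "edges (toc_graph (attach T t v)) = insert (root T, v) (edges (toc_graph t) \<union> edges T)"
proof -
  note b = configurationD(1)[OF xs]
  have T: "rooted_tree T" using b[OF s(2)] s(1) by (simp add: tree_lie_basis)
  have rT: "sinks T = {root T}" by (rule sinks_eq_root[OF T])
  then have r: "root T \<in> verts T" by (auto simp: sinks_def)
  note bt = basis_props[OF b[OF t]]
  have "attach T t v \<in> lie_basis (tree_lie red :: (nat, _, rat) dg_lie) \<and>
      toc_roots (attach T t v) = (if t = s then [] else toc_roots t)"
  proof (cases "t = s")
    case True
    have v': "v \<in> verts T" using v True s(1) by simp
    have F: "functional_digraph T"
      using T by (auto simp: functional_digraph_def rooted_tree_iff connected_digraph_def)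
    note f = functional_add_edge[OF F, of "root T" v]
    have "cycle_of_trees (add_edge T (root T) v)"
      unfolding cycle_of_trees_iff
      using f rT v' T connected_add_edge[of T] by (auto simp: functional_digraph_def rooted_tree_iff)
    moreover have "red \<longrightarrow> \<not> has_loop (add_edge T (root T) v)"
      using rooted_tree_no_loop[OF T] red by (auto simp: has_loop_def)
    ultimately show ?thesis using True s(1) by (simp add: tree_lie_basis)
  next
    case False
    have disj: "verts (toc_graph t) \<inter> verts T = {}"
      using configurationD(2)[OF xs t s(2) False] s(1) by simp
    note j = join_props[OF bt(1,3) T v disj]
    have c: "connected_digraph (join (toc_graph t) T v)"
      using T r v bt(2) by (intro connected_join) (auto simp: rooted_tree_iff)
    show ?thesis
    proof (cases t)
      case (Tree U)
      have "rooted_tree (join U T v)"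
        using j c bt(4) Tree by (auto simp: rooted_tree_iff)
      moreover from this have "root (join U T v) = root U"
        using sinks_eq_root[of "join U T v"] j(3) bt(4) Tree by simp
      ultimately show ?thesis using Tree False s(1) by (simp add: tree_lie_basis)
    next
      case (Cyc C)
      have "cycle_of_trees (join C T v)"
        using j c bt(4) Cyc by (auto simp: cycle_of_trees_iff)
      moreover have "red \<longrightarrow> \<not> has_loop (join C T v)"
        using j(4) Cyc basis_has_loop[OF b[OF t]] by auto
      ultimately show ?thesis using Cyc False by (simp add: tree_lie_basis)
    qed
  qed
  then show "attach T t v \<in> lie_basis (tree_lie red :: (nat, _, rat) dg_lie)"
    "toc_roots (attach T t v) = (if t = s then [] else toc_roots t)" by auto
  show "verts (toc_graph (attach T t v)) = verts (toc_graph t) \<union> verts T"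
    "edges (toc_graph (attach T t v)) = insert (root T, v) (edges (toc_graph t) \<union> edges T)"
    using s(1) by (cases t; auto)+
qed

abbreviation others :: "'a \<Rightarrow> 'a \<Rightarrow> 'a list \<Rightarrow> 'a list"
  where "others s t xs \<equiv> filter (\<lambda>x. x \<notin> {s, t}) xs"

text \<open>The tree and its target are replaced by one component, whose vertices are still disjoint
  from all others. The case \<open>t = s\<close> is included: \<open>others\<close> then removes a
  single entry. On the level of digraphs both cases are one and the same edge insertion.\<close>

lemma configuration_attach:
  assumes xs: "configuration red xs" and s: "s = Tree T" "s \<in> set xs" and t: "t \<in> set xs"
    and v: "v \<in> verts (toc_graph t)" and red: "red \<longrightarrow> v \<noteq> root T"
  defines "ys \<equiv> attach T t v # others s t xs"
  shows "configuration red ys" "graph_union ys = add_edge (graph_union xs) (root T) v"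
    "root T \<in> set (list_roots xs)" "set (list_roots ys) = set (list_roots xs) - {root T}"
proof -
  note b = configurationD(1)[OF xs] and disj = configurationD(2)[OF xs]
  note a = attach_props[OF xs s t v red]
  have vs: "verts (toc_graph s) = verts T" "edges (toc_graph s) = edges T" "toc_roots s = [root T]"
    using s(1) by simp_all
  have "sorted_wrt (\<lambda>x y. verts (toc_graph x) \<inter> verts (toc_graph y) = {}) (others s t xs)"
    using xs by (intro sorted_wrt_filter) (simp add: configuration_def)
  moreover have "verts (toc_graph (attach T t v)) \<inter> verts (toc_graph x) = {}" if "x \<in> set (others s t xs)" for x
    using disj[of t x] disj[of s x] that t s(2) unfolding a(3) vs(1)[symmetric] by auto
  ultimately show "configuration red ys"
    using a(1) b unfolding configuration_def ys_def by auto
  have V: "(\<Union>x\<in>set xs. F x) = F s \<union> F t \<union> (\<Union>x\<in>set (others s t xs). F x)" for F :: "_ \<Rightarrow> 'c set"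
    using s(2) t by auto
  have "verts (graph_union ys) = verts (graph_union xs)"
    unfolding graph_union_simps ys_def V[of "\<lambda>x. verts (toc_graph x)"] vs list.set UN_insert a(3) by blast
  moreover have "edges (graph_union ys) = insert (root T, v) (edges (graph_union xs))"
    unfolding graph_union_simps ys_def V[of "\<lambda>x. edges (toc_graph x)"] vs list.set UN_insert a(4) by blast
  ultimately show "graph_union ys = add_edge (graph_union xs) (root T) v"
    by (simp add: add_edge_def prod_eq_iff)
  show "root T \<in> set (list_roots xs)" using s vs(3) by (force simp: set_list_roots)
  have "root T \<notin> set (toc_roots x)" if "x \<in> set xs" "x \<noteq> s" for x
    using disj[OF that(1) s(2) that(2)] basis_props(6)[OF b[OF that(1)]] basis_props(6)[OF b[OF s(2)]] vs(3)
    by auto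
  then have "(\<Union>x\<in>set (others s t xs). set (toc_roots x)) - {root T} = (\<Union>x\<in>set (others s t xs). set (toc_roots x))"
    "t \<noteq> s \<Longrightarrow> set (toc_roots t) - {root T} = set (toc_roots t)" using t by auto
  then show "set (list_roots ys) = set (list_roots xs) - {root T}"
    unfolding set_list_roots V[of "\<lambda>x. set (toc_roots x)"] ys_def list.set UN_insert a(2) vs(3)
    by (cases "t = s") (auto simp: vs(3))
qed

lemma filter_eq_singleton: "distinct xs \<Longrightarrow> s \<in> set xs \<Longrightarrow> filter (\<lambda>x. x \<in> {s}) xs = [s]"
proof (induction xs)
  case (Cons x xs)
  show ?case
  proof (cases "x = s")
    case True
    then have "filter (\<lambda>x. x \<in> {s}) xs = []" using Cons.prems by (auto simp: filter_empty_conv)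
    then show ?thesis using True by simp
  qed (use Cons in auto)
qed simp

lemma filter_eq_pair:
  assumes "distinct xs" "x \<in> set xs" "y \<in> set xs" "x \<noteq> y"
  shows "filter (\<lambda>z. z \<in> {x, y}) xs = [x, y] \<or> filter (\<lambda>z. z \<in> {x, y}) xs = [y, x]"
proof -
  let ?a = "filter (\<lambda>z. z \<in> {x, y}) xs"
  have a: "set ?a = {x, y}" "distinct ?a" using assms by auto
  then have "length ?a = 2" using distinct_card[of ?a] assms(4) by simp
  then obtain u w where "?a = [u, w]" by (auto simp: length_Suc_conv numeral_2_eq_2)
  then show ?thesis using a by (auto simp: doubleton_eq_iff)
qed

lemma length_filter_mem: "distinct xs \<Longrightarrow> A \<subseteq> set xs \<Longrightarrow> length (filter (\<lambda>x. x \<in> A) xs) = card A"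
  by (simp add: length_filter_distinct) (metis Int_absorb1 Int_def)

text \<open>The contribution of attaching the tree \<open>s\<close> to the component
  \<open>t\<close>; the diagonal \<open>s = t\<close> is the divergence. The sign compares the old
  roots with the root of \<open>s\<close> followed by the remaining ones. The excluded root can lie
  in \<open>t\<close> only on the diagonal.\<close>

definition ce_term :: "bool \<Rightarrow> nat tree_or_cycle list \<Rightarrow> (nat tree_or_cycle list \<Rightarrow> ('c \<Rightarrow>\<^sub>0 'k::field))
    \<Rightarrow> nat tree_or_cycle \<Rightarrow> nat tree_or_cycle \<Rightarrow> ('c \<Rightarrow>\<^sub>0 'k)"
  where "ce_term red xs f s t = (case s of Cyc C \<Rightarrow> 0 | Tree T \<Rightarrow>
    \<Sum>v\<in>verts (toc_graph t) - (if red then {root T} else {}).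
      fscale (orientation (list_roots xs) * orientation (root T # list_roots (attach T t v # others s t xs)))
        (f (attach T t v # others s t xs)))"

text \<open>Either of two trees may be attached to the other. The bracket takes the difference, and
  exchanging the two leading roots supplies the missing sign. For a tree and a cycle only one
  attachment exists, and the sign \<open>(-1)\<close> to the degree of the first argument in
  \<open>ce2\<close> makes both orders of the arguments agree.\<close>

lemma ce2_term:
  fixes f :: "nat tree_or_cycle list \<Rightarrow> ('c \<Rightarrow>\<^sub>0 'k::field)"
  assumes xs: "configuration red xs" and s: "s \<in> set xs" and t: "t \<in> set xs" and st: "s \<noteq> t"
  shows "fscale (orientation (list_roots xs) * orientation (list_roots ([s, t] @ others s t xs)))
      (lin (\<lambda>y. f (y # others s t xs)) (ce2 (tree_lie red) [s, t]))
    = - ce_term red xs f s t - ce_term red xs f t s"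
proof -
  let ?b = "others s t xs" and ?o = "orientation (list_roots xs) :: 'k"
  have b: "others t s xs = ?b" by (metis insert_commute)
  note bs = configurationD(1)[OF xs]
  have disj: "verts (toc_graph s) \<inter> verts (toc_graph t) = {}" by (rule configurationD(2)[OF xs s t st])
  \<comment> \<open>Off the diagonal the exclusion of the root is vacuous, so the bracket is the
    same in both Lie algebras.\<close>
  have ext: "verts (toc_graph u) - (if red then {root T} else {}) = verts (toc_graph u)"
    if "Tree T \<in> set xs" "u \<in> set xs" "Tree T \<noteq> u" for T u
  proof -
    have "root T \<in> verts T" using basis_props(6)[OF bs[OF that(1)]] by simp
    then have "root T \<notin> verts (toc_graph u)" using configurationD(2)[OF xs that] by auto
    then show ?thesis by simp
  qed
  have root: "toc_roots (attach T u v) = toc_roots u"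
    if "Tree T \<in> set xs" "u \<in> set xs" "Tree T \<noteq> u" "v \<in> verts (toc_graph u)" for T u v
  proof -
    have "v \<noteq> root T"
      using configurationD(2)[OF xs that(1,2,3)] basis_props(6)[OF bs[OF that(1)]] that(4) by auto
    then have "red \<longrightarrow> v \<noteq> root T" by simp
    then show ?thesis using attach_props(2)[OF xs refl that(1,2,4)] that(3) by auto
  qed
  have ct: "ce_term red xs f (Tree T) u = (\<Sum>v\<in>verts (toc_graph u).
      fscale (?o * orientation (root T # toc_roots u @ list_roots (others (Tree T) u xs)))
        (f (attach T u v # others (Tree T) u xs)))"
    if "Tree T \<in> set xs" "u \<in> set xs" "Tree T \<noteq> u" for T u
    unfolding ce_term_def tree_or_cycle.case ext[OF that] using root[OF that] by (intro sum.cong) auto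
  show ?thesis
  proof (cases s)
    case sT: (Tree T)
    show ?thesis
    proof (cases t)
      case tU: (Tree U)
      have ne: "T \<noteq> U" "root T \<noteq> root U"
        using st sT tU disj basis_props(6)[OF bs[OF s]] basis_props(6)[OF bs[OF t]] by auto
      let ?A = "\<Sum>v\<in>verts T. f (Tree (join T U v) # ?b)" and ?B = "\<Sum>v\<in>verts U. f (Tree (join U T v) # ?b)"
      have "lin (\<lambda>y. f (y # ?b)) (ce2 (tree_lie red) [s, t]) = ?A - ?B"
        using sT tU by (simp add: ce2_def grafts_eq parity_sign_def module_hom.diff[OF linmap_lin] lin_sum)
      moreover have "ce_term red xs f s t = fscale (?o * orientation (root T # root U # list_roots ?b)) ?B"
        using ct[of T t] s t st sT tU ne by (simp add: fvec.scale_sum_right)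
      moreover have "ce_term red xs f t s = fscale (?o * orientation (root U # root T # list_roots ?b)) ?A"
        using ct[of U s] s t st sT tU ne b by (simp add: fvec.scale_sum_right)
      moreover have "orientation (root U # root T # list_roots ?b) = (- orientation (root T # root U # list_roots ?b) :: 'k)"
        using orientation_swap[of "root U" "root T" "[]"] ne by simp
      ultimately show ?thesis
        using sT tU by (simp add: fvec.scale_right_diff_distrib del: orientation.simps)
    next
      case tC: (Cyc C)
      have "lin (\<lambda>y. f (y # ?b)) (ce2 (tree_lie red) [s, t]) = - (\<Sum>v\<in>verts C. f (Cyc (join C T v) # ?b))"
        using sT tC by (simp add: ce2_def grafts_eq parity_sign_def module_hom.neg[OF linmap_lin] lin_sum)
      moreover have "ce_term red xs f s t = fscale (?o * orientation (root T # list_roots ?b))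
          (\<Sum>v\<in>verts C. f (Cyc (join C T v) # ?b))"
        using ct[of T t] s t st sT tC by (simp add: fvec.scale_sum_right)
      moreover have "ce_term red xs f t s = 0" using tC by (simp add: ce_term_def)
      ultimately show ?thesis using sT tC by (simp del: orientation.simps)
    qed
  next
    case sC: (Cyc C)
    show ?thesis
    proof (cases t)
      case tT: (Tree T)
      have "lin (\<lambda>y. f (y # ?b)) (ce2 (tree_lie red) [s, t]) = - (\<Sum>v\<in>verts C. f (Cyc (join C T v) # ?b))"
        using sC tT by (simp add: ce2_def grafts_eq parity_sign_def module_hom.neg[OF linmap_lin] lin_sum)
      moreover have "ce_term red xs f t s = fscale (?o * orientation (root T # list_roots ?b))
          (\<Sum>v\<in>verts C. f (Cyc (join C T v) # ?b))"
        using ct[of T s] s t st sC tT b by (simp add: fvec.scale_sum_right)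
      moreover have "ce_term red xs f s t = 0" using sC by (simp add: ce_term_def)
      ultimately show ?thesis using sC tT by (simp del: orientation.simps)
    next
      case tC: (Cyc D)
      then show ?thesis using sC by (simp add: ce2_def ce_term_def)
    qed
  qed
qed

lemma ce1_term:
  fixes f :: "nat tree_or_cycle list \<Rightarrow> ('c \<Rightarrow>\<^sub>0 'k::field)"
  shows "fscale (orientation (list_roots xs) * orientation (list_roots ([s] @ others s s xs)))
      (lin (\<lambda>y. f (y # others s s xs)) (ce1 (tree_lie red) [s])) = - ce_term red xs f s s"
proof (cases s)
  case (Tree T)
  have "lin (\<lambda>y. f (y # others s s xs)) (ce1 (tree_lie red) [s])
      = - (\<Sum>v\<in>verts T - (if red then {root T} else {}). f (Cyc (add_edge T (root T) v) # others s s xs))"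
    using Tree by (simp add: ce1_def close_up_eq module_hom.neg[OF linmap_lin] lin_sum)
  then show ?thesis using Tree by (simp add: ce_term_def fvec.scale_sum_right del: orientation.simps)
next
  case (Cyc C)
  then show ?thesis by (simp add: ce1_def ce_term_def)
qed

text \<open>Subsets of size one give the diagonal terms and those of size two the others. The
  statement is for an arbitrary linear extension \<open>lin f\<close>, because it serves both for
  the comparison with \<open>horizontal\<close> and for showing that the differential preserves the
  generators' span.\<close>

lemma ce_differential_eq:
  fixes f :: "nat tree_or_cycle list \<Rightarrow> ('c \<Rightarrow>\<^sub>0 'k::field)"
  assumes xs: "configuration red xs"
  shows "lin f (ce_differential (tree_lie red) xs) = - (\<Sum>s\<in>set xs. \<Sum>t\<in>set xs. ce_term red xs f s t)"
proof -
  let ?L = "tree_lie red :: (nat, _, 'k) dg_lie"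
  let ?a = "\<lambda>A. filter (\<lambda>x. x \<in> A) xs" and ?b = "\<lambda>A. filter (\<lambda>x. x \<notin> A) xs"
  note d = configurationD(3,4)[OF xs]
  define H where "H c A = fscale (orientation (list_roots xs) * orientation (list_roots (?a A @ ?b A)))
      (lin (\<lambda>y. f (y # ?b A)) (c (?a A)))" for c :: "nat tree_or_cycle list \<Rightarrow> (nat tree_or_cycle \<Rightarrow>\<^sub>0 'k)" and A
  have H: "lin f (coderivation (susp_deg ?L) k c xs) = (\<Sum>A\<in>{A \<in> Pow (set xs). card A = k}. H c A)" for k c
  proof -
    have "lin f (coderivation (susp_deg ?L) k c xs) = unshuffle_sum (susp_deg ?L) xs
        (\<lambda>a b. if length a = k then lin (\<lambda>y. f (y # b)) (c a) else 0)"
      unfolding coderivation_def lin_unshuffle_sum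
      by (intro unshuffle_sum_cong) (simp add: lin_lin)
    also have "\<dots> = (\<Sum>A\<in>Pow (set xs). if card A = k then H c A else 0)"
      unfolding unshuffle_sum_subsets[OF d] H_def
      by (intro sum.cong refl) (simp add: length_filter_mem[OF d(1)])
    also have "\<dots> = (\<Sum>A\<in>{A \<in> Pow (set xs). card A = k}. H c A)"
      by (rule sum.inter_filter[symmetric]) simp
    finally show ?thesis .
  qed
  have "lin f (coderivation (susp_deg ?L) 1 (ce1 ?L) xs) = (\<Sum>s\<in>set xs. - ce_term red xs f s s)"
  proof -
    have "{A \<in> Pow (set xs). card A = 1} = (\<lambda>s. {s}) ` set xs" by (auto simp: card_1_singleton_iff)
    then have "lin f (coderivation (susp_deg ?L) 1 (ce1 ?L) xs) = (\<Sum>s\<in>set xs. H (ce1 ?L) {s})"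
      unfolding H by (simp add: sum.reindex)
    also have "\<dots> = (\<Sum>s\<in>set xs. - ce_term red xs f s s)"
    proof (rule sum.cong[OF refl])
      fix s assume "s \<in> set xs"
      then have "?a {s} = [s]" by (rule filter_eq_singleton[OF d(1)])
      moreover have "?b {s} = others s s xs" by simp
      ultimately show "H (ce1 ?L) {s} = - ce_term red xs f s s"
        unfolding H_def by (simp only: ce1_term)
    qed
    finally show ?thesis .
  qed
  moreover have "lin f (coderivation (susp_deg ?L) 2 (ce2 ?L) xs)
      = (\<Sum>s\<in>set xs. \<Sum>t\<in>set xs - {s}. - ce_term red xs f s t)"
    unfolding H
  proof (rule sum_card_2_subsets)
    fix s t assume st: "s \<in> set xs" "t \<in> set xs" "s \<noteq> t"
    have b: "others t s xs = ?b {s, t}" by (metis insert_commute)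
    \<comment> \<open>The pair occurs in \<open>xs\<close> in one of two orders; the right-hand side
      of \<open>ce2_term\<close> is symmetric in the two entries, so both orders give the same
      value.\<close>
    from filter_eq_pair[OF d(1) st] show "H (ce2 ?L) {s, t} = - ce_term red xs f s t + - ce_term red xs f t s"
    proof
      assume "?a {s, t} = [s, t]"
      then show ?thesis
        using ce2_term[OF xs st, of f] unfolding H_def by simp
    next
      assume "?a {s, t} = [t, s]"
      then show ?thesis
        using ce2_term[OF xs st(2,1), of f] st(3) unfolding H_def b by simp
    qed
  qed simp
  moreover have "(\<Sum>t\<in>set xs. ce_term red xs f s t) = ce_term red xs f s s + (\<Sum>t\<in>set xs - {s}. ce_term red xs f s t)"
    if "s \<in> set xs" for s using that by (intro sum.remove) auto
  ultimately show ?thesis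
    by (simp add: ce_differential_def lin_add sum_negf sum.distrib)
qed

section \<open>Relabelling and components of configurations\<close>

lemma map_digraph_symcl: "(u, v) \<in> symcl G \<Longrightarrow> (\<phi> u, \<phi> v) \<in> symcl (map_digraph \<phi> G)"
proof (induction rule: rtrancl_induct)
  case (step y z)
  then have "(\<phi> y, \<phi> z) \<in> edges (map_digraph \<phi> G) \<union> (edges (map_digraph \<phi> G))\<inverse>" by force
  then show ?case using step.IH by (rule rtrancl_into_rtrancl[rotated])
qed simp

lemma connected_map: "connected_digraph G \<Longrightarrow> connected_digraph (map_digraph \<phi> G)"
  using map_digraph_symcl[of _ _ G \<phi>] unfolding connected_digraph_iff by auto

lemma toc_map_props:
  assumes "b \<in> lie_basis (tree_lie red :: ('v, _, rat) dg_lie)" "inj_on \<phi> (verts (toc_graph b))"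
  shows "toc_map \<phi> b \<in> lie_basis (tree_lie red :: ('v, _, rat) dg_lie)"
    and "toc_graph (toc_map \<phi> b) = map_digraph \<phi> (toc_graph b)"
    and "toc_roots (toc_map \<phi> b) = map \<phi> (toc_roots b)"
proof -
  note b = basis_props[OF assms(1)]
  have F: "functional_digraph (toc_graph b)" using b by (simp add: functional_digraph_def)
  note f = functional_map[OF F assms(2)]
  have c: "connected_digraph (map_digraph \<phi> (toc_graph b))" by (rule connected_map[OF b(2)])
  have "toc_map \<phi> b \<in> lie_basis (tree_lie red :: ('v, _, rat) dg_lie)
    \<and> toc_roots (toc_map \<phi> b) = map \<phi> (toc_roots b)"
  proof (cases b)
    case (Tree T)
    have t: "rooted_tree (map_digraph \<phi> T)"
      using f c b(4) Tree by (simp add: rooted_tree_iff functional_digraph_def)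
    moreover from this have "root (map_digraph \<phi> T) = \<phi> (root T)"
      using sinks_eq_root[of "map_digraph \<phi> T"] f(2) b(4) Tree by simp
    ultimately show ?thesis using Tree by (simp add: tree_lie_basis)
  next
    case (Cyc C)
    have "cycle_of_trees (map_digraph \<phi> C)"
      using f c b(4) Cyc by (simp add: cycle_of_trees_iff functional_digraph_def)
    moreover have "red \<longrightarrow> \<not> has_loop (map_digraph \<phi> C)"
      using f(3) Cyc basis_has_loop[OF assms(1)] by simp
    ultimately show ?thesis using Cyc by (simp add: tree_lie_basis)
  qed
  then show "toc_map \<phi> b \<in> lie_basis (tree_lie red :: ('v, _, rat) dg_lie)"
    "toc_roots (toc_map \<phi> b) = map \<phi> (toc_roots b)" by auto
  show "toc_graph (toc_map \<phi> b) = map_digraph \<phi> (toc_graph b)" by (cases b) simp_all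
qed

lemma configuration_map:
  assumes xs: "configuration red xs" and inj: "inj_on \<phi> (verts (graph_union xs))"
  shows "configuration red (map (toc_map \<phi>) xs)"
    "graph_union (map (toc_map \<phi>) xs) = map_digraph \<phi> (graph_union xs)"
    "list_roots (map (toc_map \<phi>) xs) = map \<phi> (list_roots xs)"
proof -
  have sub: "verts (toc_graph x) \<subseteq> verts (graph_union xs)" if "x \<in> set xs" for x using that by auto
  have p: "toc_map \<phi> x \<in> lie_basis (tree_lie red :: (nat, _, rat) dg_lie)"
    "toc_graph (toc_map \<phi> x) = map_digraph \<phi> (toc_graph x)"
    "toc_roots (toc_map \<phi> x) = map \<phi> (toc_roots x)" if "x \<in> set xs" for x
    using toc_map_props[OF configurationD(1)[OF xs that] inj_on_subset[OF inj sub[OF that]]] by blast+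
  have s: "sorted_wrt (\<lambda>x y. verts (toc_graph x) \<inter> verts (toc_graph y) = {}) xs"
    using xs by (simp add: configuration_def)
  have "sorted_wrt (\<lambda>x y. verts (toc_graph (toc_map \<phi> x)) \<inter> verts (toc_graph (toc_map \<phi> y)) = {}) xs"
  proof (rule sorted_wrt_mono_rel[OF _ s])
    fix x y assume xy: "x \<in> set xs" "y \<in> set xs" "verts (toc_graph x) \<inter> verts (toc_graph y) = {}"
    have "\<phi> ` verts (toc_graph x) \<inter> \<phi> ` verts (toc_graph y) = {}"
      using inj_on_image_Int[OF inj sub[OF xy(1)] sub[OF xy(2)]] xy(3) by simp
    then show "verts (toc_graph (toc_map \<phi> x)) \<inter> verts (toc_graph (toc_map \<phi> y)) = {}"
      by (simp add: p(2)[OF xy(1)] p(2)[OF xy(2)])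
  qed
  then show "configuration red (map (toc_map \<phi>) xs)"
    using xs p(1) by (auto simp: configuration_def sorted_wrt_map)
  show "graph_union (map (toc_map \<phi>) xs) = map_digraph \<phi> (graph_union xs)"
    using p(2) by (simp add: prod_eq_iff image_UN)
  show "list_roots (map (toc_map \<phi>) xs) = map \<phi> (list_roots xs)"
    using p(3) by (induction xs) auto
qed

text \<open>An edge of the union that meets \<open>x\<close> belongs to \<open>x\<close>, because
  the vertex sets are disjoint. So no undirected path leaves \<open>x\<close>, and connectedness
  gives the rest.\<close>

lemma toc_graph_eq_component:
  assumes xs: "configuration red xs" and x: "x \<in> set xs" and v: "v \<in> verts (toc_graph x)"
  shows "toc_graph x = restrict_digraph (graph_union xs) (component_of (graph_union xs) v)"
proof -
  let ?G = "graph_union xs"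
  note b = configurationD(1)[OF xs]
  have E: "edges (toc_graph y) \<subseteq> verts (toc_graph y) \<times> verts (toc_graph y)" if "y \<in> set xs" for y
    using basis_props(1)[OF b[OF that]] by (simp add: finite_digraph_def)
  have edge: "(a, c) \<in> edges (toc_graph x)"
    if ac: "(a, c) \<in> edges ?G" and mem: "a \<in> verts (toc_graph x) \<or> c \<in> verts (toc_graph x)" for a c
  proof -
    obtain y where y: "y \<in> set xs" "(a, c) \<in> edges (toc_graph y)"
      using ac unfolding graph_union_simps by blast
    then have "verts (toc_graph x) \<inter> verts (toc_graph y) \<noteq> {}" using E[OF y(1)] mem by blast
    then have "x = y" using configurationD(2)[OF xs x y(1)] by blast
    then show ?thesis using y(2) by simp
  qed
  have "w \<in> verts (toc_graph x)" if "(v, w) \<in> symcl ?G" for w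
    using that
  proof (induction rule: rtrancl_induct)
    case base
    show ?case by (rule v)
  next
    case (step y z)
    then have "(y, z) \<in> edges (toc_graph x) \<or> (z, y) \<in> edges (toc_graph x)" using edge by blast
    then show ?case using E[OF x] by blast
  qed
  moreover have "(v, w) \<in> symcl ?G" if w: "w \<in> verts (toc_graph x)" for w
  proof (rule symcl_mono)
    show "(v, w) \<in> symcl (toc_graph x)"
      using basis_props(2)[OF b[OF x]] v w unfolding connected_digraph_iff by blast
    show "edges (toc_graph x) \<subseteq> edges ?G" using x by auto
  qed
  ultimately have C: "component_of ?G v = verts (toc_graph x)"
    using x unfolding component_of_def by auto
  have "edges ?G \<inter> verts (toc_graph x) \<times> verts (toc_graph x) = edges (toc_graph x)"
    using edge E[OF x] x by auto
  then show ?thesis unfolding C restrict_digraph_def by (simp add: prod_eq_iff)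
qed

text \<open>The union determines its components, and the constructor of each is determined by
  whether it has a sink. Only the order of the list is lost.\<close>

lemma configuration_unique:
  assumes xs: "configuration red xs" and ys: "configuration red ys" and eq: "graph_union xs = graph_union ys"
  shows "set xs = set ys"
proof -
  have sub: "set xs \<subseteq> set ys"
    if xs: "configuration red xs" and ys: "configuration red ys" and eq: "graph_union xs = graph_union ys"
    for xs ys
  proof
    fix x assume x: "x \<in> set xs"
    note bx = basis_props[OF configurationD(1)[OF xs x]]
    obtain v where v: "v \<in> verts (toc_graph x)" using bx(5) by auto
    then have "v \<in> verts (graph_union ys)" using x by (auto simp: eq[symmetric])
    then obtain y where y: "y \<in> set ys" "v \<in> verts (toc_graph y)" by auto
    have g: "toc_graph x = toc_graph y"
      using toc_graph_eq_component[OF xs x v] toc_graph_eq_component[OF ys y] eq by simp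
    note b_y = basis_props[OF configurationD(1)[OF ys y(1)]]
    have "toc_roots x = [] \<longleftrightarrow> toc_roots y = []" using bx(4) b_y(4) g by (metis set_empty)
    then have "x = y" using g by (cases x; cases y) auto
    then show "x \<in> set ys" using y(1) by simp
  qed
  show ?thesis using sub[OF xs ys eq] sub[OF ys xs eq[symmetric]] by blast
qed

lemma component_of_cong:
  assumes "w \<in> component_of G v"
  shows "component_of G w = component_of G v"
proof -
  have "(v, w) \<in> symcl G" using assms by (simp add: component_of_def)
  then have "(w, u) \<in> symcl G \<longleftrightarrow> (v, u) \<in> symcl G" for u
    using symcl_sym[of v w G] by (meson rtrancl_trans)
  then show ?thesis by (simp add: component_of_def)
qed

text \<open>The components listed in any order form a configuration; a component inherits the
  absence of loops, as the reduced basis requires.\<close>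

lemma configuration_exists:
  assumes G: "functional_digraph G" and red: "red \<longrightarrow> \<not> has_loop G"
  obtains xs where "configuration red xs" "graph_union xs = (G :: nat digraph)"
proof -
  define tag where "tag C = (if sinks C = {} then Cyc C else Tree C)" for C :: "nat digraph"
  have tag: "toc_graph (tag C) = C" for C by (simp add: tag_def)
  have fin: "finite_digraph G" and sv: "single_valued (edges G)" and ne: "verts G \<noteq> {}"
    using G by (auto simp: functional_digraph_def)
  have "finite (tag ` components G)" using fin by (simp add: components_eq finite_digraph_def)
  from finite_distinct_list[OF this] obtain xs where xs: "set xs = tag ` components G" "distinct xs"
    by (elim exE conjE)
  have el: "\<exists>v\<in>verts G. x = tag (restrict_digraph G (component_of G v))" if "x \<in> set xs" for x
    using that xs(1) by (auto simp: components_eq)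
  have disj: "verts (toc_graph x) \<inter> verts (toc_graph y) = {}"
    if xy: "x \<in> set xs" "y \<in> set xs" "x \<noteq> y" for x y
  proof -
    obtain v w where v: "x = tag (restrict_digraph G (component_of G v))"
      and w: "y = tag (restrict_digraph G (component_of G w))" using el[OF xy(1)] el[OF xy(2)] by blast
    show ?thesis
    proof (rule ccontr)
      assume "verts (toc_graph x) \<inter> verts (toc_graph y) \<noteq> {}"
      then obtain u where "u \<in> component_of G v" "u \<in> component_of G w"
        unfolding v w tag restrict_digraph_simps by blast
      then have "component_of G v = component_of G w" by (metis component_of_cong)
      then show False using xy(3) v w by simp
    qed
  qed
  have "tag (restrict_digraph G (component_of G v)) \<in> lie_basis (tree_lie red :: (nat, _, rat) dg_lie)"
    if v: "v \<in> verts G" for v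
  proof -
    let ?C = "restrict_digraph G (component_of G v)"
    have "finite_digraph ?C" "connected_digraph ?C" "single_valued (edges ?C)"
      using component_finite[OF fin v] component_connected[OF fin v] sv by (auto simp: single_valued_def)
    moreover have "red \<longrightarrow> \<not> has_loop ?C" using red by (auto simp: has_loop_def)
    ultimately show ?thesis
      by (simp add: tag_def tree_lie_basis rooted_tree_iff cycle_of_trees_iff)
  qed
  then have "set xs \<subseteq> lie_basis (tree_lie red :: (nat, _, rat) dg_lie)" using el by blast
  moreover have "xs \<noteq> []" using xs(1) ne by (auto simp: components_eq)
  moreover have "sorted_wrt (\<lambda>x y. verts (toc_graph x) \<inter> verts (toc_graph y) = {}) xs"
    unfolding sorted_wrt_iff_nth_less
  proof (intro allI impI)
    fix i j assume ij: "i < j" "j < length xs"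
    then have "xs ! i \<noteq> xs ! j" using xs(2) by (simp add: nth_eq_iff_index_eq)
    then show "verts (toc_graph (xs ! i)) \<inter> verts (toc_graph (xs ! j)) = {}"
      using ij by (intro disj) auto
  qed
  ultimately have "configuration red xs" by (simp add: configuration_def)
  moreover have "graph_union xs = G"
  proof -
    have self: "v \<in> component_of G v" if "v \<in> verts G" for v using that by (simp add: component_of_def)
    have "(\<Union>v\<in>verts G. component_of G v) = verts G"
      using self by (auto simp: component_of_def)
    then have "verts (graph_union xs) = verts G"
      unfolding graph_union_simps xs(1) components_eq image_image UN_simps tag restrict_digraph_simps by simp
    moreover have "(a, c) \<in> (\<Union>v\<in>verts G. edges G \<inter> component_of G v \<times> component_of G v)"
      if ac: "(a, c) \<in> edges G" for a c
    proof -
      have a: "a \<in> verts G" using ac fin by (auto simp: finite_digraph_def)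
      then show ?thesis using self[OF a] ac component_of_step[OF fin ac, of a] by blast
    qed
    then have "(\<Union>v\<in>verts G. edges G \<inter> component_of G v \<times> component_of G v) = edges G" by auto
    then have "edges (graph_union xs) = edges G"
      unfolding graph_union_simps xs(1) components_eq image_image UN_simps tag restrict_digraph_simps by simp
    ultimately show ?thesis by (simp add: prod_eq_iff)
  qed
  ultimately show ?thesis using that by blast
qed

section \<open>Comparison with antisymmetrised forests\<close>

text \<open>The orientation makes the value change by the Koszul sign when \<open>xs\<close> is
  reordered, as the relations of the symmetric powers demand.\<close>

definition forest_elt :: "nat set \<Rightarrow> nat tree_or_cycle list \<Rightarrow> (forest_class \<Rightarrow>\<^sub>0 'k::field_char_0)"
  where "forest_elt Q xs = fscale (orientation (list_roots xs)) (alt (graph_union xs) (set (list_roots xs)) Q)"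

text \<open>The antisymmetrisation makes \<open>d\<^sup>H\<close> an average over the \<open>p + 1\<close> roots with the sign \<open>(- 1)\<^sup>p\<close> of
  moving a root to the last place, and \<open>d\<^sup>V\<close> appends the new white vertex after \<open>q\<close> others, where
  the differential of \<open>K\<close> inserts it from the front; the factors compensate for this.\<close>

primrec root_factor :: "nat \<Rightarrow> 'k::field_char_0"
  where "root_factor 0 = 1"
  | "root_factor (Suc p) = (- 1) ^ Suc p * of_nat (Suc p) * root_factor p"

primrec white_factor :: "nat \<Rightarrow> 'k::field_char_0"
  where "white_factor 0 = 1"
  | "white_factor (Suc q) = (- 1) ^ q * white_factor q"

lemma factor_nonzero: "root_factor p \<noteq> 0" "white_factor q \<noteq> 0"
proof -
  show "(root_factor p :: 'a::field_char_0) \<noteq> 0"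
  proof (induction p)
    case (Suc p)
    then show ?case by (simp del: of_nat_Suc)
  qed simp
  show "(white_factor q :: 'b::field_char_0) \<noteq> 0" by (induction q) simp_all
qed

definition psi :: "nat \<Rightarrow> nat \<Rightarrow> (nat \<times> nat tree_or_cycle list \<times> nat set \<Rightarrow>\<^sub>0 'k)
    \<Rightarrow> (forest_class \<Rightarrow>\<^sub>0 'k::field_char_0)"
  where "psi p q = lin (\<lambda>(n, xs, Q). fscale (root_factor p * white_factor q) (forest_elt Q xs))"

lemma linmap_psi: "linmap (psi p q)"
  unfolding psi_def by (rule linmap_lin)

abbreviation ce :: "bool \<Rightarrow> (nat, nat tree_or_cycle list, 'k::field_char_0) dg_species"
  where "ce red \<equiv> chevalley_eilenberg (tree_lie red)"

lemma K_gens_iff: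
  "(n, xs, Q) \<in> K_gens (ce red :: (_, _, 'k::field_char_0) dg_species) p q \<longleftrightarrow>
    configuration red xs \<and> verts (graph_union xs) = {1..n} \<and> length (list_roots xs) = p \<and>
    Q \<subseteq> {1..n} \<and> card Q = q"
  unfolding K_gens_def chevalley_eilenberg_def dg_species.simps mem_Collect_eq prod.case tensor_basis_iff
  by simp

lemma configuration_wf_alt:
  assumes "configuration red xs" "Q \<subseteq> verts (graph_union xs)"
  shows "wf_alt (graph_union xs) (set (list_roots xs)) Q"
  using functional_wf_alt[OF configuration_graph(1)[OF assms(1)] assms(2)]
  by (simp add: configuration_graph(2)[OF assms(1)])

lemma below_sign_eq:
  assumes "distinct rs"
  shows "(orientation (r # rs) * orientation rs :: 'k::field) = below_sign (set rs) r"
  using assms by (simp add: below_sign_def length_filter_distinct mult.assoc)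

text \<open>The forests to be divided out on the aromatic side. In the unreduced case there are
  none, and congruence modulo their span is equality, so both isomorphisms can share their
  proofs.\<close>

definition bad :: "bool \<Rightarrow> nat digraph \<Rightarrow> bool"
  where "bad red G \<longleftrightarrow> red \<and> has_loop G"

lemma edge_stable_bad: "edge_stable (bad red)"
  by (auto simp: bad_def edge_stable_def has_loop_def)

text \<open>Both sides run over pairs of a root and a target vertex with the same signs. They differ
  only in the reduced case, where \<open>horizontal\<close> also attaches each root to itself; those
  terms have loops, so the maps commute modulo \<open>bad\<close>.\<close>

lemma psi_ce_differential:
  assumes g: "(n, xs, Q) \<in> K_gens (ce red :: (_, _, 'k::field_char_0) dg_species) (Suc p) q"
  shows "psi p q (lin (\<lambda>ys. bas (n, ys, Q)) (ce_differential (tree_lie red) xs))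
      - horizontal (psi (Suc p) q (bas (n, xs, Q))) \<in> (fvec.span (alt_forests (bad red) p q) :: (_ \<Rightarrow>\<^sub>0 'k) set)"
proof -
  let ?G = "graph_union xs" and ?R = "set (list_roots xs)" and ?V = "verts (graph_union xs)"
  let ?o = "orientation (list_roots xs) :: 'k"
  let ?X = "\<lambda>r. if red then {r} else {}"
  have xs: "configuration red xs" and Q: "Q \<subseteq> ?V" and len: "length (list_roots xs) = Suc p" and cQ: "card Q = q"
    using g by (auto simp: K_gens_iff)
  note F = configuration_graph(1,2)[OF xs]
  note b = configurationD(1)[OF xs] and disj = configurationD(2)[OF xs]
  have finV: "finite ?V" "finite ?R" using functional_finite[OF F(1)] by auto
  have cR: "card ?R = Suc p" using configurationD(4)[OF xs] len by (simp add: distinct_card)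
  define S where "S r v = (fscale (below_sign ?R r) (alt (add_edge ?G r v) (?R - {r}) Q) :: _ \<Rightarrow>\<^sub>0 'k)" for r v
  have disj_roots: "set (toc_roots s) \<inter> set (toc_roots t) = {}" if "s \<in> set xs" "t \<in> set xs" "s \<noteq> t" for s t
    using disj[OF that] basis_props(6)[OF b[OF that(1)]] basis_props(6)[OF b[OF that(2)]] by blast
  have ce_t: "ce_term red xs (forest_elt Q) s t
      = (\<Sum>r\<in>set (toc_roots s). \<Sum>v\<in>verts (toc_graph t) - ?X r. fscale ?o (S r v))"
    if s: "s \<in> set xs" and t: "t \<in> set xs" for s t
  proof (cases s)
    case (Tree T)
    have summand: "fscale (?o * orientation (root T # list_roots (attach T t v # others s t xs)))
        (forest_elt Q (attach T t v # others s t xs)) = fscale ?o (S (root T) v)"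
      if v: "v \<in> verts (toc_graph t) - ?X (root T)" for v
    proof -
      let ?ys = "attach T t v # others s t xs"
      have v': "v \<in> verts (toc_graph t)" "red \<longrightarrow> v \<noteq> root T" using v by (auto split: if_splits)
      note c = configuration_attach[OF xs Tree s t v']
      have "(orientation (root T # list_roots ?ys) * orientation (list_roots ?ys) :: 'k)
          = below_sign (set (list_roots ?ys)) (root T)"
        using below_sign_eq[OF configurationD(4)[OF c(1)]] .
      \<comment> \<open>Removing the root itself does not alter the number of smaller roots.\<close>
      also have "\<dots> = below_sign ?R (root T)"
        unfolding c(4) below_sign_def by (intro arg_cong[where f = "\<lambda>A. (- 1) ^ card A"]) auto
      finally have e: "(orientation (root T # list_roots ?ys) * orientation (list_roots ?ys) :: 'k)
          = below_sign ?R (root T)" .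
      show ?thesis
        unfolding forest_elt_def S_def c(2,4) fvec.scale_scale mult.assoc e ..
    qed
    have "ce_term red xs (forest_elt Q) s t = (\<Sum>v\<in>verts (toc_graph t) - ?X (root T).
        fscale (?o * orientation (root T # list_roots (attach T t v # others s t xs)))
          (forest_elt Q (attach T t v # others s t xs)))"
      by (simp only: ce_term_def Tree tree_or_cycle.case)
    also have "\<dots> = (\<Sum>v\<in>verts (toc_graph t) - ?X (root T). fscale ?o (S (root T) v))"
      by (rule sum.cong[OF refl summand])
    finally show ?thesis by (simp add: Tree)
  next
    case (Cyc C)
    then show ?thesis by (simp add: ce_term_def)
  qed
  have "lin (forest_elt Q) (ce_differential (tree_lie red) xs)
      = - (\<Sum>s\<in>set xs. \<Sum>t\<in>set xs. \<Sum>r\<in>set (toc_roots s). \<Sum>v\<in>verts (toc_graph t) - ?X r. fscale ?o (S r v))"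
    unfolding ce_differential_eq[OF xs] using ce_t by (simp cong: sum.cong)
  also have "(\<Sum>s\<in>set xs. \<Sum>t\<in>set xs. \<Sum>r\<in>set (toc_roots s). \<Sum>v\<in>verts (toc_graph t) - ?X r. fscale ?o (S r v))
      = (\<Sum>s\<in>set xs. \<Sum>r\<in>set (toc_roots s). \<Sum>t\<in>set xs. \<Sum>v\<in>verts (toc_graph t) - ?X r. fscale ?o (S r v))"
    by (intro sum.cong refl sum.swap)
  \<comment> \<open>The components partition the vertices, so the bracket terms and the divergence
    term together run once over all admissible targets.\<close>
  also have "\<dots> = (\<Sum>s\<in>set xs. \<Sum>r\<in>set (toc_roots s). \<Sum>v\<in>?V - ?X r. fscale ?o (S r v))"
  proof (intro sum.cong refl)
    fix s r
    have "(\<Union>t\<in>set xs. verts (toc_graph t) - ?X r) = ?V - ?X r" by auto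
    moreover have "finite (verts (toc_graph t) - ?X r)" if "t \<in> set xs" for t
      using finV(1) that by (auto intro: finite_subset)
    moreover have "(verts (toc_graph t) - ?X r) \<inter> (verts (toc_graph u) - ?X r) = {}"
      if "t \<in> set xs" "u \<in> set xs" "t \<noteq> u" for t u using disj[OF that] by blast
    ultimately show "(\<Sum>t\<in>set xs. \<Sum>v\<in>verts (toc_graph t) - ?X r. fscale ?o (S r v))
        = (\<Sum>v\<in>?V - ?X r. fscale ?o (S r v))"
      by (subst sum.UNION_disjoint[symmetric]) simp_all
  qed
  also have "\<dots> = (\<Sum>r\<in>?R. \<Sum>v\<in>?V - ?X r. fscale ?o (S r v))"
    unfolding set_list_roots using disj_roots by (subst sum.UNION_disjoint) auto
  finally have lhs: "lin (forest_elt Q) (ce_differential (tree_lie red) xs)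
      = - (\<Sum>r\<in>?R. \<Sum>v\<in>?V - ?X r. fscale ?o (S r v))" .
  let ?c = "root_factor p * white_factor q :: 'k"
  have "psi p q (lin (\<lambda>ys. bas (n, ys, Q)) (ce_differential (tree_lie red) xs))
      = fscale ?c (lin (forest_elt Q) (ce_differential (tree_lie red) xs))"
    by (simp add: psi_def lin_lin lin_fun_scale)
  also have "\<dots> = fscale (- (?c * ?o)) (\<Sum>r\<in>?R. \<Sum>v\<in>?V - ?X r. S r v)"
    unfolding lhs by (simp add: fvec.scale_sum_right sum_negf)
  finally have 1: "psi p q (lin (\<lambda>ys. bas (n, ys, Q)) (ce_differential (tree_lie red) xs))
      = fscale (- (?c * ?o)) (\<Sum>r\<in>?R. \<Sum>v\<in>?V - ?X r. S r v)" .
  have "horizontal (psi (Suc p) q (bas (n, xs, Q)))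
      = fscale (root_factor (Suc p) * white_factor q * ?o) (horizontal (alt ?G ?R Q))"
    by (simp add: psi_def forest_elt_def module_hom.scale[OF linmap_horizontal] del: root_factor.simps)
  also have "\<dots> = fscale (root_factor (Suc p) * white_factor q * ?o * ((- 1) ^ p / of_nat (Suc p)))
      (\<Sum>r\<in>?R. \<Sum>v\<in>?V. S r v)"
    unfolding horizontal_alt[OF configuration_wf_alt[OF xs Q] cR] S_def fvec.scale_scale ..
  \<comment> \<open>The recursion of \<open>root_factor\<close> is made for this: its new factor
    cancels the averaging in \<open>horizontal_alt\<close> up to the minus sign of
    \<open>ce_differential_eq\<close>.\<close>
  also have "root_factor (Suc p) * white_factor q * ?o * ((- 1) ^ p / of_nat (Suc p)) = - (?c * ?o)"
  proof -
    have "(- 1) ^ p * (- 1) ^ p = (1 :: 'k)" by (simp flip: power_add)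
    then show ?thesis by (simp add: field_simps del: of_nat_Suc)
  qed
  finally have 2: "horizontal (psi (Suc p) q (bas (n, xs, Q))) = fscale (- (?c * ?o)) (\<Sum>r\<in>?R. \<Sum>v\<in>?V. S r v)" .
  show ?thesis
  proof (cases red)
    case False
    then show ?thesis unfolding 1 2 by (simp add: fvec.span_zero)
  next
    case True
    have RV: "?R \<subseteq> ?V" using F(2) by (auto simp: sinks_def)
    \<comment> \<open>Separating the terms with \<open>v = r\<close>, which are exactly the
      difference between the two sides.\<close>
    have "(\<Sum>r\<in>?R. \<Sum>v\<in>?V. S r v) = (\<Sum>r\<in>?R. S r r + (\<Sum>v\<in>?V - {r}. S r v))"
      using RV finV by (intro sum.cong refl sum.remove) auto
    then have "fscale (- (?c * ?o)) (\<Sum>r\<in>?R. \<Sum>v\<in>?V - ?X r. S r v) - fscale (- (?c * ?o)) (\<Sum>r\<in>?R. \<Sum>v\<in>?V. S r v)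
        = fscale (?c * ?o) (\<Sum>r\<in>?R. S r r)"
      using True by (simp add: sum.distrib fvec.scale_right_distrib)
    moreover have "S r r \<in> fvec.span (alt_forests (bad red) p q)" if r: "r \<in> ?R" for r
    proof -
      have rV: "r \<in> ?V" "r \<in> sinks ?G" using r RV F(2) by auto
      note f = functional_add_edge[OF F(1) rV(2,1)]
      have "bad red (add_edge ?G r r)" using True by (auto simp: bad_def has_loop_def)
      then have "alt (add_edge ?G r r) (sinks (add_edge ?G r r)) Q \<in> alt_forests (bad red) p q"
        using f Q cQ cR r finV by (intro alt_forestsI) (auto simp: F(2))
      then show ?thesis unfolding S_def f(2) F(2) by (intro fvec.span_scale fvec.span_base)
    qed
    ultimately show ?thesis unfolding 1 2 by (simp add: fvec.span_scale fvec.span_sum)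
  qed
qed

lemma psi_K_diff:
  assumes g: "(n, xs, Q) \<in> K_gens (ce red :: (_, _, 'k::field_char_0) dg_species) p q"
  shows "psi p (Suc q) (K_diff (n, xs, Q))
    = skew_whites (Suc q) (whiten (psi p q (bas (n, xs, Q)) :: _ \<Rightarrow>\<^sub>0 'k))"
proof -
  let ?G = "graph_union xs" and ?R = "set (list_roots xs)" and ?o = "orientation (list_roots xs) :: 'k"
  have xs: "configuration red xs" and V: "verts ?G = {1..n}" and Q: "Q \<subseteq> verts ?G" and cQ: "card Q = q"
    using g by (auto simp: K_gens_iff)
  let ?c = "root_factor p * white_factor q :: 'k"
  have "psi p (Suc q) (K_diff (n, xs, Q)) = (\<Sum>i\<in>{1..n} - Q. fscale (?c * ?o)
      (fscale ((- 1) ^ q * below_sign Q i) (alt ?G ?R (insert i Q))))"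
    by (simp add: psi_def K_diff_def lin_sum lin_scale forest_elt_def below_sign_def mult_ac)
  also have "\<dots> = fscale (?c * ?o) (skew_whites (Suc q) (whiten (alt ?G ?R Q)))"
    unfolding whiten_alt[OF configuration_wf_alt[OF xs Q] cQ] V fvec.scale_sum_right ..
  also have "\<dots> = skew_whites (Suc q) (whiten (psi p q (bas (n, xs, Q))))"
    by (simp add: psi_def forest_elt_def module_hom.scale[OF linmap_skew_whites]
      module_hom.scale[OF linmap_whiten])
  finally show ?thesis .
qed

lemma K_diff_in:
  assumes "(n, xs, Q) \<in> K_gens (ce red :: (_, _, 'k::field_char_0) dg_species) p q"
  shows "(K_diff (n, xs, Q) :: _ \<Rightarrow>\<^sub>0 'k) \<in> span_of (K_gens (ce red :: (_, _, 'k) dg_species) p (Suc q))"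
proof -
  have "bas (n, xs, insert i Q) \<in> (span_of (K_gens (ce red :: (_, _, 'k) dg_species) p (Suc q)) :: (_ \<Rightarrow>\<^sub>0 'k) set)"
    if "i \<in> {1..n} - Q" for i
  proof (rule bas_in_span_of)
    have "finite Q" using assms finite_subset[of Q "{1..n}"] by (simp add: K_gens_iff)
    then show "(n, xs, insert i Q) \<in> K_gens (ce red :: (_, _, 'k) dg_species) p (Suc q)"
      using assms that by (simp add: K_gens_iff)
  qed
  then show ?thesis
    unfolding K_diff_def prod.case by (intro fvec.subspace_sum fvec.subspace_scale subspace_span_of)
qed

lemma ce_differential_in:
  assumes g: "(n, xs, Q) \<in> K_gens (ce red :: (_, _, 'k::field_char_0) dg_species) (Suc p) q"
  shows "lin (\<lambda>ys. bas (n, ys, Q)) (ce_differential (tree_lie red) xs)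
    \<in> (span_of (K_gens (ce red :: (_, _, 'k) dg_species) p q) :: (_ \<Rightarrow>\<^sub>0 'k) set)"
proof -
  have xs: "configuration red xs" and V: "verts (graph_union xs) = {1..n}"
    and len: "length (list_roots xs) = Suc p" and Q: "Q \<subseteq> {1..n}" "card Q = q"
    using g by (auto simp: K_gens_iff)
  let ?f = "\<lambda>ys. bas (n, ys, Q) :: _ \<Rightarrow>\<^sub>0 'k"
  have "ce_term red xs ?f s t \<in> span_of (K_gens (ce red :: (_, _, 'k) dg_species) p q)"
    if s: "s \<in> set xs" and t: "t \<in> set xs" for s t
  proof (cases s)
    case (Tree T)
    have "?f (attach T t v # others s t xs) \<in> span_of (K_gens (ce red :: (_, _, 'k) dg_species) p q)"
      if v: "v \<in> verts (toc_graph t) - (if red then {root T} else {})" for v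
    proof (rule bas_in_span_of)
      let ?ys = "attach T t v # others s t xs"
      have v': "v \<in> verts (toc_graph t)" "red \<longrightarrow> v \<noteq> root T" using v by (auto split: if_splits)
      note c = configuration_attach[OF xs Tree s t v']
      have "length (list_roots ?ys) = card (set (list_roots xs) - {root T})"
        unfolding c(4)[symmetric] using distinct_card[OF configurationD(4)[OF c(1)]] by simp
      also have "\<dots> = p" using c(3) len distinct_card[OF configurationD(4)[OF xs]] by simp
      finally have l: "length (list_roots ?ys) = p" .
      have "verts (graph_union ?ys) = {1..n}" unfolding c(2) verts_add_edge by (rule V)
      then show "(n, ?ys, Q) \<in> K_gens (ce red :: (_, _, 'k) dg_species) p q"
        unfolding K_gens_iff using c(1) l Q by blast
    qed
    then show ?thesis unfolding ce_term_def Tree tree_or_cycle.case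
      by (intro fvec.subspace_sum fvec.subspace_scale subspace_span_of) (simp add: Tree)
  next
    case (Cyc C)
    then show ?thesis by (simp add: ce_term_def fvec.subspace_0[OF subspace_span_of])
  qed
  then show ?thesis
    unfolding ce_differential_eq[OF xs] by (intro fvec.subspace_neg fvec.subspace_sum subspace_span_of)
qed

section \<open>Generators and relations of the composite\<close>

text \<open>A description of the elements of \<open>K_gens\<close> that does not mention the field,
  which membership in \<open>K_gens\<close> carries in its type.\<close>

definition generator :: "bool \<Rightarrow> nat \<Rightarrow> nat \<Rightarrow> nat \<Rightarrow> nat tree_or_cycle list \<Rightarrow> nat set \<Rightarrow> bool"
  where "generator red p q n xs Q \<longleftrightarrow> configuration red xs \<and> verts (graph_union xs) = {1..n} \<and>
    length (list_roots xs) = p \<and> Q \<subseteq> {1..n} \<and> card Q = q"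

lemma generator_configuration: "generator red p q n xs Q \<Longrightarrow> configuration red xs"
  by (simp only: generator_def)

definition K_space :: "bool \<Rightarrow> nat \<Rightarrow> nat \<Rightarrow> (nat \<times> nat tree_or_cycle list \<times> nat set \<Rightarrow>\<^sub>0 'k::field_char_0) set"
  where "K_space red p q = span_of (K_gens (ce red :: (_, _, 'k) dg_species) p q)"

definition K_relations :: "bool \<Rightarrow> nat \<Rightarrow> nat \<Rightarrow> (nat \<times> nat tree_or_cycle list \<times> nat set \<Rightarrow>\<^sub>0 'k::field_char_0) set"
  where "K_relations red p q = fvec.span (K_rels (ce red :: (_, _, 'k) dg_species) p q)"

lemma K_gens_generator:
  "(n, xs, Q) \<in> K_gens (ce red :: (_, _, 'k::field_char_0) dg_species) p q \<longleftrightarrow> generator red p q n xs Q"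
  by (simp only: K_gens_iff generator_def)

lemma subspace_K: "fvec.subspace (K_space red p q)" "fvec.subspace (K_relations red p q)"
  by (simp_all add: K_space_def K_relations_def subspace_span_of)

lemma generator_in_space: "generator red p q n xs Q \<Longrightarrow> bas (n, xs, Q) \<in> K_space red p q"
  unfolding K_space_def by (rule bas_in_span_of) (simp only: K_gens_generator)

lemma K_space_cases:
  assumes "x \<in> bas ` K_gens (ce red :: (_, _, 'k::field_char_0) dg_species) p q"
  obtains n xs Q where "x = bas (n, xs, Q)" "generator red p q n xs Q"
  using assms that by (auto simp: K_gens_generator)

lemma configuration_reorder:
  assumes xs: "configuration red xs" and ys: "set ys = set xs" "distinct ys"
  shows "configuration red ys"
proof -
  have "sorted_wrt (\<lambda>x y. verts (toc_graph x) \<inter> verts (toc_graph y) = {}) ys"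
    unfolding sorted_wrt_iff_nth_less
  proof (intro allI impI)
    fix i j assume ij: "i < j" "j < length ys"
    then have "ys ! i \<noteq> ys ! j" using ys(2) by (simp add: nth_eq_iff_index_eq)
    moreover have "ys ! i \<in> set xs" "ys ! j \<in> set xs" using ij ys(1)[symmetric] by auto
    ultimately show "verts (toc_graph (ys ! i)) \<inter> verts (toc_graph (ys ! j)) = {}"
      by (intro configurationD(2)[OF xs])
  qed
  moreover have "ys \<noteq> []" using xs ys(1) by (auto simp: configuration_def)
  ultimately show ?thesis using xs ys(1) by (simp add: configuration_def)
qed

lemma generator_reorder:
  assumes g: "generator red p q n xs Q" and ys: "set ys = set xs" "distinct ys"
  shows "generator red p q n ys Q" "graph_union ys = graph_union xs"
    "set (list_roots ys) = set (list_roots xs)"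
proof -
  have xs: "configuration red xs" using g by (simp add: generator_def)
  note y = configuration_reorder[OF xs ys]
  show gu: "graph_union ys = graph_union xs" using ys(1) by (simp add: graph_union_def)
  show lr: "set (list_roots ys) = set (list_roots xs)" using ys(1) by (simp add: set_list_roots)
  have "length (list_roots ys) = length (list_roots xs)"
    using distinct_card[OF configurationD(4)[OF y]] distinct_card[OF configurationD(4)[OF xs]] lr by simp
  then show "generator red p q n ys Q" using g y gu by (simp add: generator_def)
qed

lemma generator_permute:
  assumes g: "generator red p q n xs Q" and \<sigma>: "\<sigma> permutes {1..n}"
  shows "generator red p q n (map (toc_map \<sigma>) xs) (\<sigma> ` Q)"
    "graph_union (map (toc_map \<sigma>) xs) = map_digraph \<sigma> (graph_union xs)"
    "list_roots (map (toc_map \<sigma>) xs) = map \<sigma> (list_roots xs)"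
proof -
  have xs: "configuration red xs" using g by (simp add: generator_def)
  have inj: "inj_on \<sigma> A" for A using permutes_inj_on[OF \<sigma>] .
  note m = configuration_map[OF xs inj]
  show "graph_union (map (toc_map \<sigma>) xs) = map_digraph \<sigma> (graph_union xs)"
    "list_roots (map (toc_map \<sigma>) xs) = map \<sigma> (list_roots xs)" using m by blast+
  have "\<sigma> ` Q \<subseteq> {1..n}" using image_mono[of Q "{1..n}" \<sigma>] g permutes_image[OF \<sigma>] by (simp add: generator_def)
  moreover have "verts (map_digraph \<sigma> (graph_union xs)) = {1..n}"
    using g permutes_image[OF \<sigma>] by (simp add: generator_def)
  ultimately show "generator red p q n (map (toc_map \<sigma>) xs) (\<sigma> ` Q)"
    using g m inj unfolding generator_def by (simp add: card_image)
qed

lemma orientation_list_roots_swap: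
  assumes "distinct (list_roots (us @ x # y # vs))"
  shows "(orientation (list_roots (us @ y # x # vs)) :: 'k::field)
    = parity_sign (susp_deg (tree_lie red :: (nat, _, 'k) dg_lie) x * susp_deg (tree_lie red :: (nat, _, 'k) dg_lie) y)
      * orientation (list_roots (us @ x # y # vs))"
proof (cases "toc_roots x = [] \<or> toc_roots y = []")
  case True
  then show ?thesis by (auto simp: susp_deg_tree_lie parity_sign_def)
next
  case False
  then obtain r s where rs: "toc_roots x = [r]" "toc_roots y = [s]"
    using toc_roots_cases[of x] toc_roots_cases[of y] by blast
  then have "r \<noteq> s" using assms by auto
  then show ?thesis
    using orientation_swap[of r s "list_roots us" "list_roots vs", where ?'b = 'k]
    by (simp add: rs susp_deg_tree_lie parity_sign_def)
qed

lemma swap_relation: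
  assumes "generator red p q n (us @ x # y # vs) Q"
  shows "bas (n, us @ x # y # vs, Q)
    - fscale (parity_sign (susp_deg (tree_lie red :: (nat, _, 'k) dg_lie) x * susp_deg (tree_lie red :: (nat, _, 'k) dg_lie) y))
        (bas (n, us @ y # x # vs, Q)) \<in> K_rels (ce red :: (_, _, 'k::field_char_0) dg_species) p q"
proof -
  let ?s = "parity_sign (susp_deg (tree_lie red :: (nat, _, 'k) dg_lie) x * susp_deg (tree_lie red :: (nat, _, 'k) dg_lie) y) :: 'k"
  let ?r = "bas (us @ x # y # vs) - fscale ?s (bas (us @ y # x # vs)) :: _ \<Rightarrow>\<^sub>0 'k"
  have "us @ x # y # vs \<in> tensor_basis (tree_lie red :: (nat, _, 'k) dg_lie) {1..n} (int p)"
    using assms unfolding tensor_basis_iff generator_def by blast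
  then have "?r \<in> rels (ce red :: (_, _, 'k) dg_species) {1..n} (int p)"
    unfolding chevalley_eilenberg_def dg_species.simps by blast
  moreover have "lin (\<lambda>x. bas (n, x, Q)) ?r = bas (n, us @ x # y # vs, Q) - fscale ?s (bas (n, us @ y # x # vs, Q))"
    by (simp add: module_hom.diff[OF linmap_lin] lin_scale)
  moreover have "Q \<subseteq> {1..n}" "card Q = q" using assms by (auto simp: generator_def)
  ultimately show ?thesis unfolding K_rels_def by (intro UnI1 CollectI) metis
qed

lemma permute_relation:
  assumes "generator red p q n xs Q" "\<sigma> permutes {1..n}"
  shows "bas (n, xs, Q) - fscale (white_sign \<sigma> Q) (bas (n, map (toc_map \<sigma>) xs, \<sigma> ` Q))
    \<in> K_rels (ce red :: (_, _, 'k::field_char_0) dg_species) p q"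
proof -
  have "transport (ce red :: (_, _, 'k) dg_species) \<sigma> xs = map (toc_map \<sigma>) xs"
    by (simp add: chevalley_eilenberg_def)
  then show ?thesis
    using assms K_gens_generator[of n xs Q red p q, where 'k = 'k] unfolding K_rels_def
    by (intro UnI2 CollectI) metis
qed

lemma K_rels_cases:
  assumes "z \<in> K_rels (ce red :: (_, _, 'k::field_char_0) dg_species) p q"
  obtains (swap) n us x y vs Q where "generator red p q n (us @ x # y # vs) Q"
    "z = bas (n, us @ x # y # vs, Q)
    - fscale (parity_sign (susp_deg (tree_lie red :: (nat, _, 'k) dg_lie) x * susp_deg (tree_lie red :: (nat, _, 'k) dg_lie) y))
        (bas (n, us @ y # x # vs, Q))"
  | (permute) n xs Q \<sigma> where "generator red p q n xs Q" "\<sigma> permutes {1..n}"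
    "z = bas (n, xs, Q) - fscale (white_sign \<sigma> Q) (bas (n, map (toc_map \<sigma>) xs, \<sigma> ` Q))"
proof -
  let ?s = "\<lambda>x y. parity_sign (susp_deg (tree_lie red :: (nat, _, 'k) dg_lie) x * susp_deg (tree_lie red :: (nat, _, 'k) dg_lie) y) :: 'k"
  from assms consider (1) n r Q where "r \<in> rels (ce red :: (_, _, 'k) dg_species) {1..n} (int p)"
      "Q \<subseteq> {1..n}" "card Q = q" "z = lin (\<lambda>x. bas (n, x, Q)) r"
    | (2) n xs Q \<sigma> where "(n, xs, Q) \<in> K_gens (ce red :: (_, _, 'k) dg_species) p q" "\<sigma> permutes {1..n}"
      "z = bas (n, xs, Q) - fscale (white_sign \<sigma> Q) (bas (n, transport (ce red :: (_, _, 'k) dg_species) \<sigma> xs, \<sigma> ` Q))"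
    unfolding K_rels_def by blast
  then show ?thesis
  proof cases
    case 1
    then obtain us x y vs where u: "us @ x # y # vs \<in> tensor_basis (tree_lie red :: (nat, _, 'k) dg_lie) {1..n} (int p)"
      "r = bas (us @ x # y # vs) - fscale (?s x y) (bas (us @ y # x # vs))"
      unfolding chevalley_eilenberg_def dg_species.simps by blast
    have "generator red p q n (us @ x # y # vs) Q"
      using u(1) 1 unfolding tensor_basis_iff generator_def by blast
    moreover have "z = bas (n, us @ x # y # vs, Q) - fscale (?s x y) (bas (n, us @ y # x # vs, Q))"
      unfolding 1(4) u(2) by (simp add: module_hom.diff[OF linmap_lin] lin_scale)
    ultimately show ?thesis by (rule swap)
  next
    case 2
    have "transport (ce red :: (_, _, 'k) dg_species) \<sigma> xs = map (toc_map \<sigma>) xs"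
      by (simp add: chevalley_eilenberg_def)
    then show ?thesis using 2 permute K_gens_generator[of n xs Q red p q, where 'k = 'k] by metis
  qed
qed

lemma generator_swap:
  assumes "generator red p q n (us @ x # y # vs) Q"
  shows "generator red p q n (us @ y # x # vs) Q"
    "graph_union (us @ y # x # vs) = graph_union (us @ x # y # vs)"
    "set (list_roots (us @ y # x # vs)) = set (list_roots (us @ x # y # vs))"
proof -
  have "distinct (us @ x # y # vs)" by (rule configurationD(3)[OF generator_configuration[OF assms]])
  then show "generator red p q n (us @ y # x # vs) Q"
    "graph_union (us @ y # x # vs) = graph_union (us @ x # y # vs)"
    "set (list_roots (us @ y # x # vs)) = set (list_roots (us @ x # y # vs))"
    by (intro generator_reorder[OF assms]; auto)+
qed

lemma K_relations_subset: "K_relations red p q \<subseteq> (K_space red p q :: (_ \<Rightarrow>\<^sub>0 'k::field_char_0) set)"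
proof -
  have "z \<in> K_space red p q" if "z \<in> K_rels (ce red :: (_, _, 'k) dg_species) p q" for z
    using that
  proof (cases rule: K_rels_cases)
    case (swap n us x y vs Q)
    show ?thesis unfolding swap(2)
      by (intro fvec.subspace_diff fvec.subspace_scale subspace_K generator_in_space swap(1) generator_swap)
  next
    case (permute n xs Q \<sigma>)
    show ?thesis unfolding permute(3)
      by (intro fvec.subspace_diff fvec.subspace_scale subspace_K generator_in_space permute(1)
        generator_permute(1)[OF permute(1,2)])
  qed
  then show ?thesis unfolding K_relations_def
    by (intro fvec.span_minimal subspace_K) blast
qed

lemma orientation_map_sorted:
  assumes "distinct rs" "inj_on \<phi> (set rs)"
  shows "(orientation (map \<phi> (sorted_list_of_set (set rs))) :: 'k::field) = orientation (map \<phi> rs) * orientation rs"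
proof -
  have m: "mset (sorted_list_of_set (set rs)) = mset rs"
    using assms(1) by (simp add: set_eq_iff_mset_eq_distinct[symmetric])
  have "(orientation (map \<phi> (sorted_list_of_set (set rs))) * orientation (map \<phi> rs) :: 'k) = orientation rs"
    using orientation_map_mult[OF m, of \<phi>, where ?'k = 'k] assms by simp
  then have "(orientation (map \<phi> (sorted_list_of_set (set rs))) * orientation (map \<phi> rs) * orientation (map \<phi> rs) :: 'k)
      = orientation rs * orientation (map \<phi> rs)" by simp
  then show ?thesis by (simp add: mult.assoc mult.commute)
qed

lemma psi_generator:
  "psi p q (bas (n, xs, Q)) = fscale (root_factor p * white_factor q * orientation (list_roots xs))
    (alt (graph_union xs) (set (list_roots xs)) Q)"
  by (simp add: psi_def forest_elt_def)

text \<open>Swapping two components changes the orientation of the roots by the Koszul sign. Under a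
  relabelling, \<open>alt_map\<close> produces one sign for the roots, which turns their orientation
  into that of the relabelled list, and one for the white vertices, which is the sign in the
  coinvariance relation.\<close>

lemma psi_relations:
  assumes "z \<in> (K_relations red p q :: (_ \<Rightarrow>\<^sub>0 'k::field_char_0) set)"
  shows "psi p q z = 0"
proof (rule linmap_eq_on_span[OF linmap_psi _ _ assms[unfolded K_relations_def], where g = "\<lambda>_. 0"])
  show "linmap (\<lambda>_ :: nat \<times> nat tree_or_cycle list \<times> nat set \<Rightarrow>\<^sub>0 'k. 0 :: forest_class \<Rightarrow>\<^sub>0 'k)"
    by (rule linmapI) auto
  fix z :: "nat \<times> nat tree_or_cycle list \<times> nat set \<Rightarrow>\<^sub>0 'k"
  assume "z \<in> K_rels (ce red :: (_, _, 'k) dg_species) p q"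
  then show "psi p q z = 0"
  proof (cases rule: K_rels_cases)
    case (swap n us x y vs Q)
    let ?s = "parity_sign (susp_deg (tree_lie red :: (nat, _, 'k) dg_lie) x * susp_deg (tree_lie red :: (nat, _, 'k) dg_lie) y) :: 'k"
    have d: "distinct (list_roots (us @ x # y # vs))"
      by (rule configurationD(4)[OF generator_configuration[OF swap(1)]])
    have s: "?s * ?s = 1" by (simp add: parity_sign_def)
    have "psi p q (fscale ?s (bas (n, us @ y # x # vs, Q))) = psi p q (bas (n, us @ x # y # vs, Q) :: _ \<Rightarrow>\<^sub>0 'k)"
      unfolding module_hom.scale[OF linmap_psi] psi_generator generator_swap(2,3)[OF swap(1)]
        orientation_list_roots_swap[OF d, of red]
      using s by (simp add: mult_ac)
    then show ?thesis unfolding swap(2) by (simp add: module_hom.diff[OF linmap_psi])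
  next
    case (permute n xs Q \<sigma>)
    note g = permute(1)
    have xs: "configuration red xs" and Q: "Q \<subseteq> verts (graph_union xs)"
      using g by (auto simp: generator_def)
    have fQ: "finite Q" using g by (auto simp: generator_def intro: finite_subset)
    have inj: "inj_on \<sigma> A" for A using permutes_inj_on[OF permute(2)] .
    have e: "(orientation (map \<sigma> (sorted_list_of_set (set (list_roots xs)))) :: 'k)
        = orientation (map \<sigma> (list_roots xs)) * orientation (list_roots xs)"
      by (rule orientation_map_sorted[OF configurationD(4)[OF xs] inj])
    have "psi p q (bas (n, xs, Q) :: _ \<Rightarrow>\<^sub>0 'k) = fscale (root_factor p * white_factor q)
      (fscale (orientation (list_roots xs) * (orientation (map \<sigma> (list_roots xs)) * orientation (list_roots xs))
          * white_sign \<sigma> Q)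
      (alt (map_digraph \<sigma> (graph_union xs)) (\<sigma> ` set (list_roots xs)) (\<sigma> ` Q)))"
      unfolding psi_generator alt_map[OF configuration_wf_alt[OF xs Q] inj] e
        white_sign_eq_orientation[OF fQ, symmetric] by (simp add: mult_ac)
    moreover have "orientation (list_roots xs) * (orientation (map \<sigma> (list_roots xs)) * orientation (list_roots xs))
        = (orientation (map \<sigma> (list_roots xs)) :: 'k)" by (simp add: mult.left_commute)
    moreover have "psi p q (fscale (white_sign \<sigma> Q) (bas (n, map (toc_map \<sigma>) xs, \<sigma> ` Q)))
      = fscale (root_factor p * white_factor q) (fscale (orientation (map \<sigma> (list_roots xs)) * white_sign \<sigma> Q)
      (alt (map_digraph \<sigma> (graph_union xs)) (\<sigma> ` set (list_roots xs)) (\<sigma> ` Q) :: _ \<Rightarrow>\<^sub>0 'k))"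
      unfolding module_hom.scale[OF linmap_psi] psi_generator generator_permute(2,3)[OF permute(1,2)]
      by (simp add: mult_ac)
    ultimately show ?thesis unfolding permute(3) by (simp only: module_hom.diff[OF linmap_psi] diff_self)
  qed
qed

text \<open>Weighted by its orientation, a generator does not depend on the order of its components
  modulo the relations: each adjacent swap changes the orientation by just the sign in the
  corresponding relation.\<close>

lemma reorder_relation:
  assumes g: "generator red p q n xs Q" and m: "mset xs = mset ys"
  shows "fscale (orientation (list_roots xs)) (bas (n, xs, Q)) - fscale (orientation (list_roots ys)) (bas (n, ys, Q))
    \<in> (K_relations red p q :: (_ \<Rightarrow>\<^sub>0 'k::field_char_0) set)"
  using m
proof (induction rule: mset_swap_induct)
  case refl
  show ?case by (simp add: fvec.subspace_0[OF subspace_K(2)])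
next
  case (swap us x y vs)
  let ?b = "\<lambda>xs. bas (n, xs, Q) :: _ \<Rightarrow>\<^sub>0 'k" and ?o = "\<lambda>xs. orientation (list_roots xs) :: 'k"
  let ?u = "us @ x # y # vs" and ?w = "us @ y # x # vs"
  let ?s = "parity_sign (susp_deg (tree_lie red :: (nat, _, 'k) dg_lie) x * susp_deg (tree_lie red :: (nat, _, 'k) dg_lie) y) :: 'k"
  have "distinct xs" by (rule configurationD(3)[OF generator_configuration[OF g]])
  then have u: "generator red p q n ?u Q"
    using swap.hyps by (intro generator_reorder(1)[OF g]) (metis mset_eq_setD, metis mset_eq_imp_distinct_iff)
  then have d: "distinct (list_roots ?u)" by (intro configurationD(4) generator_configuration)
  have "?b ?u - fscale ?s (?b ?w) \<in> K_relations red p q"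
    unfolding K_relations_def by (rule fvec.span_base[OF swap_relation[OF u]])
  then have "fscale (?o ?u) (?b ?u - fscale ?s (?b ?w)) \<in> K_relations red p q"
    by (rule fvec.subspace_scale[OF subspace_K(2)])
  moreover have "fscale (?o ?u) (?b ?u - fscale ?s (?b ?w)) = fscale (?o ?u) (?b ?u) - fscale (?o ?w) (?b ?w)"
    unfolding orientation_list_roots_swap[OF d, of red]
    by (simp add: fvec.scale_right_diff_distrib mult.commute)
  ultimately have "fscale (?o ?u) (?b ?u) - fscale (?o ?w) (?b ?w) \<in> K_relations red p q" by simp
  from fvec.subspace_add[OF subspace_K(2) swap.IH this] show ?case by simp
qed

section \<open>The isomorphisms\<close>

text \<open>A presentation of the class \<open>c\<close> by a digraph on \<open>{1..n}\<close> that
  is cut into components. The orders \<open>rs\<close> and \<open>ws\<close> are those of the class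
  and need not agree with the order of \<open>xs\<close> or of the labels.\<close>

fun datum :: "bool \<Rightarrow> nat \<Rightarrow> nat \<Rightarrow> forest_class \<Rightarrow> nat \<times> nat tree_or_cycle list \<times> nat list \<times> nat list \<Rightarrow> bool"
  where "datum red p q c (n, xs, rs, ws) \<longleftrightarrow> generator red p q n xs (set ws) \<and> distinct rs \<and>
    set rs = set (list_roots xs) \<and> distinct ws \<and> c = cls (graph_union xs) rs ws"

text \<open>The first two orientations sort the roots and white vertices of the class, and the third
  compensates the one in \<open>forest_elt\<close>. Up to the degree factors this is what an inverse
  of \<open>psi\<close> must assign to the class.\<close>

fun datum_value :: "nat \<times> nat tree_or_cycle list \<times> nat list \<times> nat list
    \<Rightarrow> (nat \<times> nat tree_or_cycle list \<times> nat set \<Rightarrow>\<^sub>0 'k::field_char_0)"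
  where "datum_value (n, xs, rs, ws) =
    fscale (orientation rs * orientation ws * orientation (list_roots xs)) (bas (n, xs, set ws))"

lemma datum_wf: "datum red p q c (n, xs, rs, ws) \<Longrightarrow> wf_data (graph_union xs) rs ws"
  using configuration_graph(1,2) by (intro functional_wf_data) (auto simp: generator_def simp del: graph_union_simps)

text \<open>Two presentations of one class differ by an isomorphism, hence by a permutation of the
  same set of labels, and by the order of the components. The coinvariance relations account for the
  former and the swap relations for the latter.\<close>

lemma datum_value_unique:
  assumes d: "datum red p q c d" and d': "datum red p q c d'"
  shows "datum_value d - datum_value d' \<in> (K_relations red p q :: (_ \<Rightarrow>\<^sub>0 'k::field_char_0) set)"
proof -
  obtain n xs rs ws where [simp]: "d = (n, xs, rs, ws)" by (cases d)
  obtain n' xs' rs' ws' where [simp]: "d' = (n', xs', rs', ws')" by (cases d')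
  let ?Q = "set ws" and ?G = "graph_union xs"
  have g: "generator red p q n xs ?Q" and rs: "distinct rs" "set rs = set (list_roots xs)" "distinct ws"
    and c: "c = cls ?G rs ws" using d by auto
  have g': "generator red p q n' xs' (set ws')" and c': "c = cls (graph_union xs') rs' ws'"
    using d' by auto
  note xs = generator_configuration[OF g] and xs' = generator_configuration[OF g']
  have V: "verts ?G = {1..n}" "verts (graph_union xs') = {1..n'}" "?Q \<subseteq> {1..n}"
    using g g' by (simp_all only: generator_def)
  have wf: "wf_data ?G rs ws" by (rule datum_wf[of red p q c n]) (use d in simp)
  have "forest_iso \<lparr>graph = ?G, roots = rs, whites = ws\<rparr> \<lparr>graph = graph_union xs', roots = rs', whites = ws'\<rparr>"
    using c c' wf by (simp add: forest_class_eq_iff[symmetric])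
  then obtain \<phi> where \<phi>: "inj_on \<phi> (verts ?G)" "graph_union xs' = map_digraph \<phi> ?G"
    "rs' = map \<phi> rs" "ws' = map \<phi> ws" by (auto simp: forest_iso_def simp del: graph_union_simps)
  have im: "\<phi> ` {1..n} = {1..n'}" using \<phi>(2) V by (metis verts_map_digraph)
  then have n: "n' = n" using card_image[OF \<phi>(1)] unfolding V(1) by simp
  \<comment> \<open>The isomorphism is only controlled on the vertices; extending it by the identity
    gives a permutation in the sense of \<open>permutes\<close>.\<close>
  define \<sigma> where "\<sigma> i = (if i \<in> {1..n} then \<phi> i else i)" for i
  have "bij_betw \<phi> {1..n} {1..n}" using im \<phi>(1) unfolding V(1) n by (simp add: bij_betw_def)
  then have "bij_betw \<sigma> {1..n} {1..n}" by (rule iffD1[OF bij_betw_cong, rotated]) (simp add: \<sigma>_def)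
  then have \<sigma>: "\<sigma> permutes {1..n}" by (rule bij_imp_permutes) (auto simp: \<sigma>_def)
  have \<sigma>\<phi>: "\<phi> v = \<sigma> v" if "v \<in> verts ?G" for v using that unfolding V(1) by (simp add: \<sigma>_def)
  have E: "edges ?G \<subseteq> verts ?G \<times> verts ?G" and sub: "set rs \<subseteq> verts ?G" "set ws \<subseteq> verts ?G"
    using wf by (simp_all add: wf_data_def finite_digraph_def del: graph_union_simps)
  have iso: "graph_union xs' = map_digraph \<sigma> ?G" "rs' = map \<sigma> rs" "ws' = map \<sigma> ws"
    using \<phi> map_digraph_cong[OF E \<sigma>\<phi>] sub \<sigma>\<phi> by (auto simp del: graph_union_simps)
  let ?ys = "map (toc_map \<sigma>) xs"
  note ys = generator_permute[OF g \<sigma>]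
  have inj: "inj_on \<sigma> A" for A using permutes_inj_on[OF \<sigma>] .
  have "set xs' = set ?ys"
    using configuration_unique[OF xs' generator_configuration[OF ys(1)]] iso(1) ys(2) by simp
  then have m: "mset ?ys = mset xs'"
    using set_eq_iff_mset_eq_distinct[OF configurationD(3)[OF xs']
      configurationD(3)[OF generator_configuration[OF ys(1)]]] by (simp only:)
  let ?o = "orientation :: nat list \<Rightarrow> 'k"
  \<comment> \<open>With \<open>o2\<close>, the sign bookkeeping that makes the intermediate terms
    cancel: relabelling changes the two orders of the roots by the same relative sign, and the white
    sign relates \<open>ws\<close> to its image.\<close>
  have o1: "?o rs * ?o (list_roots xs) = ?o (map \<sigma> rs) * ?o (map \<sigma> (list_roots xs))"
  proof -
    have "mset rs = mset (list_roots xs)"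
      using rs configurationD(4)[OF xs] by (simp add: set_eq_iff_mset_eq_distinct)
    then show ?thesis using orientation_map_mult[of rs "list_roots xs" \<sigma>, where ?'k = 'k] rs(1) inj by simp
  qed
  have o2: "?o ws * white_sign \<sigma> ?Q = ?o (map \<sigma> ws)"
    unfolding white_sign_eq_orientation[OF finite_set] orientation_map_sorted[OF rs(3) inj]
    by (simp add: mult.left_commute)
  have 1: "bas (n, xs, ?Q) - fscale (white_sign \<sigma> ?Q) (bas (n, ?ys, \<sigma> ` ?Q)) \<in> (K_relations red p q :: (_ \<Rightarrow>\<^sub>0 'k) set)"
    unfolding K_relations_def by (rule fvec.span_base[OF permute_relation[OF g \<sigma>]])
  have 2: "fscale (?o (list_roots ?ys)) (bas (n, ?ys, \<sigma> ` ?Q)) - fscale (?o (list_roots xs')) (bas (n, xs', \<sigma> ` ?Q))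
      \<in> K_relations red p q"
    by (rule reorder_relation[OF ys(1) m])
  have "datum_value d - datum_value d'
    = fscale (?o rs * ?o ws * ?o (list_roots xs)) (bas (n, xs, ?Q) - fscale (white_sign \<sigma> ?Q) (bas (n, ?ys, \<sigma> ` ?Q)))
    + fscale (?o (map \<sigma> rs) * ?o (map \<sigma> ws)) (fscale (?o (list_roots ?ys)) (bas (n, ?ys, \<sigma> ` ?Q))
        - fscale (?o (list_roots xs')) (bas (n, xs', \<sigma> ` ?Q)))"
  proof -
    have "?o rs * ?o ws * ?o (list_roots xs) * white_sign \<sigma> ?Q = ?o (map \<sigma> rs) * ?o (map \<sigma> ws) * ?o (list_roots ?ys)"
      unfolding ys(3) o2[symmetric] using o1 by (simp add: mult_ac)
    then have "fscale (?o rs * ?o ws * ?o (list_roots xs)) (fscale (white_sign \<sigma> ?Q) (bas (n, ?ys, \<sigma> ` ?Q)))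
        = fscale (?o (map \<sigma> rs) * ?o (map \<sigma> ws)) (fscale (?o (list_roots ?ys)) (bas (n, ?ys, \<sigma> ` ?Q)))"
      by (simp add: mult_ac)
    then show ?thesis by (auto simp: iso(2,3) n fvec.scale_right_diff_distrib)
  qed
  then show ?thesis
    using fvec.subspace_add[OF subspace_K(2) fvec.subspace_scale[OF subspace_K(2) 1] fvec.subspace_scale[OF subspace_K(2) 2]]
    by simp
qed

text \<open>The inverse of \<open>psi\<close> modulo the relations.  A class of a forest with a loop has no datum if
  \<open>red\<close> holds, so that \<open>theta\<close> kills the loop forests.\<close>

definition theta :: "bool \<Rightarrow> nat \<Rightarrow> nat \<Rightarrow> forest_class
    \<Rightarrow> (nat \<times> nat tree_or_cycle list \<times> nat set \<Rightarrow>\<^sub>0 'k::field_char_0)"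
  where "theta red p q c = (if \<exists>d. datum red p q c d
    then fscale (1 / (root_factor p * white_factor q)) (datum_value (SOME d. datum red p q c d)) else 0)"

lemma theta_datum:
  assumes "datum red p q c d"
  shows "theta red p q c - fscale (1 / (root_factor p * white_factor q)) (datum_value d)
    \<in> (K_relations red p q :: (_ \<Rightarrow>\<^sub>0 'k::field_char_0) set)"
proof -
  have "datum red p q c (SOME d. datum red p q c d)" using assms by (rule someI)
  then have "datum_value (SOME d. datum red p q c d) - datum_value d \<in> (K_relations red p q :: (_ \<Rightarrow>\<^sub>0 'k) set)"
    using assms by (rule datum_value_unique)
  then have "fscale (1 / (root_factor p * white_factor q)) (datum_value (SOME d. datum red p q c d) - datum_value d)
      \<in> (K_relations red p q :: (_ \<Rightarrow>\<^sub>0 'k) set)"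
    by (rule fvec.subspace_scale[OF subspace_K(2)])
  moreover have "theta red p q c = (fscale (1 / (root_factor p * white_factor q))
      (datum_value (SOME d. datum red p q c d)) :: _ \<Rightarrow>\<^sub>0 'k)"
    unfolding theta_def by (rule if_P) (rule exI[of _ d], rule assms)
  ultimately show ?thesis by (simp only: fvec.scale_right_diff_distrib)
qed

text \<open>The maps prescribed on classes, such as \<open>theta\<close>, can be evaluated on an
  antisymmetrised forest only after it has been expanded in the basis of classes.\<close>

lemma alt_expand:
  assumes "wf_alt G R Q" "card R = p" "card Q = q"
  shows "(alt G R Q :: _ \<Rightarrow>\<^sub>0 'k::field_char_0) = fscale (1 / (fact p * fact q))
    (\<Sum>\<tau> | \<tau> permutes {..<q}. \<Sum>\<sigma> | \<sigma> permutes {..<p}. fscale (of_int (sign \<sigma>) * of_int (sign \<tau>))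
      (bas (cls G (permute_list \<sigma> (sorted_list_of_set R)) (permute_list \<tau> (sorted_list_of_set Q)))))"
proof -
  let ?rs = "sorted_list_of_set R" and ?ws = "sorted_list_of_set Q"
  note wf = wf_data_sorted[OF assms(1)]
  have len: "length ?rs = p" "length ?ws = q" using assms by simp_all
  have "alt G R Q = skew_trees p (fscale (1 / fact q)
      (\<Sum>\<tau> | \<tau> permutes {..<q}. fscale (of_int (sign \<tau>)) (bas (cls G ?rs (permute_list \<tau> ?ws)))))"
    unfolding alt_def assms(2,3) skew_whites_cls[OF wf len(2)] ..
  also have "\<dots> = fscale (1 / fact q) (\<Sum>\<tau> | \<tau> permutes {..<q}. fscale (of_int (sign \<tau>))
      (skew_trees p (bas (cls G ?rs (permute_list \<tau> ?ws)))))"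
    by (simp only: module_hom.scale[OF linmap_skew_trees] module_hom.sum[OF linmap_skew_trees])
  also have "(\<Sum>\<tau> | \<tau> permutes {..<q}. fscale (of_int (sign \<tau>))
      (skew_trees p (bas (cls G ?rs (permute_list \<tau> ?ws)))))
    = (\<Sum>\<tau> | \<tau> permutes {..<q}. fscale (1 / fact p) (\<Sum>\<sigma> | \<sigma> permutes {..<p}.
        fscale (of_int (sign \<sigma>) * of_int (sign \<tau>)) (bas (cls G (permute_list \<sigma> ?rs) (permute_list \<tau> ?ws)) :: _ \<Rightarrow>\<^sub>0 'k)))"
  proof (rule sum.cong[OF refl])
    fix \<tau> assume "\<tau> \<in> {\<tau>. \<tau> permutes {..<q}}"
    then have w: "wf_data G ?rs (permute_list \<tau> ?ws)" using wf wf_permute(2)[of \<tau> ?ws] len by simp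
    show "fscale (of_int (sign \<tau>)) (skew_trees p (bas (cls G ?rs (permute_list \<tau> ?ws))))
      = fscale (1 / fact p) (\<Sum>\<sigma> | \<sigma> permutes {..<p}.
        fscale (of_int (sign \<sigma>) * of_int (sign \<tau>)) (bas (cls G (permute_list \<sigma> ?rs) (permute_list \<tau> ?ws)) :: _ \<Rightarrow>\<^sub>0 'k))"
      unfolding skew_trees_cls[OF w len(1)] by (simp add: fvec.scale_sum_right mult_ac)
  qed
  finally show ?thesis by (simp add: fvec.scale_sum_right mult_ac)
qed

text \<open>Modulo the relations, \<open>theta\<close> sends all \<open>p! q!\<close> classes in the
  expansion to signed multiples of the original generator. The signs square to one, the number of
  terms cancels the normalisation, and the degree factors and orientations cancel as well.\<close>

lemma lin_theta_psi:
  assumes g: "generator red p q n xs Q"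
  shows "lin (theta red p q) (psi p q (bas (n, xs, Q))) - bas (n, xs, Q)
    \<in> (K_relations red p q :: (_ \<Rightarrow>\<^sub>0 'k::field_char_0) set)"
proof -
  let ?G = "graph_union xs" and ?R = "set (list_roots xs)"
  let ?rs = "sorted_list_of_set ?R" and ?ws = "sorted_list_of_set Q"
  let ?B = "bas (n, xs, Q) :: _ \<Rightarrow>\<^sub>0 'k"
  let ?c = "root_factor p * white_factor q :: 'k" and ?o = "orientation (list_roots xs) :: 'k"
  let ?P = "\<lambda>n. {\<sigma>. \<sigma> permutes {..<n}}"
  let ?cls = "\<lambda>\<sigma> \<tau>. cls ?G (permute_list \<sigma> ?rs) (permute_list \<tau> ?ws)"
  define s :: "(nat \<Rightarrow> nat) \<Rightarrow> (nat \<Rightarrow> nat) \<Rightarrow> 'k" where "s \<sigma> \<tau> = of_int (sign \<sigma>) * of_int (sign \<tau>)" for \<sigma> \<tau>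
  have ss: "s \<sigma> \<tau> * s \<sigma> \<tau> = 1" for \<sigma> \<tau> unfolding s_def by (simp flip: of_int_mult add: mult_ac)
  note xs = generator_configuration[OF g]
  have QV: "Q \<subseteq> verts ?G" "card Q = q" and len: "length (list_roots xs) = p"
    using g by (simp_all only: generator_def)
  have fQ: "finite Q" using g finite_subset unfolding generator_def by blast
  have cR: "card ?R = p" using distinct_card[OF configurationD(4)[OF xs]] len by simp
  have c0: "?c \<noteq> 0" by (simp add: factor_nonzero)
  let ?T = "lin (theta red p q) :: _ \<Rightarrow> _ \<Rightarrow>\<^sub>0 'k"
  let ?k = "1 / (fact p * fact q) :: 'k"
  have T: "?T (psi p q ?B) = fscale (?c * ?o) (fscale ?k
      (\<Sum>\<tau>\<in>?P q. \<Sum>\<sigma>\<in>?P p. fscale (s \<sigma> \<tau>) (theta red p q (?cls \<sigma> \<tau>))))"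
    unfolding psi_generator alt_expand[OF configuration_wf_alt[OF xs QV(1)] cR QV(2)] s_def
    by (simp only: module_hom.scale[OF linmap_lin] module_hom.sum[OF linmap_lin] lin_bas)
  have "fscale ?k (\<Sum>\<tau>\<in>?P q. \<Sum>\<sigma>\<in>?P p. fscale (s \<sigma> \<tau>) (fscale (s \<sigma> \<tau>) ?B)) = ?B"
  proof -
    have "card (?P p) = fact p" "card (?P q) = fact q"
      by (simp_all add: card_permutations[of "{..<p}" p] card_permutations[of "{..<q}" q])
    then show ?thesis by (simp add: ss fvec.sum_constant_scale)
  qed
  moreover have "fscale (?c * ?o) (fscale ?k (\<Sum>\<tau>\<in>?P q. \<Sum>\<sigma>\<in>?P p. fscale (s \<sigma> \<tau>) (fscale (s \<sigma> \<tau> * (?o / ?c)) ?B)))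
    = fscale (?c * ?o * (?o / ?c)) (fscale ?k (\<Sum>\<tau>\<in>?P q. \<Sum>\<sigma>\<in>?P p. fscale (s \<sigma> \<tau>) (fscale (s \<sigma> \<tau>) ?B)))"
    by (simp add: fvec.scale_sum_right mult_ac factor_nonzero)
  moreover have "?c * ?o * (?o / ?c) = 1" using c0 by (simp add: mult_ac)
  ultimately have B: "fscale (?c * ?o) (fscale ?k (\<Sum>\<tau>\<in>?P q. \<Sum>\<sigma>\<in>?P p. fscale (s \<sigma> \<tau>) (fscale (s \<sigma> \<tau> * (?o / ?c)) ?B))) = ?B"
    by simp
  have e: "?T (psi p q ?B) - ?B = fscale (?c * ?o) (fscale ?k
      (\<Sum>\<tau>\<in>?P q. \<Sum>\<sigma>\<in>?P p. fscale (s \<sigma> \<tau>) (theta red p q (?cls \<sigma> \<tau>) - fscale (s \<sigma> \<tau> * (?o / ?c)) ?B)))"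
    unfolding T by (subst B[symmetric]) (simp only: fvec.scale_right_diff_distrib sum_subtractf)
  have "theta red p q (?cls \<sigma> \<tau>) - fscale (s \<sigma> \<tau> * (?o / ?c)) ?B \<in> K_relations red p q"
    if "\<sigma> \<in> ?P p" "\<tau> \<in> ?P q" for \<sigma> \<tau>
  proof -
    have \<sigma>: "\<sigma> permutes {..<length ?rs}" and \<tau>: "\<tau> permutes {..<length ?ws}" using that cR QV(2) by auto
    let ?d = "(n, xs, permute_list \<sigma> ?rs, permute_list \<tau> ?ws)"
    have "datum red p q (?cls \<sigma> \<tau>) ?d" using \<sigma> \<tau> g fQ by simp
    moreover have "fscale (1 / ?c) (datum_value ?d) = fscale (s \<sigma> \<tau> * (?o / ?c)) ?B"
      using \<sigma> \<tau> fQ orientation_permute_list[OF _ \<sigma>, where ?'k = 'k] orientation_permute_list[OF _ \<tau>, where ?'k = 'k]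
      by (simp add: s_def)
    ultimately show ?thesis using theta_datum by metis
  qed
  then show ?thesis
    unfolding e by (intro fvec.subspace_scale fvec.subspace_sum subspace_K)
qed

lemma lin_theta_bad:
  assumes "y \<in> (fvec.span (alt_forests (bad red) p q) :: (_ \<Rightarrow>\<^sub>0 'k::field_char_0) set)"
  shows "lin (theta red p q) y = (0 :: _ \<Rightarrow>\<^sub>0 'k)"
proof (rule linmap_eq_on_span[OF linmap_lin _ _ assms, where g = "\<lambda>_. 0"])
  show "linmap (\<lambda>_ :: forest_class \<Rightarrow>\<^sub>0 'k. 0 :: nat \<times> nat tree_or_cycle list \<times> nat set \<Rightarrow>\<^sub>0 'k)"
    by (rule linmapI) auto
  fix y :: "forest_class \<Rightarrow>\<^sub>0 'k" assume "y \<in> alt_forests (bad red) p q"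
  then obtain G Q where y: "y = alt G (sinks G) Q" "functional_digraph G" "bad red G" "Q \<subseteq> verts G"
    "card (sinks G) = p" "card Q = q" by (auto simp: alt_forests_def)
  have "theta red p q (cls G rs ws) = (0 :: _ \<Rightarrow>\<^sub>0 'k)" for rs ws
  proof -
    have "\<not> datum red p q (cls G rs ws) d" for d
    proof
      assume d: "datum red p q (cls G rs ws) d"
      obtain n xs rs' ws' where d_eq: "d = (n, xs, rs', ws')" by (cases d)
      have g: "generator red p q n xs (set ws')" and c: "cls G rs ws = cls (graph_union xs) rs' ws'"
        and wf: "wf_data (graph_union xs) rs' ws'"
        using d datum_wf[of red p q "cls G rs ws" n xs rs' ws'] unfolding d_eq by auto
      have "forest_iso \<lparr>graph = graph_union xs, roots = rs', whites = ws'\<rparr> \<lparr>graph = G, roots = rs, whites = ws\<rparr>"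
        using c wf by (simp add: forest_class_eq_iff[symmetric])
      then obtain \<phi> where "inj_on \<phi> (verts (graph_union xs))" "G = map_digraph \<phi> (graph_union xs)"
        by (auto simp: forest_iso_def simp del: graph_union_simps)
      then have "has_loop G \<longleftrightarrow> has_loop (graph_union xs)"
        using functional_map(3)[OF configuration_graph(1)[OF generator_configuration[OF g]]] by blast
      then show False
        using y(3) configuration_graph(3)[OF generator_configuration[OF g]] by (auto simp: bad_def)
    qed
    then show ?thesis by (simp add: theta_def)
  qed
  then show "lin (theta red p q) y = (0 :: _ \<Rightarrow>\<^sub>0 'k)"
    unfolding y(1) alt_expand[OF functional_wf_alt[OF y(2,4)] y(5,6)]
    by (simp add: module_hom.scale[OF linmap_lin] module_hom.sum[OF linmap_lin])
qed

text \<open>On the span of \<open>bad\<close> forests \<open>theta\<close> vanishes exactly, whereas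
  \<open>theta\<close> after \<open>psi\<close> is the identity modulo the relations. So an
  \<open>x\<close> sent into that span is itself a relation.\<close>

lemma psi_kernel:
  assumes x: "x \<in> (K_space red p q :: (_ \<Rightarrow>\<^sub>0 'k::field_char_0) set)"
  shows "psi p q x \<in> fvec.span (alt_forests (bad red) p q) \<longleftrightarrow> x \<in> K_relations red p q"
proof
  assume "psi p q x \<in> fvec.span (alt_forests (bad red) p q)"
  then have "lin (theta red p q) (psi p q x) = (0 :: _ \<Rightarrow>\<^sub>0 'k)" by (rule lin_theta_bad)
  moreover have "lin (theta red p q) (psi p q x) - x \<in> K_relations red p q"
  proof (rule linmap_in_subspace[OF _ subspace_K(2) _ x[unfolded K_space_def span_of_def]])
    show "linmap (\<lambda>x. lin (theta red p q) (psi p q x) - x :: _ \<Rightarrow>\<^sub>0 'k)"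
      by (rule linmap_diff[OF linmap_comp[OF linmap_lin linmap_psi] linmap_ident])
  qed (elim K_space_cases, simp add: lin_theta_psi)
  ultimately have "- x \<in> K_relations red p q" by simp
  then show "x \<in> K_relations red p q" using fvec.subspace_neg[OF subspace_K(2)] by fastforce
next
  assume "x \<in> K_relations red p q"
  then show "psi p q x \<in> fvec.span (alt_forests (bad red) p q)" by (simp add: psi_relations fvec.span_zero)
qed

lemma psi_in_Omega:
  assumes x: "x \<in> (K_space red p q :: (_ \<Rightarrow>\<^sub>0 'k::field_char_0) set)"
  shows "psi p q x \<in> fvec.span (alt_forests (\<lambda>_. True) p q)"
proof (rule linmap_in_subspace[OF linmap_psi fvec.subspace_span _ x[unfolded K_space_def span_of_def]])
  fix y :: "nat \<times> nat tree_or_cycle list \<times> nat set \<Rightarrow>\<^sub>0 'k"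
  assume "y \<in> bas ` K_gens (ce red :: (_, _, 'k) dg_species) p q"
  then obtain n xs Q where y: "y = bas (n, xs, Q)" and g: "generator red p q n xs Q" by (rule K_space_cases)
  note xs = generator_configuration[OF g] and G = configuration_graph[OF generator_configuration[OF g]]
  have "card (sinks (graph_union xs)) = p"
    using g distinct_card[OF configurationD(4)[OF xs]] unfolding G(2) generator_def by simp
  then have "alt (graph_union xs) (sinks (graph_union xs)) Q \<in> alt_forests (\<lambda>_. True) p q"
    using g G(1) by (intro alt_forestsI) (simp_all only: generator_def)
  then show "psi p q y \<in> fvec.span (alt_forests (\<lambda>_. True) p q)"
    unfolding y psi_generator G(2) by (intro fvec.span_scale fvec.span_base)
qed

text \<open>A \<open>bad\<close> forest is congruent to zero. Any other is relabelled by
  \<open>{1..n}\<close> and cut into components; the image of the resulting generator is a nonzero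
  multiple of the relabelled \<open>alt\<close> element, and so can be rescaled.\<close>

lemma psi_surjective:
  assumes "y \<in> (fvec.span (alt_forests (\<lambda>_. True) p q) :: (_ \<Rightarrow>\<^sub>0 'k::field_char_0) set)"
  shows "\<exists>x\<in>K_space red p q. y - psi p q x \<in> fvec.span (alt_forests (bad red) p q)"
  using assms
proof (induction rule: fvec.span_induct_alt)
  case base
  show ?case
    by (intro bexI[of _ 0]) (simp_all add: module_hom.zero[OF linmap_psi] fvec.span_zero fvec.subspace_0[OF subspace_K(1)])
next
  case (step c y z)
  obtain x' where x': "x' \<in> K_space red p q" "z - psi p q x' \<in> fvec.span (alt_forests (bad red) p q)"
    using step.IH by blast
  obtain G Q where y: "y = alt G (sinks G) Q" "functional_digraph G" "Q \<subseteq> verts G"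
    "card (sinks G) = p" "card Q = q" using step.hyps by (auto simp: alt_forests_def)
  have "\<exists>x\<in>K_space red p q. y - psi p q x \<in> fvec.span (alt_forests (bad red) p q)"
  proof (cases "bad red G")
    case True
    then have "y \<in> alt_forests (bad red) p q" unfolding y(1) using y by (intro alt_forestsI)
    then show ?thesis
      by (intro bexI[of _ 0])
         (simp_all add: module_hom.zero[OF linmap_psi] fvec.span_base fvec.subspace_0[OF subspace_K(1)])
  next
    case False
    have "finite (verts G)" using functional_finite[OF y(2)] by simp
    then obtain h where h: "bij_betw h {1..card (verts G)} (verts G)" using ex_bij_betw_nat_finite_1 by blast
    define \<phi> where "\<phi> = inv_into {1..card (verts G)} h"
    have "bij_betw \<phi> (verts G) {1..card (verts G)}" unfolding \<phi>_def by (rule bij_betw_inv_into[OF h])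
    then have inj: "inj_on \<phi> (verts G)" and im: "\<phi> ` verts G = {1..card (verts G)}"
      by (simp_all add: bij_betw_def)
    let ?H = "map_digraph \<phi> G"
    note H = functional_map[OF y(2) inj]
    have "red \<longrightarrow> \<not> has_loop ?H" using False H(3) by (simp add: bad_def)
    then obtain xs where xs: "configuration red xs" "graph_union xs = ?H" using configuration_exists[OF H(1)] by blast
    have R: "set (list_roots xs) = \<phi> ` sinks G" using configuration_graph(2)[OF xs(1)] xs(2) H(2) by simp
    have sub: "sinks G \<subseteq> verts G" by (auto simp: sinks_def)
    have "length (list_roots xs) = p"
      using distinct_card[OF configurationD(4)[OF xs(1)]] R card_image[OF inj_on_subset[OF inj sub]] y(4) by simp
    moreover have "card (\<phi> ` Q) = q" using card_image[OF inj_on_subset[OF inj y(3)]] y(5) by simp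
    ultimately have "generator red p q (card (verts G)) xs (\<phi> ` Q)"
      unfolding generator_def xs(2) verts_map_digraph im[symmetric] using xs(1) y(3) by blast
    note B = generator_in_space[OF this]
    let ?b = "bas (card (verts G), xs, \<phi> ` Q) :: _ \<Rightarrow>\<^sub>0 'k"
    let ?e = "root_factor p * white_factor q * orientation (list_roots xs) :: 'k"
    obtain k :: 'k where k: "y = fscale k (alt ?H (\<phi> ` sinks G) (\<phi> ` Q))"
      using alt_map[OF functional_wf_alt[OF y(2,3)] inj] unfolding y(1) by blast
    have "?e \<noteq> 0" by (simp add: factor_nonzero)
    then have "psi p q (fscale (k / ?e) ?b) = y"
      unfolding module_hom.scale[OF linmap_psi] psi_generator xs(2) R k by simp
    moreover have "fscale (k / ?e) ?b \<in> K_space red p q" by (rule fvec.subspace_scale[OF subspace_K(1) B])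
    ultimately show ?thesis by (intro bexI[of _ "fscale (k / ?e) ?b"]) (simp_all add: fvec.span_zero)
  qed
  then obtain x where x: "x \<in> K_space red p q" "y - psi p q x \<in> fvec.span (alt_forests (bad red) p q)" by blast
  have "fscale c y + z - psi p q (fscale c x + x') = fscale c (y - psi p q x) + (z - psi p q x')"
    by (simp add: module_hom.add[OF linmap_psi] module_hom.scale[OF linmap_psi] fvec.scale_right_diff_distrib)
  also have "\<dots> \<in> fvec.span (alt_forests (bad red) p q)"
    using x x' by (intro fvec.span_add fvec.span_scale)
  finally have "fscale c y + z - psi p q (fscale c x + x') \<in> fvec.span (alt_forests (bad red) p q)" .
  moreover have "fscale c x + x' \<in> K_space red p q"
    using x x' by (intro fvec.subspace_add fvec.subspace_scale subspace_K)
  ultimately show ?case by blast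
qed

definition K_horizontal :: "bool \<Rightarrow> (nat \<times> nat tree_or_cycle list \<times> nat set \<Rightarrow>\<^sub>0 'k)
    \<Rightarrow> (nat \<times> nat tree_or_cycle list \<times> nat set \<Rightarrow>\<^sub>0 'k::field_char_0)"
  where "K_horizontal red = lin (\<lambda>(n, x, Q). lin (\<lambda>y. bas (n, y, Q)) (ce_differential (tree_lie red) x))"

lemma composite_K_eq:
  "composite_K (ce red :: (_, _, 'k::field_char_0) dg_species) = quotient_bicomplex
    (free_bicomplex (K_space red) (\<lambda>p q. K_horizontal red) (\<lambda>p q. lin K_diff)) (K_relations red)"
proof -
  have "diff (ce red :: (_, _, 'k) dg_species) = ce_differential (tree_lie red)"
    by (simp add: chevalley_eilenberg_def)
  then show ?thesis
    by (simp add: composite_K_def K_space_def[abs_def] K_relations_def[abs_def] K_horizontal_def)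
qed

lemma K_horizontal_in:
  assumes x: "x \<in> (K_space red (Suc p) q :: (_ \<Rightarrow>\<^sub>0 'k::field_char_0) set)"
  shows "K_horizontal red x \<in> K_space red p q"
    and "psi p q (K_horizontal red x) - horizontal (psi (Suc p) q x) \<in> fvec.span (alt_forests (bad red) p q)"
proof -
  have lin: "linmap (K_horizontal red :: _ \<Rightarrow> _ \<Rightarrow>\<^sub>0 'k)" unfolding K_horizontal_def by (rule linmap_lin)
  have gen: "K_horizontal red (bas (n, xs, Q)) = (lin (\<lambda>ys. bas (n, ys, Q)) (ce_differential (tree_lie red) xs) :: _ \<Rightarrow>\<^sub>0 'k)"
    for n xs Q by (simp add: K_horizontal_def)
  show "K_horizontal red x \<in> K_space red p q"
  proof (rule linmap_in_subspace[OF lin subspace_K(1) _ x[unfolded K_space_def span_of_def]])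
    fix y :: "nat \<times> nat tree_or_cycle list \<times> nat set \<Rightarrow>\<^sub>0 'k"
    assume "y \<in> bas ` K_gens (ce red :: (_, _, 'k) dg_species) (Suc p) q"
    then obtain n xs Q where y: "y = bas (n, xs, Q)" "generator red (Suc p) q n xs Q" by (rule K_space_cases)
    then show "K_horizontal red y \<in> K_space red p q"
      unfolding y(1) gen K_space_def by (intro ce_differential_in) (simp only: K_gens_generator)
  qed
  show "psi p q (K_horizontal red x) - horizontal (psi (Suc p) q x) \<in> fvec.span (alt_forests (bad red) p q)"
  proof (rule linmap_in_subspace[OF _ fvec.subspace_span _ x[unfolded K_space_def span_of_def]])
    show "linmap (\<lambda>x. psi p q (K_horizontal red x) - horizontal (psi (Suc p) q x) :: _ \<Rightarrow>\<^sub>0 'k)"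
      by (rule linmap_diff[OF linmap_comp[OF linmap_psi lin] linmap_comp[OF linmap_horizontal linmap_psi]])
    fix y :: "nat \<times> nat tree_or_cycle list \<times> nat set \<Rightarrow>\<^sub>0 'k"
    assume "y \<in> bas ` K_gens (ce red :: (_, _, 'k) dg_species) (Suc p) q"
    then obtain n xs Q where y: "y = bas (n, xs, Q)" "generator red (Suc p) q n xs Q" by (rule K_space_cases)
    then show "psi p q (K_horizontal red y) - horizontal (psi (Suc p) q y) \<in> fvec.span (alt_forests (bad red) p q)"
      unfolding y(1) gen by (intro psi_ce_differential) (simp only: K_gens_generator)
  qed
qed

lemma K_vertical_in:
  assumes x: "x \<in> (K_space red p q :: (_ \<Rightarrow>\<^sub>0 'k::field_char_0) set)"
  shows "lin K_diff x \<in> (K_space red p (Suc q) :: (_ \<Rightarrow>\<^sub>0 'k) set)"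
    and "psi p (Suc q) (lin K_diff x) = skew_whites (Suc q) (whiten (psi p q x))"
proof -
  show "lin K_diff x \<in> (K_space red p (Suc q) :: (_ \<Rightarrow>\<^sub>0 'k) set)"
  proof (rule linmap_in_subspace[OF linmap_lin subspace_K(1) _ x[unfolded K_space_def span_of_def]])
    fix y :: "nat \<times> nat tree_or_cycle list \<times> nat set \<Rightarrow>\<^sub>0 'k"
    assume "y \<in> bas ` K_gens (ce red :: (_, _, 'k) dg_species) p q"
    then obtain n xs Q where y: "y = bas (n, xs, Q)" "generator red p q n xs Q" by (rule K_space_cases)
    then show "lin K_diff y \<in> K_space red p (Suc q)"
      unfolding y(1) lin_bas K_space_def by (intro K_diff_in) (simp only: K_gens_generator)
  qed
  show "psi p (Suc q) (lin K_diff x) = skew_whites (Suc q) (whiten (psi p q x))"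
  proof (rule linmap_eq_on_span[OF linmap_comp[OF linmap_psi linmap_lin]
      linmap_comp[OF linmap_comp[OF linmap_skew_whites linmap_whiten] linmap_psi] _ x[unfolded K_space_def span_of_def]])
    fix y :: "nat \<times> nat tree_or_cycle list \<times> nat set \<Rightarrow>\<^sub>0 'k"
    assume "y \<in> bas ` K_gens (ce red :: (_, _, 'k) dg_species) p q"
    then obtain n xs Q where y: "y = bas (n, xs, Q)" "generator red p q n xs Q" by (rule K_space_cases)
    then show "psi p (Suc q) (lin K_diff y) = skew_whites (Suc q) (whiten (psi p q y))"
      unfolding y(1) lin_bas by (intro psi_K_diff) (simp only: K_gens_generator)
  qed
qed

lemma aromatic_isomorphic:
  "(aromatic_bicomplex :: (_, 'k::field_char_0) bicomplex) \<cong>\<^sub>b composite_K (ce False)"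
  unfolding composite_K_eq
proof (rule quotient_isomorphic[where \<Psi> = psi])
  \<comment> \<open>Nothing is divided out here, so every congruence about \<open>psi\<close>
    becomes an equality.\<close>
  have bad: "fvec.span (alt_forests (bad False) p q) = ({0} :: (forest_class \<Rightarrow>\<^sub>0 'k) set)" for p q
    by (simp add: alt_forests_def bad_def)
  have carr: "carr aromatic_bicomplex p q = (fvec.span (alt_forests (\<lambda>_. True) p q) :: (forest_class \<Rightarrow>\<^sub>0 'k) set)"
    and add: "add aromatic_bicomplex p q = ((+) :: (forest_class \<Rightarrow>\<^sub>0 'k) \<Rightarrow> _)"
    and scl: "scl aromatic_bicomplex p q = (fscale :: 'k \<Rightarrow> (forest_class \<Rightarrow>\<^sub>0 'k) \<Rightarrow> _)"
    and dh: "dh aromatic_bicomplex p q = (horizontal :: (forest_class \<Rightarrow>\<^sub>0 'k) \<Rightarrow> _)"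
    and dv: "dv aromatic_bicomplex p q = (\<lambda>x :: forest_class \<Rightarrow>\<^sub>0 'k. skew_whites (Suc q) (whiten x))" for p q
    by (simp_all add: aromatic_bicomplex_def free_bicomplex_def Omega_eq)
  fix p q and x y :: "nat \<times> nat tree_or_cycle list \<times> nat set \<Rightarrow>\<^sub>0 'k" and c :: 'k
  show "psi p q x \<in> carr aromatic_bicomplex p q" if "x \<in> K_space False p q"
    unfolding carr by (rule psi_in_Omega[OF that])
  show "psi p q (x + y) = add aromatic_bicomplex p q (psi p q x) (psi p q y)"
    unfolding add by (rule module_hom.add[OF linmap_psi])
  show "psi p q (fscale c x) = scl aromatic_bicomplex p q c (psi p q x)"
    unfolding scl by (rule module_hom.scale[OF linmap_psi])
  show "\<exists>x\<in>K_space False p q. z = psi p q x" if "z \<in> carr aromatic_bicomplex p q" for z :: "forest_class \<Rightarrow>\<^sub>0 'k"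
    using psi_surjective[OF that[unfolded carr], of False] unfolding bad by auto
  show "psi p q x = psi p q y \<longleftrightarrow> x - y \<in> K_relations False p q" if "x \<in> K_space False p q" "y \<in> K_space False p q"
    using psi_kernel[OF fvec.subspace_diff[OF subspace_K(1) that]] unfolding bad
    by (simp add: module_hom.diff[OF linmap_psi])
  show "psi p q (K_horizontal False x) = dh aromatic_bicomplex (Suc p) q (psi (Suc p) q x)" if "x \<in> K_space False (Suc p) q"
    using K_horizontal_in(2)[OF that] unfolding bad dh by simp
  show "psi p (Suc q) (lin K_diff x) = dv aromatic_bicomplex p q (psi p q x)" if "x \<in> K_space False p q"
    unfolding dv by (rule K_vertical_in(2)[OF that])
qed (rule is_bicomplex_aromatic subspace_K K_relations_subset linmap_lin K_horizontal_in K_vertical_in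
  | assumption | simp only: K_horizontal_def linmap_lin)+

text \<open>The target is itself a quotient, so \<open>psi\<close> is followed by the projection to
  cosets. That the loop forests span a subcomplex, and hence that the target is a bicomplex, comes
  from the stability of loops under new edges.\<close>

lemma divergence_free_isomorphic:
  "(divergence_free_aromatic_bicomplex :: (_, 'k::field_char_0) bicomplex) \<cong>\<^sub>b composite_K (ce True)"
proof -
  let ?V = "\<lambda>p q. fvec.span (alt_forests (\<lambda>_. True) p q) :: (forest_class \<Rightarrow>\<^sub>0 'k) set"
  let ?W = "\<lambda>p q. fvec.span (alt_forests (bad True) p q) :: (forest_class \<Rightarrow>\<^sub>0 'k) set"
  let ?dV = "\<lambda>(p :: nat) q (x :: forest_class \<Rightarrow>\<^sub>0 'k). skew_whites (Suc q) (whiten x)"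
  interpret A: bicomplex_presentation ?V ?W "\<lambda>p q. horizontal" ?dV
  proof (rule bicomplex_presentation.intro)
    fix p q and x :: "forest_class \<Rightarrow>\<^sub>0 'k"
    show "fvec.subspace (?V p q)" "fvec.subspace (?W p q)" by simp_all
    show "linmap (horizontal :: (forest_class \<Rightarrow>\<^sub>0 'k) \<Rightarrow> _)" by (rule linmap_horizontal)
    show "linmap (?dV p q)" by (rule linmap_comp[OF linmap_skew_whites linmap_whiten])
    show "horizontal x \<in> ?V p q" if "x \<in> ?V (Suc p) q" using that by (rule horizontal_alt_forests[OF edge_stable_True])
    show "horizontal x \<in> ?W p q" if "x \<in> ?W (Suc p) q" using that by (rule horizontal_alt_forests[OF edge_stable_bad])
    show "?dV p q x \<in> ?V p (Suc q)" if "x \<in> ?V p q" using that by (rule vertical_alt_forests)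
    show "?dV p q x \<in> ?W p (Suc q)" if "x \<in> ?W p q" using that by (rule vertical_alt_forests)
  qed
  have A_eq: "divergence_free_aromatic_bicomplex = A.Q"
  proof -
    have "bad True = has_loop" by (auto simp: bad_def)
    moreover have "Omega = ?V" by (intro ext) (rule Omega_eq)
    ultimately show ?thesis
      by (simp add: divergence_free_aromatic_bicomplex_def aromatic_bicomplex_def loop_classes_eq skew_forests_eq)
  qed
  have "is_bicomplex A.Q"
  proof (rule A.is_bicomplex_Q)
    fix p q and x :: "forest_class \<Rightarrow>\<^sub>0 'k"
    show "horizontal (horizontal x) \<in> ?W p q" if "x \<in> ?V (Suc (Suc p)) q"
      using horizontal_horizontal[OF that] by (simp add: fvec.span_zero)
    show "?dV p (Suc q) (?dV p q x) \<in> ?W p (Suc (Suc q))" if "x \<in> ?V p q"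
      using vertical_vertical[OF that] by (simp add: fvec.span_zero)
    show "horizontal (?dV (Suc p) q x) - ?dV p q (horizontal x) \<in> ?W p (Suc q)" if "x \<in> ?V (Suc p) q"
      using horizontal_vertical[OF that] by (simp add: fvec.span_zero)
  qed
  then show ?thesis
    unfolding A_eq composite_K_eq
  proof (rule quotient_isomorphic[where \<Psi> = "\<lambda>p q x. coset (?W p q) (psi p q x)"])
    fix p q and x y :: "nat \<times> nat tree_or_cycle list \<times> nat set \<Rightarrow>\<^sub>0 'k" and c :: 'k
    show "coset (?W p q) (psi p q x) \<in> carr A.Q p q" if "x \<in> K_space True p q"
      unfolding A.Q_carr by (rule imageI[OF psi_in_Omega[OF that]])
    show "coset (?W p q) (psi p q (x + y)) = add A.Q p q (coset (?W p q) (psi p q x)) (coset (?W p q) (psi p q y))"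
      unfolding A.Q_add module_hom.add[OF linmap_psi] ..
    show "coset (?W p q) (psi p q (fscale c x)) = scl A.Q p q c (coset (?W p q) (psi p q x))"
      unfolding A.Q_scl module_hom.scale[OF linmap_psi] ..
    show "\<exists>x\<in>K_space True p q. z = coset (?W p q) (psi p q x)" if z: "z \<in> carr A.Q p q" for z
    proof -
      obtain y where "y \<in> ?V p q" "z = coset (?W p q) y" using z unfolding A.Q_carr by blast
      then show ?thesis using psi_surjective[of y p q True] coset_eq_iff[OF A.W[of p q]] by blast
    qed
    show "coset (?W p q) (psi p q x) = coset (?W p q) (psi p q y) \<longleftrightarrow> x - y \<in> K_relations True p q"
      if "x \<in> K_space True p q" "y \<in> K_space True p q"
      using psi_kernel[OF fvec.subspace_diff[OF subspace_K(1) that]]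
      unfolding coset_eq_iff[OF A.W] module_hom.diff[OF linmap_psi] .
    show "coset (?W p q) (psi p q (K_horizontal True x)) = dh A.Q (Suc p) q (coset (?W (Suc p) q) (psi (Suc p) q x))"
      if "x \<in> K_space True (Suc p) q"
      unfolding A.Q_dh coset_eq_iff[OF A.W] by (rule K_horizontal_in(2)[OF that])
    show "coset (?W p (Suc q)) (psi p (Suc q) (lin K_diff x)) = dv A.Q p q (coset (?W p q) (psi p q x))"
      if "x \<in> K_space True p q"
      unfolding A.Q_dv K_vertical_in(2)[OF that] ..
  qed (rule subspace_K K_relations_subset linmap_lin K_horizontal_in K_vertical_in
    | assumption | simp only: K_horizontal_def linmap_lin)+
qed

theorem proposition6p3:
  shows "(aromatic_bicomplex :: (_, 'k::field_char_0) bicomplex)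
           \<cong>\<^sub>b composite_K (chevalley_eilenberg (lie_L :: (nat, _, 'k) dg_lie))
       \<and> (divergence_free_aromatic_bicomplex :: (_, 'k::field_char_0) bicomplex)
           \<cong>\<^sub>b composite_K (chevalley_eilenberg (lie_L_reduced :: (nat, _, 'k) dg_lie))"
  using aromatic_isomorphic[where 'k = 'k] divergence_free_isomorphic[where 'k = 'k]
  by (simp add: tree_lie_def)

end
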